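(* Call $x$ an $\epsilon$-stationary point if $\|\nabla h(x)\|\le\epsilon$, where $h$ is the objective of the problem considered. Let $q\in[0,1]$ denote a value decided by the without-replacement sampling strategy. (i) (Compositional optimization, algorithm WiOR-Comp.) Suppose that assumptions (A1)–(A4) of the context hold, that (A5) holds with some $\alpha$ and $C$ for the example order used, and that the step-size conditions (S) of the context hold. Then, for a suitable choice of the parameters allowed by (S), to reach an $\epsilon$-stationary point WiOR-Comp needs $O(\epsilon^{-4})$ examples if they are sampled independently, and $O((\max(m,n))^{q}\epsilon^{-3})$ examples if some random-permutation-based without-replacement sampling is used. (ii) (Minimax optimization, algorithm WiOR-MiniMax.) Suppose the same assumptions and conditions hold for the minimax problem, except that the bounded-gradient requirement in (A1) is not needed. Then, for a suitable choice of the parameters allowed by (S), to reach an $\epsilon$-stationary point WiOR-MiniMax needs $O(\epsilon^{-4})$ examples if they are sampled independently, and $O((\max(m,n))^{q}\epsilon^{-3})$ examples (here $n=m$) if some random-permutation-based without-replacement sampling is used. Here $O(\cdot)$ is big-O notation with logarithmic terms hidden.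
   Context: **Bilevel notation and assumptions.** For finite datasets $\mathcal D_u=\{\xi_i\}_{i\in[m]}$ and $\mathcal D_l=\{\zeta_j\}_{j\in[n]}$, let $f(x,y)=\frac1m\sum_i f(x,y;\xi_i)$, $g(x,y)=\frac1n\sum_j g(x,y;\zeta_j)$, $y_x=\arg\min_y g(x,y)$, $h(x)=f(x,y_x)$. (A1) Each $f(\cdot,\cdot;\xi)$ is possibly non-convex, $L$-smooth, and has $C_f$-bounded gradient with respect to $y$. (A2) Each $g(\cdot,\cdot;\zeta)$ is $\mu$-strongly convex in $y$ for any given $x$ and $L$-smooth; $\nabla_{xy}g(\cdot,\cdot;\zeta)$ and $\nabla_{y^2}g(\cdot,\cdot;\zeta)$ are Lipschitz continuous with constants $L_{xy}$ and $L_{y^2}$. (A3) $\|\nabla f(x,y;\xi_i)-\nabla f(x,y)\|\le A$ for all $i,x,y$. (A4) $\|\nabla g(x,y;\zeta_j)-\nabla g(x,y)\|\le A$ and $\|\nabla^2 g(x,y;\zeta_j)-\nabla^2 g(x,y)\|\le A$ for all $j,x,y$. (A5) (constants $\alpha,C$) With $\xi_t^\pi,\zeta_t^\pi$ the examples used at step $t$ and $(x_t,y_t)$ the iterate at step $t$, for every step $t$ and every $k>0$: $\big\|\frac1k\sum_{\tau=t}^{t+k-1}\nabla f(x_t,y_t;\xi_\tau^\pi)-\nabla f(x_t,y_t)\big\|^2\le k^{-\alpha}C^2$, and likewise with $\nabla g(\cdot,\cdot;\zeta_\tau^\pi)$ and with $\nabla^2 g(\cdot,\cdot;\zeta_\tau^\pi)$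 in place of $\nabla f(\cdot,\cdot;\xi_\tau^\pi)$. (S) The learning rates are constant, $\eta_t=\eta$, $\gamma_t=c_1\eta$, $\rho_t=c_2\eta$ (no $\rho_t$ in the minimax case); the total number of steps $T$ is written $T=E\times k$; and $\eta\le\frac{1}{k\tilde L_0}$. Here $c_1,c_2,\tilde L_0$ are constants related to the smoothness parameters of $h$. **Sampling.** "Sampled independently" means that the examples are selected independently at each step. "Random-permutation-based without-replacement sampling" means that the example order is a concatenation of permutations of the dataset, e.g. random-reshuffling (fresh random permutations are drawn) or shuffle-once (a single random permutation is drawn and reused). As consequences of the sampling scheme, independent sampling is taken to give (A5) with $\alpha=1$, $C=A$, and permutation-based sampling to give (A5) with $\alpha=2$, $C=(\max(m,n))^{q}A$. **Compositional problem.** $\min_x h(x)=\frac1m\sum_i f(r(x);\xi_i)$ with $r(x)=\frac1n\sum_j r(x;\zeta_j)$. It is the special case of the bilevel problem in which the outer function depends only on $y$ and the inner problem is $g(x,y)=\frac12\|y-r(x)\|^2$, with example functions $g(x,y;\zeta)=\frac12\|y-r(x;\zeta)\|^2$ (whose average equals $\frac12\|y-r(x)\|^2$ up to a term not depending on $y$); so $y_x=r(x)$ and $\nabla h(x)=\nabla r(x)u_x$ with $u_x=\nabla_y f(r(x))$. *WiOR-Comp*: $R$ epochs of $I=\mathrm{lcm}(m,n)$ steps, $T=R\times I$. The example order in each epoch is, for random-reshuffling, the concatenation of $I/m$ random permutations of $\mathcal D_u$ and of $I/n$ random permutations of $\mathcal D_l$. At the start of each epoch $u$ is replaced by its projection $\mathcal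 P_\iota(u)$ onto a ball of size $\iota$ (to keep $u_t$ bounded). Each step performs $y_{t+1}=(1-\gamma_t)y_t+\gamma_t r(x_t;\zeta_t^\pi)$, $u_{t+1}=(1-\rho_t)u_t+\rho_t\nabla_y f(y_t;\xi_t^\pi)$, $x_{t+1}=x_t-\eta_t\nabla r(x_t;\zeta_t^\pi)u_t$. **Minimax problem.** $\min_x h(x)$ with $h(x)=\max_y\frac1m\sum_i f(x,y;\xi_i)$. It is the special case of the bilevel problem with $g=-f$ (same dataset, $n=m$), and $\nabla h(x)=\nabla_x f(x,y_x)$. *WiOR-MiniMax*: $R$ epochs of $m$ steps, $T=R\times m$, the order in each epoch being a permutation of $\mathcal D_u$ for permutation-based sampling. Each step performs $y_{t+1}=y_t+\gamma_t\nabla_y f(x_t,y_t;\xi_t^\pi)$, $x_{t+1}=x_t-\eta_t\nabla_x f(x_t,y_t;\xi_t^\pi)$. *)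

theory Defs
  imports "HOL-Probability.Probability"
begin

section \<open>Gradients and second derivatives\<close>

definition grad :: "('a::real_inner \<Rightarrow> real) \<Rightarrow> 'a \<Rightarrow> 'a" where
  "grad F z = (THE D. GDERIV F z :> D)"

definition grad_x :: "('a::real_inner \<times> 'b::real_inner \<Rightarrow> real) \<Rightarrow> 'a \<times> 'b \<Rightarrow> 'a" where
  "grad_x F z = grad (\<lambda>x. F (x, snd z)) (fst z)"

definition grad_y :: "('a::real_inner \<times> 'b::real_inner \<Rightarrow> real) \<Rightarrow> 'a \<times> 'b \<Rightarrow> 'b" where
  "grad_y F z = grad (\<lambda>y. F (fst z, y)) (snd z)"

definition hess :: "('a::real_inner \<Rightarrow> real) \<Rightarrow> 'a \<Rightarrow> 'a \<Rightarrow>\<^sub>L 'a" where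
  "hess F z = Blinfun (frechet_derivative (grad F) (at z))"

text \<open>The mixed block is taken as the derivative in \<open>x\<close> of the gradient in \<open>y\<close>. In matrix
  notation it is the transpose of the block that maps \<open>y\<close>-directions to \<open>x\<close>-directions, so norms
  and Lipschitz constants are those of either convention.\<close>

definition hess_xy :: "('a::real_inner \<times> 'b::real_inner \<Rightarrow> real) \<Rightarrow> 'a \<times> 'b \<Rightarrow> 'a \<Rightarrow>\<^sub>L 'b" where
  "hess_xy F z = Blinfun (frechet_derivative (\<lambda>x. grad_y F (x, snd z)) (at (fst z)))"

definition hess_yy :: "('a::real_inner \<times> 'b::real_inner \<Rightarrow> real) \<Rightarrow> 'a \<times> 'b \<Rightarrow> 'b \<Rightarrow>\<^sub>L 'b" where
  "hess_yy F z = Blinfun (frechet_derivative (\<lambda>y. grad_y F (fst z, y)) (at (snd z)))"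

definition smooth_with :: "real \<Rightarrow> ('a::real_inner \<Rightarrow> real) \<Rightarrow> bool" where
  "smooth_with L F \<longleftrightarrow> (\<forall>z. F differentiable (at z)) \<and> L-lipschitz_on UNIV (grad F)"

definition strongly_convex :: "real \<Rightarrow> ('a::real_inner \<Rightarrow> real) \<Rightarrow> bool" where
  "strongly_convex \<mu> F \<longleftrightarrow> convex_on UNIV (\<lambda>y. F y - \<mu> / 2 * (norm y)\<^sup>2)"

definition stationary :: "real \<Rightarrow> ('a::real_inner \<Rightarrow> real) \<Rightarrow> 'a \<Rightarrow> bool" where
  "stationary \<epsilon> h x \<longleftrightarrow> (\<exists>D. GDERIV h x :> D \<and> norm D \<le> \<epsilon>)"

section \<open>Assumptions on the datasets\<close>

text \<open>A dataset of size \<open>m\<close> is represented by the family of its example functions, indexed by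
  \<open>{..<m}\<close>.\<close>

definition avg :: "nat \<Rightarrow> (nat \<Rightarrow> 'z \<Rightarrow> 'v::real_vector) \<Rightarrow> 'z \<Rightarrow> 'v" where
  "avg m F z = (1 / real m) *\<^sub>R (\<Sum>i<m. F i z)"

definition deviation_le ::
  "real \<Rightarrow> nat \<Rightarrow> (nat \<Rightarrow> 'z \<Rightarrow> 'v::real_normed_vector) \<Rightarrow> ('z \<Rightarrow> 'v) \<Rightarrow> bool" where
  "deviation_le A m F Fbar \<longleftrightarrow> (\<forall>i<m. \<forall>z. norm (F i z - Fbar z) \<le> A)"

definition assm_A1_smooth :: "real \<Rightarrow> nat \<Rightarrow> (nat \<Rightarrow> 'a::real_inner \<times> 'b::real_inner \<Rightarrow> real) \<Rightarrow> bool"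
  where "assm_A1_smooth L m f \<longleftrightarrow> (\<forall>i<m. smooth_with L (f i))"

definition assm_A1_bounded :: "real \<Rightarrow> nat \<Rightarrow> (nat \<Rightarrow> 'a::real_inner \<times> 'b::real_inner \<Rightarrow> real) \<Rightarrow> bool"
  where "assm_A1_bounded C\<^sub>f m f \<longleftrightarrow> (\<forall>i<m. \<forall>z. norm (grad_y (f i) z) \<le> C\<^sub>f)"

definition assm_A2 ::
  "real \<Rightarrow> real \<Rightarrow> real \<Rightarrow> real \<Rightarrow> nat \<Rightarrow> (nat \<Rightarrow> 'a::euclidean_space \<times> 'b::euclidean_space \<Rightarrow> real) \<Rightarrow> bool"
  where "assm_A2 \<mu> L L\<^sub>x\<^sub>y L\<^sub>y\<^sub>y n g \<longleftrightarrow> (\<forall>j<n.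
      (\<forall>x. strongly_convex \<mu> (\<lambda>y. g j (x, y))) \<and>
      smooth_with L (g j) \<and>
      (\<forall>z. grad (g j) differentiable (at z)) \<and>
      L\<^sub>x\<^sub>y-lipschitz_on UNIV (hess_xy (g j)) \<and> L\<^sub>y\<^sub>y-lipschitz_on UNIV (hess_yy (g j)))"

definition assm_A3 :: "real \<Rightarrow> nat \<Rightarrow> (nat \<Rightarrow> 'a::real_inner \<times> 'b::real_inner \<Rightarrow> real) \<Rightarrow> bool"
  where "assm_A3 A m f \<longleftrightarrow> deviation_le A m (\<lambda>i. grad (f i)) (grad (avg m f))"

definition assm_A4 :: "real \<Rightarrow> nat \<Rightarrow> (nat \<Rightarrow> 'a::real_inner \<times> 'b::real_inner \<Rightarrow> real) \<Rightarrow> bool"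
  where "assm_A4 A n g \<longleftrightarrow>
      deviation_le A n (\<lambda>j. grad (g j)) (grad (avg n g)) \<and>
      deviation_le A n (\<lambda>j. hess (g j)) (hess (avg n g))"

text \<open>The error bound on consecutive examples, along the points \<open>z t\<close> visited in a run of
  \<open>T\<close> steps whose order of examples is \<open>s\<close>. Only windows of examples that lie within the run
  are considered.\<close>

definition window_error_le ::
  "real \<Rightarrow> real \<Rightarrow> nat \<Rightarrow> (nat \<Rightarrow> nat) \<Rightarrow> (nat \<Rightarrow> 'z) \<Rightarrow> (nat \<Rightarrow> 'z \<Rightarrow> 'v::real_normed_vector) \<Rightarrow> ('z \<Rightarrow> 'v) \<Rightarrow> bool"
  where "window_error_le \<alpha> C T s z F Fbar \<longleftrightarrow> (\<forall>t k. 0 < k \<and> t + k \<le> T \<longrightarrow>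
      (norm ((1 / real k) *\<^sub>R (\<Sum>\<tau> = t..<t + k. F (s \<tau>) (z t)) - Fbar (z t)))\<^sup>2
        \<le> real k powr (- \<alpha>) * C\<^sup>2)"

definition assm_A5 ::
  "real \<Rightarrow> real \<Rightarrow> nat \<Rightarrow> nat \<Rightarrow> nat \<Rightarrow>
   (nat \<Rightarrow> 'a::euclidean_space \<times> 'b::euclidean_space \<Rightarrow> real) \<Rightarrow> (nat \<Rightarrow> 'a \<times> 'b \<Rightarrow> real) \<Rightarrow>
   (nat \<Rightarrow> nat) \<Rightarrow> (nat \<Rightarrow> nat) \<Rightarrow> (nat \<Rightarrow> 'a \<times> 'b) \<Rightarrow> bool"
  where "assm_A5 \<alpha> C T m n f g \<xi> \<zeta> z \<longleftrightarrow>
      window_error_le \<alpha> C T \<xi> z (\<lambda>i. grad (f i)) (grad (avg m f)) \<and>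
      window_error_le \<alpha> C T \<zeta> z (\<lambda>j. grad (g j)) (grad (avg n g)) \<and>
      window_error_le \<alpha> C T \<zeta> z (\<lambda>j. hess (g j)) (hess (avg n g))"

text \<open>For the compositional problem, joint smoothness of \<open>g(x,y) = \<parallel>y - r(x)\<parallel>\<^sup>2 / 2\<close> would force
  \<open>r\<close> to be affine, because the gradient of \<open>g\<close> in \<open>x\<close> is \<open>- \<nabla>r(x) (y - r(x))\<close> with \<open>y\<close>
  unbounded; a bound on the deviation of this gradient would moreover force all example maps to
  have the same Jacobian. Neither the algorithm nor the hypergradient involves the derivatives of
  the inner function other than \<open>\<nabla>\<^sub>y g\<close>, \<open>\<nabla>\<^sub>x\<^sub>y g\<close> and \<open>\<nabla>\<^sub>y\<^sub>y g\<close>. The following conditions are the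
  conditions above restricted to these, and are implied by them
  (\<open>assm_A2_inner\<close>, \<open>assm_A4_inner\<close>, \<open>assm_A5_inner\<close> below).\<close>

definition inner_A2 ::
  "real \<Rightarrow> real \<Rightarrow> real \<Rightarrow> real \<Rightarrow> nat \<Rightarrow> (nat \<Rightarrow> 'a::euclidean_space \<times> 'b::euclidean_space \<Rightarrow> real) \<Rightarrow> bool"
  where "inner_A2 \<mu> L L\<^sub>x\<^sub>y L\<^sub>y\<^sub>y n g \<longleftrightarrow> (\<forall>j<n.
      (\<forall>x. strongly_convex \<mu> (\<lambda>y. g j (x, y))) \<and>
      (\<forall>x y. (\<lambda>y. g j (x, y)) differentiable (at y)) \<and> L-lipschitz_on UNIV (grad_y (g j)) \<and>
      (\<forall>z. grad_y (g j) differentiable (at z)) \<and>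
      L\<^sub>x\<^sub>y-lipschitz_on UNIV (hess_xy (g j)) \<and> L\<^sub>y\<^sub>y-lipschitz_on UNIV (hess_yy (g j)))"

definition inner_A4 :: "real \<Rightarrow> nat \<Rightarrow> (nat \<Rightarrow> 'a::real_inner \<times> 'b::real_inner \<Rightarrow> real) \<Rightarrow> bool"
  where "inner_A4 A n g \<longleftrightarrow>
      deviation_le A n (\<lambda>j. grad_y (g j)) (grad_y (avg n g)) \<and>
      deviation_le A n (\<lambda>j. hess_xy (g j)) (hess_xy (avg n g)) \<and>
      deviation_le A n (\<lambda>j. hess_yy (g j)) (hess_yy (avg n g))"

definition inner_A5 ::
  "real \<Rightarrow> real \<Rightarrow> nat \<Rightarrow> nat \<Rightarrow> nat \<Rightarrow>
   (nat \<Rightarrow> 'a::euclidean_space \<times> 'b::euclidean_space \<Rightarrow> real) \<Rightarrow> (nat \<Rightarrow> 'a \<times> 'b \<Rightarrow> real) \<Rightarrow>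
   (nat \<Rightarrow> nat) \<Rightarrow> (nat \<Rightarrow> nat) \<Rightarrow> (nat \<Rightarrow> 'a \<times> 'b) \<Rightarrow> bool"
  where "inner_A5 \<alpha> C T m n f g \<xi> \<zeta> z \<longleftrightarrow>
      window_error_le \<alpha> C T \<xi> z (\<lambda>i. grad (f i)) (grad (avg m f)) \<and>
      window_error_le \<alpha> C T \<zeta> z (\<lambda>j. grad_y (g j)) (grad_y (avg n g)) \<and>
      window_error_le \<alpha> C T \<zeta> z (\<lambda>j. hess_xy (g j)) (hess_xy (avg n g)) \<and>
      window_error_le \<alpha> C T \<zeta> z (\<lambda>j. hess_yy (g j)) (hess_yy (avg n g))"

section \<open>Sampling\<close>

text \<open>\<open>S\<close> is the index set of the examples, or of the pairs of examples if each step uses one of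
  each of two datasets. Distinct steps are independent and each step selects an element of \<open>S\<close>;
  the distribution within a step is left free.\<close>

definition independent_sampling :: "'w measure \<Rightarrow> 's set \<Rightarrow> (nat \<Rightarrow> 'w \<Rightarrow> 's) \<Rightarrow> bool" where
  "independent_sampling M S s \<longleftrightarrow>
     prob_space M \<and> prob_space.indep_vars M (\<lambda>_. count_space S) s UNIV"

text \<open>A concatenation of arbitrary permutations of \<open>{..<m}\<close>; every outcome of random-reshuffling
  and of shuffle-once is one.\<close>

definition permutation_order :: "nat \<Rightarrow> (nat \<Rightarrow> nat) \<Rightarrow> bool" where
  "permutation_order m s \<longleftrightarrow> (\<forall>e. bij_betw (\<lambda>i. s (e * m + i)) {..<m} {..<m})"

text \<open>\<open>N = O(B)\<close> up to logarithmic factors, with explicit constants.\<close>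

definition soft_O_le :: "real \<Rightarrow> nat \<Rightarrow> real \<Rightarrow> nat \<Rightarrow> bool" where
  "soft_O_le K p B N \<longleftrightarrow> real N \<le> K * B * (1 + \<bar>ln B\<bar>) ^ p"

section \<open>The compositional problem\<close>

text \<open>The example functions of the bilevel problem that the compositional problem with outer
  functions \<open>f i\<close> and inner maps \<open>r j\<close> is a special case of.\<close>

definition comp_outer :: "(nat \<Rightarrow> 'b \<Rightarrow> real) \<Rightarrow> nat \<Rightarrow> 'a \<times> 'b \<Rightarrow> real" where
  "comp_outer f i = (\<lambda>(x, y). f i y)"

definition comp_inner :: "(nat \<Rightarrow> 'a \<Rightarrow> 'b::real_inner) \<Rightarrow> nat \<Rightarrow> 'a \<times> 'b \<Rightarrow> real" where
  "comp_inner r j = (\<lambda>(x, y). 1 / 2 * (norm (y - r j x))\<^sup>2)"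

definition comp_obj ::
  "nat \<Rightarrow> nat \<Rightarrow> (nat \<Rightarrow> 'b \<Rightarrow> real) \<Rightarrow> (nat \<Rightarrow> 'a \<Rightarrow> 'b::real_vector) \<Rightarrow> 'a \<Rightarrow> real" where
  "comp_obj m n f r x = avg m f (avg n r x)"

text \<open>\<open>\<nabla>r(x)\<close> is the transposed Jacobian, so \<open>\<nabla>r(x) u\<close> is the adjoint of the derivative of \<open>r\<close>
  at \<open>x\<close>, applied to \<open>u\<close>. The state before step \<open>t\<close> is \<open>(x\<^sub>t, y\<^sub>t, u\<^sub>t)\<close>, before the projection
  of \<open>u\<^sub>t\<close> if \<open>t\<close> is the first step of an epoch of \<open>I\<close> steps.\<close>

primrec wior_comp ::
  "(nat \<Rightarrow> 'b \<Rightarrow> real) \<Rightarrow> (nat \<Rightarrow> 'a::euclidean_space \<Rightarrow> 'b::euclidean_space) \<Rightarrow> nat \<Rightarrow> real \<Rightarrow>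
   real \<Rightarrow> real \<Rightarrow> real \<Rightarrow> (nat \<Rightarrow> nat) \<Rightarrow> (nat \<Rightarrow> nat) \<Rightarrow> 'a \<Rightarrow> 'b \<Rightarrow> 'b \<Rightarrow> nat \<Rightarrow> 'a \<times> 'b \<times> 'b"
where
  "wior_comp f r I \<iota> \<eta> \<gamma> \<rho> \<xi> \<zeta> x0 y0 u0 0 = (x0, y0, u0)"
| "wior_comp f r I \<iota> \<eta> \<gamma> \<rho> \<xi> \<zeta> x0 y0 u0 (Suc t) =
    (let (x, y, u') = wior_comp f r I \<iota> \<eta> \<gamma> \<rho> \<xi> \<zeta> x0 y0 u0 t;
         u = (if t mod I = 0 then closest_point (cball 0 \<iota>) u' else u')
     in (x - \<eta> *\<^sub>R adjoint (frechet_derivative (r (\<zeta> t)) (at x)) u,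
         (1 - \<gamma>) *\<^sub>R y + \<gamma> *\<^sub>R r (\<zeta> t) x,
         (1 - \<rho>) *\<^sub>R u + \<rho> *\<^sub>R grad (f (\<xi> t)) y))"

text \<open>Within the first \<open>N\<close> of the \<open>T\<close> steps an \<open>\<epsilon>\<close>-stationary point is reached, provided that
  the error bound with \<open>\<alpha>\<close> and \<open>C\<close> holds along the run.\<close>

definition comp_reaches ::
  "real \<Rightarrow> real \<Rightarrow> nat \<Rightarrow> nat \<Rightarrow> real \<Rightarrow> nat \<Rightarrow> nat \<Rightarrow> (nat \<Rightarrow> 'b \<Rightarrow> real) \<Rightarrow>
   (nat \<Rightarrow> 'a::euclidean_space \<Rightarrow> 'b::euclidean_space) \<Rightarrow> (nat \<Rightarrow> nat) \<Rightarrow> (nat \<Rightarrow> nat) \<Rightarrow>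
   (nat \<Rightarrow> 'a \<times> 'b \<times> 'b) \<Rightarrow> bool"
where
  "comp_reaches \<alpha> C T N \<epsilon> m n f r \<xi> \<zeta> w \<longleftrightarrow>
    (inner_A5 \<alpha> C T m n (comp_outer f) (comp_inner r) \<xi> \<zeta> (\<lambda>t. (fst (w t), fst (snd (w t)))) \<longrightarrow>
     (\<exists>t\<le>N. stationary \<epsilon> (comp_obj m n f r) (fst (w t))))"

section \<open>The minimax problem\<close>

definition minimax_obj :: "nat \<Rightarrow> (nat \<Rightarrow> 'a \<times> 'b \<Rightarrow> real) \<Rightarrow> 'a \<Rightarrow> real" where
  "minimax_obj m f x = (SUP y. avg m f (x, y))"

definition neg_fam :: "(nat \<Rightarrow> 'z \<Rightarrow> real) \<Rightarrow> nat \<Rightarrow> 'z \<Rightarrow> real" where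
  "neg_fam f i z = - f i z"

primrec wior_minimax ::
  "(nat \<Rightarrow> 'a::real_inner \<times> 'b::real_inner \<Rightarrow> real) \<Rightarrow> real \<Rightarrow> real \<Rightarrow> (nat \<Rightarrow> nat) \<Rightarrow> 'a \<Rightarrow> 'b \<Rightarrow>
   nat \<Rightarrow> 'a \<times> 'b"
where
  "wior_minimax f \<eta> \<gamma> \<xi> x0 y0 0 = (x0, y0)"
| "wior_minimax f \<eta> \<gamma> \<xi> x0 y0 (Suc t) =
    (let (x, y) = wior_minimax f \<eta> \<gamma> \<xi> x0 y0 t
     in (x - \<eta> *\<^sub>R grad_x (f (\<xi> t)) (x, y), y + \<gamma> *\<^sub>R grad_y (f (\<xi> t)) (x, y)))"

definition minimax_reaches ::
  "real \<Rightarrow> real \<Rightarrow> nat \<Rightarrow> nat \<Rightarrow> real \<Rightarrow> nat \<Rightarrow>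
   (nat \<Rightarrow> 'a::euclidean_space \<times> 'b::euclidean_space \<Rightarrow> real) \<Rightarrow> (nat \<Rightarrow> nat) \<Rightarrow>
   (nat \<Rightarrow> 'a \<times> 'b) \<Rightarrow> bool"
where
  "minimax_reaches \<alpha> C T N \<epsilon> m f \<xi> w \<longleftrightarrow>
    (assm_A5 \<alpha> C T m m f (neg_fam f) \<xi> \<xi> w \<longrightarrow>
     (\<exists>t\<le>N. stationary \<epsilon> (minimax_obj m f) (fst (w t))))"

section \<open>The restricted conditions follow from the full ones\<close>

lemma grad_eqI: "GDERIV F z :> D \<Longrightarrow> grad F z = D"
proof -
  assume D: "GDERIV F z :> D"
  have "E = D" if "GDERIV F z :> E" for E
  proof -
    have "(\<lambda>h. h \<bullet> E) = (\<lambda>h. h \<bullet> D)"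
      using that D unfolding gderiv_def by (rule has_derivative_unique)
    then have "h \<bullet> E = h \<bullet> D" for h by meson
    then show ?thesis by (metis inner_commute vector_eq_rdot)
  qed
  with D show ?thesis unfolding grad_def by blast
qed

lemma differentiable_imp_GDERIV:
  fixes F :: "'a::euclidean_space \<Rightarrow> real"
  assumes "F differentiable (at z)"
  shows "GDERIV F z :> grad F z"
proof -
  obtain F' where F': "(F has_derivative F') (at z)" using assms by (auto simp: differentiable_def)
  then have lin: "linear F'" by (rule has_derivative_linear)
  have "F' = (\<lambda>h. h \<bullet> adjoint F' 1)"
    using adjoint_works[OF lin, of _ 1] by (auto simp: fun_eq_iff inner_commute)
  with F' have "GDERIV F z :> adjoint F' 1" by (simp add: gderiv_def)
  then show ?thesis using grad_eqI by metis
qed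

lemma grad_y_eq_snd:
  fixes F :: "'a::euclidean_space \<times> 'b::euclidean_space \<Rightarrow> real"
  assumes "F differentiable (at z)"
  shows "(\<lambda>y. F (fst z, y)) differentiable (at (snd z))" "grad_y F z = snd (grad F z)"
proof -
  have *: "((\<lambda>y. F (fst z, y)) has_derivative (\<lambda>h. (0, h) \<bullet> grad F z)) (at (snd z))"
  proof -
    have "((\<lambda>y. (fst z, y)) has_derivative (\<lambda>h. (0, h))) (at (snd z))"
      by (intro has_derivative_Pair has_derivative_ident has_derivative_const)
    from has_derivative_compose[OF this, of F "\<lambda>h. h \<bullet> grad F z"]
    show ?thesis using differentiable_imp_GDERIV[OF assms] by (simp add: gderiv_def)
  qed
  then show "(\<lambda>y. F (fst z, y)) differentiable (at (snd z))" by (auto simp: differentiable_def)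
  have "(\<lambda>h. (0, h) \<bullet> grad F z) = (\<lambda>h. h \<bullet> snd (grad F z))"
    by (auto simp: fun_eq_iff inner_prod_def)
  with * have "GDERIV (\<lambda>y. F (fst z, y)) (snd z) :> snd (grad F z)" by (simp add: gderiv_def)
  then show "grad_y F z = snd (grad F z)" unfolding grad_y_def by (rule grad_eqI)
qed

definition block_xy :: "(('a::euclidean_space \<times> 'b::euclidean_space) \<Rightarrow>\<^sub>L ('a \<times> 'b)) \<Rightarrow> 'a \<Rightarrow>\<^sub>L 'b" where
  "block_xy H = Blinfun snd o\<^sub>L H o\<^sub>L Blinfun (\<lambda>h. (h, 0))"

definition block_yy :: "(('a::euclidean_space \<times> 'b::euclidean_space) \<Rightarrow>\<^sub>L ('a \<times> 'b)) \<Rightarrow> 'b \<Rightarrow>\<^sub>L 'b" where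
  "block_yy H = Blinfun snd o\<^sub>L H o\<^sub>L Blinfun (\<lambda>h. (0, h))"

lemma bounded_linear_embed:
  "bounded_linear (\<lambda>h. (h, 0))" "bounded_linear (\<lambda>h. (0, h))"
  by (auto intro!: bounded_linear_Pair bounded_linear_ident bounded_linear_zero)

lemma block_apply:
  "blinfun_apply (block_xy H) h = snd (blinfun_apply H (h, 0))"
  "blinfun_apply (block_yy H) k = snd (blinfun_apply H (0, k))"
  by (simp_all add: block_xy_def block_yy_def bounded_linear_Blinfun_apply bounded_linear_snd
      bounded_linear_embed)

lemma linear_block: "linear block_xy" "linear block_yy"
  by (auto intro!: linearI blinfun_eqI simp: block_apply blinfun.bilinear_simps)

lemma norm_block: "norm (block_xy H) \<le> norm H" "norm (block_yy H) \<le> norm H"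
proof -
  have snd: "norm (snd v) \<le> norm v" for v :: "'a \<times> 'b" by (metis norm_snd_le prod.collapse)
  have "norm (snd (blinfun_apply H v)) \<le> norm H * norm v" for v
    by (rule order_trans[OF snd norm_blinfun])
  then show "norm (block_xy H) \<le> norm H" "norm (block_yy H) \<le> norm H"
    by (auto intro!: norm_blinfun_bound simp: block_apply, (metis norm_Pair2 norm_Pair1)+)
qed

lemma hess_blocks:
  fixes F :: "'a::euclidean_space \<times> 'b::euclidean_space \<Rightarrow> real"
  assumes F: "\<And>z. F differentiable (at z)" and F2: "grad F differentiable (at z)"
  shows "hess_xy F z = block_xy (hess F z)" "hess_yy F z = block_yy (hess F z)"
proof -
  have gy: "grad_y F = (\<lambda>z. snd (grad F z))" using grad_y_eq_snd(2)[OF F] by blast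
  let ?D = "frechet_derivative (grad F) (at z)"
  have D: "(grad F has_derivative ?D) (at z)" using F2 by (simp add: frechet_derivative_works)
  then have hess: "blinfun_apply (hess F z) = ?D"
    unfolding hess_def by (simp add: bounded_linear_Blinfun_apply has_derivative_bounded_linear)
  have 1: "((\<lambda>x. grad_y F (x, snd z)) has_derivative blinfun_apply (block_xy (hess F z))) (at (fst z))"
  proof -
    have "((\<lambda>x. grad F (x, snd z)) has_derivative (\<lambda>h. ?D (h, 0))) (at (fst z))"
    proof -
      have "((\<lambda>x. (x, snd z)) has_derivative (\<lambda>h. (h, 0))) (at (fst z))"
        by (intro has_derivative_Pair has_derivative_ident has_derivative_const)
      from has_derivative_compose[OF this, of "grad F" ?D] D show ?thesis by simp
    qed
    then show ?thesis unfolding gy block_apply hess by (rule has_derivative_snd)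
  qed
  have 2: "((\<lambda>y. grad_y F (fst z, y)) has_derivative blinfun_apply (block_yy (hess F z))) (at (snd z))"
  proof -
    have "((\<lambda>y. grad F (fst z, y)) has_derivative (\<lambda>h. ?D (0, h))) (at (snd z))"
    proof -
      have "((\<lambda>y. (fst z, y)) has_derivative (\<lambda>h. (0, h))) (at (snd z))"
        by (intro has_derivative_Pair has_derivative_ident has_derivative_const)
      from has_derivative_compose[OF this, of "grad F" ?D] D show ?thesis by simp
    qed
    then show ?thesis unfolding gy block_apply hess by (rule has_derivative_snd)
  qed
  show "hess_xy F z = block_xy (hess F z)" "hess_yy F z = block_yy (hess F z)"
    unfolding hess_xy_def hess_yy_def frechet_derivative_at[OF 1, symmetric]
      frechet_derivative_at[OF 2, symmetric] by (simp_all add: blinfun_apply_inverse)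
qed

lemma deviation_le_map:
  assumes "deviation_le A m F Fbar" "linear P" "\<And>v. norm (P v) \<le> norm v"
    and "\<And>i z. i < m \<Longrightarrow> F' i z = P (F i z)" "\<And>z. Fbar' z = P (Fbar z)"
  shows "deviation_le A m F' Fbar'"
  using assms unfolding deviation_le_def by (metis linear_diff order_trans)

lemma window_error_le_map:
  assumes "window_error_le \<alpha> C T s z F Fbar" "linear P" "\<And>v. norm (P v) \<le> norm v"
    and "\<And>t. t < T \<Longrightarrow> s t < m"
    and "\<And>i z. i < m \<Longrightarrow> F' i z = P (F i z)" "\<And>z. Fbar' z = P (Fbar z)"
  shows "window_error_le \<alpha> C T s z F' Fbar'"
  unfolding window_error_le_def
proof (intro allI impI)
  fix t k assume tk: "0 < k \<and> t + k \<le> T"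
  let ?v = "(1 / real k) *\<^sub>R (\<Sum>\<tau> = t..<t + k. F (s \<tau>) (z t)) - Fbar (z t)"
  have "(\<Sum>\<tau> = t..<t + k. F' (s \<tau>) (z t)) = (\<Sum>\<tau> = t..<t + k. P (F (s \<tau>) (z t)))"
    using assms(4,5) tk by (intro sum.cong) auto
  then have eq: "(1 / real k) *\<^sub>R (\<Sum>\<tau> = t..<t + k. F' (s \<tau>) (z t)) - Fbar' (z t) = P ?v"
    by (simp add: assms(6) linear_diff[OF assms(2)] linear_cmul[OF assms(2)] linear_sum[OF assms(2)])
  have "(norm (P ?v))\<^sup>2 \<le> (norm ?v)\<^sup>2" by (intro power_mono assms(3)) simp
  also have "\<dots> \<le> real k powr (- \<alpha>) * C\<^sup>2"
    using assms(1) tk unfolding window_error_le_def by blast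
  finally show "(norm ((1 / real k) *\<^sub>R (\<Sum>\<tau> = t..<t + k. F' (s \<tau>) (z t)) - Fbar' (z t)))\<^sup>2
        \<le> real k powr (- \<alpha>) * C\<^sup>2"
    by (simp only: eq)
qed

lemma assm_A2_diff:
  assumes "assm_A2 \<mu> L L\<^sub>x\<^sub>y L\<^sub>y\<^sub>y n g" "j < n"
  shows "\<And>z. g j differentiable (at z)" "\<And>z. grad (g j) differentiable (at z)"
  using assms by (auto simp: assm_A2_def smooth_with_def)

lemma assm_A2_avg_diff:
  assumes A2: "assm_A2 \<mu> L L\<^sub>x\<^sub>y L\<^sub>y\<^sub>y n g"
  shows "\<And>z. avg n g differentiable (at z)" "\<And>z. grad (avg n g) differentiable (at z)"
proof -
  have "GDERIV (avg n g) z :> (1 / real n) *\<^sub>R (\<Sum>j<n. grad (g j) z)" for z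
  proof -
    have "((\<lambda>z. (1 / real n) *\<^sub>R (\<Sum>j<n. g j z)) has_derivative
        (\<lambda>h. (1 / real n) *\<^sub>R (\<Sum>j<n. h \<bullet> grad (g j) z))) (at z)"
      using differentiable_imp_GDERIV[OF assm_A2_diff(1)[OF A2]] unfolding gderiv_def
      by (intro has_derivative_scaleR_right has_derivative_sum) auto
    then show ?thesis unfolding gderiv_def avg_def[abs_def] by (simp add: inner_sum_right)
  qed
  note G = this
  then show "avg n g differentiable (at z)" for z unfolding gderiv_def differentiable_def by blast
  have "grad (avg n g) = (\<lambda>z. (1 / real n) *\<^sub>R (\<Sum>j<n. grad (g j) z))"
    using grad_eqI[OF G] by blast
  then show "grad (avg n g) differentiable (at z)" for z
    using assm_A2_diff(2)[OF A2] by (auto intro!: differentiable_scaleR differentiable_sum)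
qed

lemma linear_norm_snd:
  "linear (snd :: 'a::real_normed_vector \<times> 'b::real_normed_vector \<Rightarrow> 'b)"
  "norm (snd v) \<le> norm v" for v :: "'a::real_normed_vector \<times> 'b::real_normed_vector"
proof -
  show "linear (snd :: 'a \<times> 'b \<Rightarrow> 'b)" by (rule bounded_linear.linear[OF bounded_linear_snd])
  show "norm (snd v) \<le> norm v" by (metis norm_snd_le prod.collapse)
qed

lemma assm_A2_inner:
  assumes A2: "assm_A2 \<mu> L L\<^sub>x\<^sub>y L\<^sub>y\<^sub>y n g"
  shows "inner_A2 \<mu> L L\<^sub>x\<^sub>y L\<^sub>y\<^sub>y n g"
proof -
  have "(\<forall>x y. (\<lambda>y. g j (x, y)) differentiable (at y)) \<and> L-lipschitz_on UNIV (grad_y (g j)) \<and>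
      (\<forall>z. grad_y (g j) differentiable (at z))" if j: "j < n" for j
  proof (intro conjI allI)
    note d = assm_A2_diff[OF A2 j]
    have gy: "grad_y (g j) = (\<lambda>z. snd (grad (g j) z))" using grad_y_eq_snd(2)[OF d(1)] by blast
    show "(\<lambda>y. g j (x, y)) differentiable (at y)" for x y
      using grad_y_eq_snd(1)[OF d(1), of "(x, y)"] by simp
    have L: "L-lipschitz_on UNIV (grad (g j))" using A2 j by (auto simp: assm_A2_def smooth_with_def)
    show "L-lipschitz_on UNIV (grad_y (g j))"
      unfolding gy using L by (auto simp: lipschitz_on_def intro: order_trans[OF dist_snd_le])
    show "grad_y (g j) differentiable (at z)" for z
      unfolding gy using d(2)[of z] by (auto simp: differentiable_def intro: has_derivative_snd)
  qed
  with A2 show ?thesis unfolding assm_A2_def inner_A2_def by blast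
qed

lemma assm_A4_inner:
  assumes A2: "assm_A2 \<mu> L L\<^sub>x\<^sub>y L\<^sub>y\<^sub>y n g" and A4: "assm_A4 A n g"
  shows "inner_A4 A n g"
proof -
  note d = assm_A2_diff[OF A2] and da = assm_A2_avg_diff[OF A2]
  from A4 have 1: "deviation_le A n (\<lambda>j. grad (g j)) (grad (avg n g))"
    and 2: "deviation_le A n (\<lambda>j. hess (g j)) (hess (avg n g))" by (auto simp: assm_A4_def)
  show ?thesis unfolding inner_A4_def
    by (intro conjI deviation_le_map[OF 1 linear_norm_snd] deviation_le_map[OF 2 linear_block(1) norm_block(1)]
        deviation_le_map[OF 2 linear_block(2) norm_block(2)] grad_y_eq_snd(2) hess_blocks d da)
qed

lemma assm_A5_inner:
  assumes A2: "assm_A2 \<mu> L L\<^sub>x\<^sub>y L\<^sub>y\<^sub>y n g" and A5: "assm_A5 \<alpha> C T m n f g \<xi> \<zeta> z"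
    and \<zeta>: "\<And>t. t < T \<Longrightarrow> \<zeta> t < n"
  shows "inner_A5 \<alpha> C T m n f g \<xi> \<zeta> z"
proof -
  note d = assm_A2_diff[OF A2] and da = assm_A2_avg_diff[OF A2]
  from A5 have 1: "window_error_le \<alpha> C T \<zeta> z (\<lambda>j. grad (g j)) (grad (avg n g))"
    and 2: "window_error_le \<alpha> C T \<zeta> z (\<lambda>j. hess (g j)) (hess (avg n g))"
    and 0: "window_error_le \<alpha> C T \<xi> z (\<lambda>i. grad (f i)) (grad (avg m f))" by (auto simp: assm_A5_def)
  show ?thesis unfolding inner_A5_def
    by (intro conjI 0 window_error_le_map[OF 1 linear_norm_snd \<zeta>]
        window_error_le_map[OF 2 linear_block(1) norm_block(1) \<zeta>]
        window_error_le_map[OF 2 linear_block(2) norm_block(2) \<zeta>] grad_y_eq_snd(2) hess_blocks d da)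
qed

end

theory Submission
  imports Defs
begin

text \<open>With \<open>\<eta> = 1 / (k L0)\<close>, a window of \<open>k\<close> consecutive steps acts like a single step of the fixed
  length \<open>H = 1 / L0\<close> along the full-data field. The errors of all partial sums of the window are at
  most \<open>k \<delta>\<close> with \<open>\<delta> = k powr (- \<alpha> / 2) * C\<close>, since \<open>l powr (1 - \<alpha> / 2)\<close> increases in \<open>l\<close>, and the
  drift within the window is of relative size \<open>H\<close>. So everything reduces to a deterministic
  two-timescale argument: if \<open>c1\<close> and \<open>c2\<close> are large, the tracking error \<open>d\<close> of the auxiliary variables
  contracts faster than the target moves with \<open>x\<close>, and \<open>h + \<nu> d\<^sup>2\<close> decreases by
  \<open>H / 4 * \<parallel>\<nabla>h\<parallel>\<^sup>2 - O(\<delta>\<^sup>2)\<close> per window. Hence \<open>O(1 / \<epsilon>\<^sup>2)\<close> windows suffice once \<open>\<delta>\<close> is a small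
  multiple of \<open>\<epsilon>\<close>, that is, with \<open>k\<close> of order \<open>C\<^sup>2 / \<epsilon>\<^sup>2\<close> for \<open>\<alpha> = 1\<close> and \<open>C / \<epsilon>\<close> for \<open>\<alpha> = 2\<close>. No
  logarithmic factor arises.\<close>

section \<open>Smoothness and strong convexity\<close>

text \<open>The requirements on the two time scales pull against each other: tracking needs
  \<open>c\<close> large, but \<open>c\<close> enters the Lipschitz constant \<Lambda> of the joint
  field and hence the drift within a window. They decouple because the rate required of
  \<open>c\<close> involves only smoothness constants and never H: \<open>b\<close> is fixed before
  \<open>c\<close>, \<open>c\<close> before \<Lambda>, and \<open>L0\<close> last, so that
  \<open>H * \<Lambda>\<close> is small. None of these depends on k, \<alpha>, C or \<epsilon>,
  which leaves k and the number of windows free for the sampling scheme. This is also why the window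
  error keeps the form \<open>\<delta> + \<kappa> * (g + K1 * d + \<delta>)\<close> with \<kappa>
  proportional to H: \<open>K1\<close> contains \<open>c\<close>, and only \<kappa> can compensate
  for it. The joint field of the compositional problem contains the bilinear term
  \<open>transp (J x) u\<close>, Lipschitz only where u is bounded; the projection radius \<iota>,
  at least the gradient bound, supplies this. In both problems the gradient of h is read off a
  two-sided quadratic remainder bound, the same one that gives descent.\<close>

lemma lipschitz_derivative_remainder:
  fixes F :: "'a::real_normed_vector \<Rightarrow> 'b::real_normed_vector"
  assumes deriv: "\<And>z. (F has_derivative F' z) (at z)"
    and lip: "\<And>z w h. norm (F' w h - F' z h) \<le> K * norm (w - z) * norm h" and "0 \<le> K"
  shows "norm (F w - F z - F' z (w - z)) \<le> K * (norm (w - z))\<^sup>2"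
proof -
  let ?S = "(\<lambda>t. z + t *\<^sub>R (w - z)) ` {0..1}"
  \<comment> \<open>On the segment the derivative differs from \<open>F' z\<close> by at most
    \<open>K * norm (w - z)\<close>. This gives K where integration would give K / 2; the difference
    only enlarges \<open>L0\<close>.\<close>
  have "norm (F w - F z - F' z (w - z)) \<le> norm (w - z) * (K * norm (w - z))"
  proof (rule differentiable_bound_linearization[where S = ?S])
    fix x assume "x \<in> ?S"
    then obtain t where t: "t \<in> {0..1}" "x = z + t *\<^sub>R (w - z)" by auto
    then have "norm (x - z) \<le> norm (w - z)" by (simp add: mult_left_le_one_le)
    then have *: "K * norm (x - z) * norm h \<le> K * norm (w - z) * norm h" for h :: 'a
      using \<open>0 \<le> K\<close> by (intro mult_right_mono mult_left_mono) auto
    show "onorm (F' x - F' z) \<le> K * norm (w - z)"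
      using order_trans[OF lip *] \<open>0 \<le> K\<close> by (intro onorm_bound) (auto simp: fun_diff_def)
  qed (use deriv in \<open>auto intro: has_derivative_at_withinI image_eqI[of _ _ 0]\<close>)
  then show ?thesis by (simp add: power2_eq_square mult_ac)
qed

lemma lipschitz_gradient_remainder:
  fixes F :: "'a::real_inner \<Rightarrow> real"
  assumes "\<And>z. GDERIV F z :> G z" and lip: "L-lipschitz_on UNIV G"
  shows "\<bar>F w - F z - (w - z) \<bullet> G z\<bar> \<le> L * (norm (w - z))\<^sup>2"
proof -
  have "norm (h \<bullet> G w - h \<bullet> G z) \<le> L * norm (w - z) * norm h" for z w h
  proof -
    have "norm (h \<bullet> G w - h \<bullet> G z) \<le> norm h * norm (G w - G z)"
      by (metis inner_diff_right real_norm_def Cauchy_Schwarz_ineq2)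
    also have "\<dots> \<le> norm h * (L * norm (w - z))"
      using lip by (intro mult_left_mono) (auto simp: lipschitz_on_def dist_norm)
    finally show ?thesis by (simp add: mult_ac)
  qed
  then show ?thesis
    using lipschitz_derivative_remainder[of F "\<lambda>z h. h \<bullet> G z" L w z] assms
    by (auto simp: gderiv_def lipschitz_on_def)
qed

text \<open>Dividing by \<open>norm (w - z)\<close> leaves \<open>K * norm (w - z)\<close>, which
  tends to 0. Both objectives obtain their gradient from this.\<close>

lemma GDERIV_quadratic_remainder:
  fixes F :: "'a::real_inner \<Rightarrow> real"
  assumes rem: "\<And>w. \<bar>F w - F z - (w - z) \<bullet> D\<bar> \<le> K * (norm (w - z))\<^sup>2"
  shows "GDERIV F z :> D"
  unfolding gderiv_def has_derivative_at_within
proof (intro conjI)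
  show "bounded_linear (\<lambda>h. h \<bullet> D)" by (rule bounded_linear_inner_left)
  have "((\<lambda>y. K * norm (y - z)) \<longlongrightarrow> 0) (at z)"
    by (rule tendsto_eq_intros | simp)+
  then show "((\<lambda>y. (F y - F z - (y - z) \<bullet> D) /\<^sub>R norm (y - z)) \<longlongrightarrow> 0) (at z)"
  proof (rule Lim_null_comparison[rotated])
    have "norm ((F y - F z - (y - z) \<bullet> D) /\<^sub>R norm (y - z)) \<le> K * norm (y - z)" if "y \<noteq> z" for y
      using rem[of y] that by (simp add: divide_simps power2_eq_square mult_ac)
    then show "\<forall>\<^sub>F y in at z. norm ((F y - F z - (y - z) \<bullet> D) /\<^sub>R norm (y - z)) \<le> K * norm (y - z)"
      by (auto simp: eventually_at_filter)
  qed
qed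

text \<open>Along the segment, F minus its quadratic part is convex in one real variable, so it lies
  above its tangent at 0. The quadratic terms then recombine by expanding the squared norm of
  \<open>y' = y + (y' - y)\<close>.\<close>

lemma strongly_convex_above_tangent:
  fixes F :: "'a::real_inner \<Rightarrow> real"
  assumes sc: "strongly_convex \<mu> F" and G: "GDERIV F y :> G"
  shows "F y + (y' - y) \<bullet> G + \<mu> / 2 * (norm (y' - y))\<^sup>2 \<le> F y'"
proof -
  let ?q = "\<lambda>y. F y - \<mu> / 2 * (norm y)\<^sup>2"
  let ?l = "\<lambda>t. y + t *\<^sub>R (y' - y)"
  have line: "?l ((1 - s) *\<^sub>R a + s *\<^sub>R b) = (1 - s) *\<^sub>R ?l a + s *\<^sub>R ?l b" for s a b :: real
    by (simp add: algebra_simps)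
  have "convex_on UNIV (\<lambda>t. ?q (?l t))"
  proof (rule convex_onI)
    fix s a b :: real assume "0 < s" "s < 1"
    then show "?q (?l ((1 - s) *\<^sub>R a + s *\<^sub>R b)) \<le> (1 - s) * ?q (?l a) + s * ?q (?l b)"
      unfolding line using sc unfolding strongly_convex_def by (intro convex_onD) auto
  qed simp
  moreover have "((\<lambda>t. ?q (?l t)) has_real_derivative ((y' - y) \<bullet> G - \<mu> * ((y' - y) \<bullet> y))) (at 0)"
  proof -
    have 1: "(?l has_derivative (\<lambda>t. t *\<^sub>R (y' - y))) (at 0)"
      by (auto intro!: derivative_eq_intros)
    have "((\<lambda>t. F (?l t)) has_derivative (\<lambda>t. (t *\<^sub>R (y' - y)) \<bullet> G)) (at 0)"
      using has_derivative_compose[OF 1, of F "\<lambda>h. h \<bullet> G"] G by (simp add: gderiv_def)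
    moreover have "((\<lambda>t. (norm (?l t))\<^sup>2) has_derivative (\<lambda>t. 2 * ((t *\<^sub>R (y' - y)) \<bullet> y))) (at 0)"
      unfolding power2_norm_eq_inner by (auto intro!: derivative_eq_intros simp: inner_commute)
    ultimately have "((\<lambda>t. ?q (?l t)) has_derivative
        (\<lambda>t. (t *\<^sub>R (y' - y)) \<bullet> G - \<mu> / 2 * (2 * ((t *\<^sub>R (y' - y)) \<bullet> y)))) (at 0)"
      by (intro has_derivative_diff has_derivative_mult_right)
    then show ?thesis
      unfolding has_field_derivative_def by (rule has_derivative_eq_rhs) (auto simp: algebra_simps)
  qed
  ultimately have "?q (?l 1) - ?q (?l 0) \<ge> ((y' - y) \<bullet> G - \<mu> * ((y' - y) \<bullet> y)) * (1 - 0)"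
    by (intro convex_on_imp_above_tangent) auto
  moreover have "\<mu> * ((norm y')\<^sup>2 - (norm y)\<^sup>2) = \<mu> * ((norm (y' - y))\<^sup>2 + 2 * ((y' - y) \<bullet> y))"
    unfolding power2_norm_eq_inner by (simp add: algebra_simps inner_commute)
  ultimately show ?thesis by (simp add: algebra_simps)
qed

section \<open>Windows of consecutive steps\<close>

text \<open>A bootstrap: as long as the states stay within B of the start, replacing
  \<open>F j (z j)\<close> by \<open>F j (z 0)\<close> costs at most \<open>\<Lambda> * B\<close> in
  each step; by \<open>2 * H * \<Lambda> \<le> 1\<close> the total cost is at most B / 2, which
  keeps the next state within B. The window hypothesis concerns all partial sums because the
  intermediate states have to be controlled too.\<close>

lemma window_drift:
  fixes z :: "nat \<Rightarrow> 'v::real_normed_vector"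
  assumes step: "\<And>j. j < k \<Longrightarrow> z (Suc j) = z j + \<eta> *\<^sub>R F j (z j)"
    and lip: "\<And>j. j < k \<Longrightarrow> norm (F j (z j) - F j (z 0)) \<le> \<Lambda> * norm (z j - z 0)"
    and window: "\<And>l. l \<le> k \<Longrightarrow> norm ((\<Sum>j<l. F j (z 0)) - real l *\<^sub>R Fb) \<le> real k * \<delta>"
    and "0 \<le> \<eta>" "0 \<le> \<Lambda>" and small: "2 * (real k * \<eta>) * \<Lambda> \<le> 1"
  shows "norm (z k - z 0 - (real k * \<eta>) *\<^sub>R Fb)
      \<le> (real k * \<eta>) * (\<delta> + 2 * (real k * \<eta>) * \<Lambda> * (norm Fb + \<delta>))"
proof -
  define H where "H = real k * \<eta>"
  have "0 \<le> H" using assms by (simp add: H_def)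
  have sum: "z l = z 0 + \<eta> *\<^sub>R (\<Sum>j<l. F j (z j))" if "l \<le> k" for l
    using that by (induction l) (auto simp: step algebra_simps)
  \<comment> \<open>The empty partial sum yields this sign; \<delta> itself could be negative when k
    = 0.\<close>
  have "0 \<le> real k * \<delta>" using window[of 0] by simp
  \<comment> \<open>B solves \<open>H * \<delta> + B / 2 + H * norm Fb = B\<close>, which is the
    equation that closes the induction.\<close>
  define B where "B = 2 * H * (norm Fb + \<delta>)"
  have "0 \<le> \<eta> * (real k * \<delta>)" using \<open>0 \<le> real k * \<delta>\<close> \<open>0 \<le> \<eta>\<close> by (rule mult_nonneg_nonneg[rotated])
  then have "0 \<le> H * \<delta>" by (simp add: H_def mult_ac)
  then have "0 \<le> B" using \<open>0 \<le> H\<close> by (simp add: B_def algebra_simps)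
  have err: "norm (z l - z 0 - (real l * \<eta>) *\<^sub>R Fb) \<le> H * \<delta> + H * \<Lambda> * B"
    if l: "l \<le> k" and B: "\<And>j. j < l \<Longrightarrow> norm (z j - z 0) \<le> B" for l
  proof -
    have "z l - z 0 - (real l * \<eta>) *\<^sub>R Fb = \<eta> *\<^sub>R (((\<Sum>j<l. F j (z 0)) - real l *\<^sub>R Fb)
        + (\<Sum>j<l. F j (z j) - F j (z 0)))"
      unfolding sum[OF l] by (simp add: algebra_simps sum_subtractf)
    also have "norm \<dots> \<le> \<eta> * (real k * \<delta> + (\<Sum>j<l. \<Lambda> * B))"
    proof -
      have "norm (\<Sum>j<l. F j (z j) - F j (z 0)) \<le> (\<Sum>j<l. \<Lambda> * B)"
      proof (rule sum_norm_le)
        fix j assume "j \<in> {..<l}"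
        then have "norm (F j (z j) - F j (z 0)) \<le> \<Lambda> * norm (z j - z 0)" using l by (intro lip) auto
        also have "\<dots> \<le> \<Lambda> * B" using \<open>j \<in> _\<close> B \<open>0 \<le> \<Lambda>\<close> by (intro mult_left_mono) auto
        finally show "norm (F j (z j) - F j (z 0)) \<le> \<Lambda> * B" .
      qed
      then have "norm (((\<Sum>j<l. F j (z 0)) - real l *\<^sub>R Fb) + (\<Sum>j<l. F j (z j) - F j (z 0)))
          \<le> real k * \<delta> + (\<Sum>j<l. \<Lambda> * B)"
        using window[OF l] by (intro norm_triangle_le add_mono) 
      then show ?thesis using \<open>0 \<le> \<eta>\<close> by (simp add: mult_left_mono)
    qed
    also have "\<dots> \<le> \<eta> * (real k * \<delta> + real k * (\<Lambda> * B))"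
      using l \<open>0 \<le> \<eta>\<close> \<open>0 \<le> \<Lambda>\<close> \<open>0 \<le> B\<close> by (intro mult_left_mono add_left_mono) (auto intro!: mult_right_mono)
    finally show ?thesis by (simp add: H_def algebra_simps)
  qed
  have "H * \<Lambda> * B \<le> B / 2" using mult_right_mono[OF small \<open>0 \<le> B\<close>] by (simp add: H_def)
  have B: "norm (z l - z 0) \<le> B" if "l \<le> k" for l
    using that
  proof (induction l rule: less_induct)
    case (less l)
    have "norm (z l - z 0 - (real l * \<eta>) *\<^sub>R Fb) \<le> H * \<delta> + B / 2"
      using err[OF less.prems] less \<open>H * \<Lambda> * B \<le> B / 2\<close> by fastforce
    moreover have "norm ((real l * \<eta>) *\<^sub>R Fb) \<le> H * norm Fb"
      using less.prems \<open>0 \<le> \<eta>\<close> unfolding H_def by (simp add: mult_right_mono)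
    ultimately have "norm (z l - z 0) \<le> H * \<delta> + B / 2 + H * norm Fb"
      using norm_triangle_ineq2[of "z l - z 0" "(real l * \<eta>) *\<^sub>R Fb"] by linarith
    moreover have "H * \<delta> + B / 2 + H * norm Fb = B" by (simp add: B_def algebra_simps add_divide_distrib)
    ultimately show ?case by linarith
  qed
  have "norm (z k - z 0 - H *\<^sub>R Fb) \<le> H * \<delta> + H * \<Lambda> * B"
    using err[of k] B by (simp add: H_def)
  then show ?thesis unfolding B_def H_def by (simp add: algebra_simps)
qed

text \<open>The case \<alpha> = 2 is the limit of the argument: there the bound on the unnormalised
  error does not grow with l at all. For larger \<alpha> the bound for a short prefix would exceed
  the one for the whole window.\<close>

lemma window_error_partial_sum:
  assumes win: "window_error_le \<alpha> C T s z F Fbar" and \<alpha>: "\<alpha> \<le> 2"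
    and T: "t + k \<le> T" and l: "l \<le> k"
  shows "norm ((\<Sum>j<l. F (s (t + j)) (z t)) - real l *\<^sub>R Fbar (z t))
      \<le> real k * (real k powr (- \<alpha> / 2) * \<bar>C\<bar>)"
proof (cases "l = 0")
  case False
  let ?S = "\<Sum>j<l. F (s (t + j)) (z t)"
  have *: "real i * real i powr (- \<alpha> / 2) = real i powr (1 - \<alpha> / 2)" if "0 < i" for i
    using that by (simp add: powr_diff powr_minus_divide)
  have "(\<Sum>\<tau> = t..<t + l. F (s \<tau>) (z t)) = ?S"
    using sum.shift_bounds_nat_ivl[of "\<lambda>\<tau>. F (s \<tau>) (z t)" 0 t l] by (simp add: add.commute atLeast0LessThan)
  moreover have "0 < l \<and> t + l \<le> T" using False l T by auto
  ultimately have "(norm ((1 / real l) *\<^sub>R ?S - Fbar (z t)))\<^sup>2 \<le> real l powr (- \<alpha>) * C\<^sup>2"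
    using win[unfolded window_error_le_def, rule_format, of l t] by simp
  also have "\<dots> = (real l powr (- \<alpha> / 2) * \<bar>C\<bar>)\<^sup>2"
    by (simp add: power_mult_distrib power2_eq_square[of "_ powr _"] flip: powr_add)
  finally have "norm ((1 / real l) *\<^sub>R ?S - Fbar (z t)) \<le> real l powr (- \<alpha> / 2) * \<bar>C\<bar>"
    by (rule power2_le_imp_le) simp
  then have "real l * norm ((1 / real l) *\<^sub>R ?S - Fbar (z t)) \<le> real l * (real l powr (- \<alpha> / 2) * \<bar>C\<bar>)"
    by (rule mult_left_mono) simp
  moreover have "real l * norm ((1 / real l) *\<^sub>R ?S - Fbar (z t)) = norm (?S - real l *\<^sub>R Fbar (z t))"
  proof -
    have "?S - real l *\<^sub>R Fbar (z t) = real l *\<^sub>R ((1 / real l) *\<^sub>R ?S - Fbar (z t))"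
      using False by (simp add: scaleR_diff_right)
    then show ?thesis by simp
  qed
  moreover have "real l * (real l powr (- \<alpha> / 2)) \<le> real k * real k powr (- \<alpha> / 2)"
    using *[of l] *[of k] False l \<alpha> by (auto intro!: powr_mono2)
  then have "real l * (real l powr (- \<alpha> / 2) * \<bar>C\<bar>) \<le> real k * (real k powr (- \<alpha> / 2) * \<bar>C\<bar>)"
    by (metis abs_ge_zero mult.assoc mult_right_mono)
  ultimately show ?thesis by linarith
qed simp

section \<open>The Lyapunov function\<close>

text \<open>The step shared by both problems, in real numbers: g is the gradient norm, d and d' are
  the tracking errors before and after a window, s is the move of x, E the drift error.
  \<open>K0\<close> measures how d spoils the direction of x, \<open>K1\<close> how d enlarges the
  field, \<open>K2\<close> how s moves the target, \<open>K3\<close> how E enters the tracking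
  error. \<beta> exceeds \<open>b\<close> by at least what the d-terms of s and E cost, so a net
  decay rate \<open>b\<close> remains; \<nu> is chosen so that \<open>\<nu> * b\<close> cancels the
  multiple of the squared d in the descent inequality.\<close>

lemma lyapunov_step:
  fixes g d \<delta> E s H h h' d' :: real
  assumes nonneg: "0 \<le> g" "0 \<le> d" "0 \<le> \<delta>" "0 \<le> d'" "0 \<le> s"
      "0 \<le> K0" "0 \<le> K1" "0 \<le> K2" "0 \<le> K3" "0 \<le> Lh" "0 < H" "0 \<le> \<kappa>"
    and b: "b = 10 * (K0 + 1) * (K2 + K3) + 1" and \<beta>: "K2 * (K0 + 1) + K3 + b \<le> \<beta>"
    and small: "16 * \<kappa> \<le> 1" "\<kappa> * K1 \<le> 1" "192 * Lh * H \<le> 1" "b * H \<le> 1"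
    and E: "E \<le> H * (\<delta> + \<kappa> * (g + K1 * d + \<delta>))"
    and s: "s \<le> H * (g + K0 * d) + E"
    and h': "h' \<le> h - H * g\<^sup>2 + g * (H * (K0 * d) + E) + Lh * s\<^sup>2"
    and d': "d' \<le> (1 - \<beta> * H) * d + K2 * s + K3 * E"
  defines "\<nu> \<equiv> 3 * (K0 + 1)\<^sup>2 / b"
  shows "h' + \<nu> * d'\<^sup>2 \<le> h + \<nu> * d\<^sup>2 - H / 4 * g\<^sup>2 + 10 * H * \<delta>\<^sup>2"
proof -
  define P where "P = 2 * (K2 + K3)"
  have "1 \<le> b" "0 \<le> P" using nonneg by (auto simp: b P_def)
  \<comment> \<open>Smallness of \<kappa> reduces its part of E to a sixteenth of g, one d and one
    more \<delta>.\<close>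
  have E': "E \<le> H * (2 * \<delta> + g / 16 + d)"
  proof -
    have "\<kappa> * g \<le> g / 16" "\<kappa> * \<delta> \<le> \<delta>" "\<kappa> * K1 * d \<le> d"
      using small mult_right_mono[of "16 * \<kappa>" 1 g] mult_right_mono[of \<kappa> 1 \<delta>] 
        mult_right_mono[of "\<kappa> * K1" 1 d] nonneg by auto
    then have "\<delta> + \<kappa> * (g + K1 * d + \<delta>) \<le> 2 * \<delta> + g / 16 + d" by (simp add: algebra_simps)
    with E show ?thesis using nonneg by (meson mult_left_mono order_trans less_imp_le)
  qed
  define X where "X = (K0 + 1) * d"
  have "0 \<le> X" using nonneg by (simp add: X_def)
  have s': "s \<le> H * (2 * g + X + 2 * \<delta>)"
  proof -
    have "H * g \<ge> 0" using nonneg by simp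
    then show ?thesis using s E' unfolding X_def by (simp add: algebra_simps)
  qed
  \<comment> \<open>Budget: of the available \<open>H * g\<^sup>2\<close> the curvature term takes
    1/16 and the mixed term 5/16, so more than 1/2 is left. A further 1/4 is spent on the tracking
    error below.\<close>
  have A: "h' \<le> h - H / 2 * g\<^sup>2 + 3 * H * X\<^sup>2 + 9 * H * \<delta>\<^sup>2"
  proof -
    have sq: "(2 * g + X + 2 * \<delta>)\<^sup>2 \<le> 12 * g\<^sup>2 + 3 * X\<^sup>2 + 12 * \<delta>\<^sup>2"
      using sum_squares_bound[of "2 * g" X] sum_squares_bound[of "2 * g" "2 * \<delta>"]
        sum_squares_bound[of "2 * \<delta>" X]
      by (simp add: power2_eq_square algebra_simps)
    have "s\<^sup>2 \<le> (H * (2 * g + X + 2 * \<delta>))\<^sup>2" using s' nonneg by (intro power_mono)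
    also have "\<dots> \<le> H\<^sup>2 * (12 * g\<^sup>2 + 3 * X\<^sup>2 + 12 * \<delta>\<^sup>2)"
      using sq by (simp add: power_mult_distrib mult_left_mono)
    finally have "Lh * s\<^sup>2 \<le> Lh * (H\<^sup>2 * (12 * g\<^sup>2 + 3 * X\<^sup>2 + 12 * \<delta>\<^sup>2))"
      using nonneg by (intro mult_left_mono)
    also have "\<dots> = (192 * Lh * H) * (H * (12 * g\<^sup>2 + 3 * X\<^sup>2 + 12 * \<delta>\<^sup>2) / 192)"
      by (simp add: power2_eq_square)
    also have "\<dots> \<le> 1 * (H * (12 * g\<^sup>2 + 3 * X\<^sup>2 + 12 * \<delta>\<^sup>2) / 192)"
      using small nonneg by (intro mult_right_mono) auto
    also have "\<dots> = 12 / 192 * (H * g\<^sup>2) + 3 / 192 * (H * X\<^sup>2) + 12 / 192 * (H * \<delta>\<^sup>2)"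
      by (simp add: field_simps)
    finally have 1: "Lh * s\<^sup>2 \<le> 12 / 192 * (H * g\<^sup>2) + 3 / 192 * (H * X\<^sup>2) + 12 / 192 * (H * \<delta>\<^sup>2)" .
    have "H * (K0 * d) + E \<le> H * (X + 2 * \<delta> + g / 16)"
      using E' by (simp add: X_def algebra_simps)
    then have "g * (H * (K0 * d) + E) \<le> g * (H * (X + 2 * \<delta> + g / 16))"
      using nonneg by (intro mult_left_mono)
    also have "\<dots> = H * (g * X + 2 * (g * \<delta>) + g\<^sup>2 / 16)"
      by (simp add: algebra_simps power2_eq_square)
    also have "\<dots> \<le> H * (g\<^sup>2 / 8 + 2 * X\<^sup>2 + (g\<^sup>2 / 8 + 8 * \<delta>\<^sup>2) + g\<^sup>2 / 16)"
    proof -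
      have "g * X \<le> g\<^sup>2 / 8 + 2 * X\<^sup>2" "2 * (g * \<delta>) \<le> g\<^sup>2 / 8 + 8 * \<delta>\<^sup>2"
        using zero_le_power2[of "g - 4 * X"] zero_le_power2[of "g - 8 * \<delta>"]
        by (auto simp: power2_diff power_mult_distrib field_simps)
      then show ?thesis using nonneg by (intro mult_left_mono add_mono) auto
    qed
    also have "\<dots> = 5 / 16 * (H * g\<^sup>2) + 2 * (H * X\<^sup>2) + 8 * (H * \<delta>\<^sup>2)"
      by (simp add: field_simps)
    finally have 2: "g * (H * (K0 * d) + E) \<le> 5 / 16 * (H * g\<^sup>2) + 2 * (H * X\<^sup>2) + 8 * (H * \<delta>\<^sup>2)" .
    have nn: "0 \<le> H * g\<^sup>2" "0 \<le> H * X\<^sup>2" "0 \<le> H * \<delta>\<^sup>2" using nonneg by auto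
    have "h' \<le> h - 1 / 2 * (H * g\<^sup>2) + 3 * (H * X\<^sup>2) + 9 * (H * \<delta>\<^sup>2)"
      using 1 2 h' nn by linarith
    then show ?thesis by simp
  qed
  \<comment> \<open>Written as a convex combination with weight \<open>b * H\<close>, so that
    convexity of the square gives the decay of the squared error without a cross term.\<close>
  have D: "d' \<le> (1 - b * H) * d + b * H * (P * (g + \<delta>) / b)"
  proof -
    have "K2 * s \<le> K2 * (H * (2 * g + X + 2 * \<delta>))" "K3 * E \<le> K3 * (H * (2 * \<delta> + g / 16 + d))"
      using s' E' nonneg by (auto intro: mult_left_mono)
    moreover have "K3 * (H * (g / 16)) \<le> K3 * (H * (2 * g))"
      using nonneg by (intro mult_left_mono) auto
    moreover have "(K2 * (K0 + 1) + K3 + b) * (H * d) \<le> \<beta> * (H * d)"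
      using \<beta> nonneg by (intro mult_right_mono) auto
    ultimately have "d' \<le> (1 - b * H) * d + H * (P * (g + \<delta>))"
      using d' unfolding X_def P_def by (simp add: algebra_simps)
    then show ?thesis using \<open>1 \<le> b\<close> by simp
  qed
  have "d'\<^sup>2 \<le> ((1 - b * H) * d + b * H * (P * (g + \<delta>) / b))\<^sup>2"
    using D nonneg by (intro power_mono)
  also have "\<dots> \<le> (1 - b * H) * d\<^sup>2 + b * H * (P * (g + \<delta>) / b)\<^sup>2"
  proof -
    have conv: "((1 - u) * a + u * c)\<^sup>2 \<le> (1 - u) * a\<^sup>2 + u * c\<^sup>2" if "0 \<le> u" "u \<le> 1" for u a c :: real
    proof -
      have "(1 - u) * a\<^sup>2 + u * c\<^sup>2 - ((1 - u) * a + u * c)\<^sup>2 = u * (1 - u) * (a - c)\<^sup>2"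
        by (simp add: power2_eq_square algebra_simps)
      then show ?thesis using that by (smt (verit) mult_nonneg_nonneg zero_le_power2)
    qed
    show ?thesis using small \<open>1 \<le> b\<close> nonneg by (intro conv) auto
  qed
  also have "b * H * (P * (g + \<delta>) / b)\<^sup>2 = (H * P\<^sup>2 / b) * (g + \<delta>)\<^sup>2"
    using \<open>1 \<le> b\<close> by (simp add: power2_eq_square field_simps)
  also have "\<dots> \<le> (H * P\<^sup>2 / b) * (2 * g\<^sup>2 + 2 * \<delta>\<^sup>2)"
    using sum_squares_bound[of g \<delta>] nonneg \<open>1 \<le> b\<close>
    by (intro mult_left_mono) (auto simp: power2_sum)
  finally have D2: "d'\<^sup>2 \<le> (1 - b * H) * d\<^sup>2 + (H * P\<^sup>2 / b) * (2 * g\<^sup>2 + 2 * \<delta>\<^sup>2)" by simp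
  have "0 \<le> \<nu>" using \<open>1 \<le> b\<close> by (simp add: \<nu>_def)
  from mult_left_mono[OF D2 this]
  have "\<nu> * d'\<^sup>2 \<le> \<nu> * d\<^sup>2 - (\<nu> * b) * H * d\<^sup>2 + (\<nu> * P\<^sup>2 / b * 2) * (H * (g\<^sup>2 + \<delta>\<^sup>2))"
    by (simp add: algebra_simps)
  also have "(\<nu> * b) * H * d\<^sup>2 = 3 * H * X\<^sup>2"
    using \<open>1 \<le> b\<close> by (simp add: \<nu>_def X_def power_mult_distrib)
  also have "(\<nu> * P\<^sup>2 / b * 2) * (H * (g\<^sup>2 + \<delta>\<^sup>2)) \<le> 1 / 4 * (H * (g\<^sup>2 + \<delta>\<^sup>2))"
  proof (rule mult_right_mono)
    \<comment> \<open>Origin of the 10 in \<open>b\<close>: with \<open>P = 2 * (K2 + K3)\<close>, b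
      is at least \<open>5 * ((K0 + 1) * P)\<close>, and 25 exceeds the 24 that is required
      here.\<close>
    have "24 * ((K0 + 1) * P)\<^sup>2 \<le> (5 * ((K0 + 1) * P))\<^sup>2"
      unfolding power_mult_distrib[of 5] by (intro mult_right_mono) auto
    also have "\<dots> \<le> b\<^sup>2" using nonneg \<open>0 \<le> P\<close> 
      by (intro power_mono mult_nonneg_nonneg) (auto simp: b P_def algebra_simps)
    finally have "24 * ((K0 + 1)\<^sup>2 * P\<^sup>2) \<le> b\<^sup>2" by (simp add: power_mult_distrib)
    then show "\<nu> * P\<^sup>2 / b * 2 \<le> 1 / 4"
      using \<open>1 \<le> b\<close> by (simp add: \<nu>_def divide_simps power2_eq_square)
  qed (use nonneg in auto)
  finally have "\<nu> * d'\<^sup>2 \<le> \<nu> * d\<^sup>2 - 3 * H * X\<^sup>2 + 1 / 4 * (H * (g\<^sup>2 + \<delta>\<^sup>2))" by simp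
  with A have "h' + \<nu> * d'\<^sup>2 \<le> h + \<nu> * d\<^sup>2 - H / 4 * g\<^sup>2 + (9 + 1 / 4) * (H * \<delta>\<^sup>2)"
    by (simp add: algebra_simps)
  moreover have "(9 + 1 / 4) * (H * \<delta>\<^sup>2) \<le> 10 * (H * \<delta>\<^sup>2)" using nonneg by (intro mult_right_mono) auto
  ultimately show ?thesis by linarith
qed

text \<open>If every \<open>g e\<close> exceeded \<epsilon>, each window would lower V by at least
  \<open>H * \<epsilon>\<^sup>2 / 8\<close>: the gradient contributes one quarter, and the factor 80
  makes the loss \<open>10 * \<delta>\<^sup>2\<close> at most one eighth. After E windows the
  decrease would exceed W.\<close>

lemma small_gradient_of_descent:
  fixes V g :: "nat \<Rightarrow> real"
  assumes descent: "\<And>e. e < E \<Longrightarrow> V (Suc e) \<le> V e - H / 4 * (g e)\<^sup>2 + 10 * H * \<delta>\<^sup>2"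
    and "V 0 - V E \<le> W" "0 < H" "0 \<le> \<epsilon>" and \<delta>: "80 * \<delta>\<^sup>2 \<le> \<epsilon>\<^sup>2" and E: "8 * W < real E * H * \<epsilon>\<^sup>2"
  shows "\<exists>e<E. g e \<le> \<epsilon>"
proof (rule ccontr)
  assume "\<not> ?thesis"
  then have large: "\<epsilon>\<^sup>2 \<le> (g e)\<^sup>2" if "e < E" for e
    using that \<open>0 \<le> \<epsilon>\<close> by (intro power_mono) force+
  have "V e \<le> V 0 - real e * (H * \<epsilon>\<^sup>2 / 8)" if "e \<le> E" for e
    using that
  proof (induction e)
    case (Suc e)
    have "H * (\<epsilon>\<^sup>2 / 8) \<le> H * ((g e)\<^sup>2 / 4 - 10 * \<delta>\<^sup>2)"
      using large[of e] Suc.prems \<delta> \<open>0 < H\<close> by (intro mult_left_mono) auto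
    moreover have "H * ((g e)\<^sup>2 / 4 - 10 * \<delta>\<^sup>2) = H / 4 * (g e)\<^sup>2 - 10 * H * \<delta>\<^sup>2"
      by (simp add: algebra_simps)
    moreover have "real (Suc e) * (H * \<epsilon>\<^sup>2 / 8) = real e * (H * \<epsilon>\<^sup>2 / 8) + H * (\<epsilon>\<^sup>2 / 8)"
      by (simp add: algebra_simps)
    ultimately show ?case using Suc descent[of e] by linarith
  qed simp
  from this[of E] assms show False by simp
qed

text \<open>R collects the tracking and drift errors of the direction. The squared move stays
  unexpanded, because the bound on the move in the second conclusion serves the tracking error as
  well.\<close>

lemma descent_step:
  fixes h :: "'a::real_inner \<Rightarrow> real"
  assumes rem: "\<bar>h x' - h x - (x' - x) \<bullet> D\<bar> \<le> K * (norm (x' - x))\<^sup>2"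
    and err: "norm (x' - x + H *\<^sub>R D) \<le> R" and "0 \<le> H"
  shows "h x' \<le> h x - H * (norm D)\<^sup>2 + norm D * R + K * (norm (x' - x))\<^sup>2"
    and "norm (x' - x) \<le> H * norm D + R"
proof -
  have "(x' - x + H *\<^sub>R D) \<bullet> D \<le> R * norm D"
    using norm_cauchy_schwarz[of "x' - x + H *\<^sub>R D" D] mult_right_mono[OF err norm_ge_zero[of D]] by linarith
  then have "(x' - x) \<bullet> D \<le> - H * (norm D)\<^sup>2 + norm D * R"
    by (simp add: inner_add_left power2_norm_eq_inner mult.commute)
  then show "h x' \<le> h x - H * (norm D)\<^sup>2 + norm D * R + K * (norm (x' - x))\<^sup>2"
    using rem by linarith
  show "norm (x' - x) \<le> H * norm D + R"
    using norm_triangle_ineq4[of "x' - x + H *\<^sub>R D" "H *\<^sub>R D"] err \<open>0 \<le> H\<close> by simp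
qed

section \<open>Averages over a dataset\<close>

lemma GDERIV_avg:
  fixes f :: "nat \<Rightarrow> 'a::real_inner \<Rightarrow> real"
  assumes "\<And>i. i < m \<Longrightarrow> GDERIV (f i) z :> G i z"
  shows "GDERIV (avg m f) z :> avg m G z"
proof -
  have "((\<lambda>z. (1 / real m) *\<^sub>R (\<Sum>i<m. f i z)) has_derivative
      (\<lambda>h. (1 / real m) *\<^sub>R (\<Sum>i<m. h \<bullet> G i z))) (at z)"
    using assms unfolding gderiv_def by (intro has_derivative_scaleR_right has_derivative_sum) auto
  then show ?thesis unfolding gderiv_def avg_def[abs_def] by (simp add: inner_sum_right)
qed

lemma avg_diff: "avg m F z - avg m F w = (1 / real m) *\<^sub>R (\<Sum>i<m. F i z - F i w)"
  by (simp add: avg_def sum_subtractf scaleR_diff_right)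

lemma norm_avg_le:
  assumes "0 < m" "\<And>i. i < m \<Longrightarrow> norm (v i) \<le> B"
  shows "norm ((1 / real m) *\<^sub>R (\<Sum>i<m. v i)) \<le> B"
proof -
  have "norm (\<Sum>i<m. v i) \<le> real m * B"
    using sum_norm_le[of "{..<m}" v "\<lambda>_. B"] assms by simp
  then show ?thesis using \<open>0 < m\<close> by (simp add: field_simps)
qed

lemma lipschitz_on_avg:
  fixes F :: "nat \<Rightarrow> 'a::real_normed_vector \<Rightarrow> 'b::real_normed_vector"
  assumes "0 < m" "\<And>i. i < m \<Longrightarrow> L-lipschitz_on U (F i)"
  shows "L-lipschitz_on U (avg m F)"
proof (rule lipschitz_onI)
  show "0 \<le> L" using assms by (auto simp: lipschitz_on_def)
  fix z w assume "z \<in> U" "w \<in> U"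
  then show "dist (avg m F z) (avg m F w) \<le> L * dist z w"
    using assms unfolding dist_norm avg_diff
    by (intro norm_avg_le) (auto simp: lipschitz_on_def dist_norm)
qed

lemma lipschitz_norm_diff:
  assumes "L-lipschitz_on UNIV F"
  shows "norm (F z - F w) \<le> L * norm (z - w)"
  using assms by (auto simp: lipschitz_on_def dist_norm)

lemma norm_fst_le_norm: "norm (fst v) \<le> norm v"
  by (metis norm_fst_le prod.collapse)

lemma grad_x_eq_fst:
  fixes F :: "'a::euclidean_space \<times> 'b::euclidean_space \<Rightarrow> real"
  assumes "F differentiable (at z)"
  shows "grad_x F z = fst (grad F z)"
proof -
  have "((\<lambda>x. (x, snd z)) has_derivative (\<lambda>h. (h, 0))) (at (fst z))"
    by (intro has_derivative_Pair has_derivative_ident has_derivative_const)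
  from has_derivative_compose[OF this, of F "\<lambda>h. h \<bullet> grad F z"]
  have "((\<lambda>x. F (x, snd z)) has_derivative (\<lambda>h. (h, 0) \<bullet> grad F z)) (at (fst z))"
    using differentiable_imp_GDERIV[OF assms] by (simp add: gderiv_def)
  moreover have "(\<lambda>h. (h, 0) \<bullet> grad F z) = (\<lambda>h. h \<bullet> fst (grad F z))"
    by (auto simp: fun_eq_iff inner_prod_def)
  ultimately have "GDERIV (\<lambda>x. F (x, snd z)) (fst z) :> fst (grad F z)" by (simp add: gderiv_def)
  then show ?thesis unfolding grad_x_def by (rule grad_eqI)
qed

section \<open>Minimax optimization\<close>

text \<open>Strong concavity enters as its tangent inequality, which is linear in the function and
  its gradient and so passes from the examples to their average.\<close>

locale strongly_concave_in_y =
  fixes \<phi> :: "'a::euclidean_space \<times> 'b::euclidean_space \<Rightarrow> real" and G \<mu> L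
  assumes pos: "0 < \<mu>" "0 < L"
    and gderiv: "\<And>z. GDERIV \<phi> z :> G z"
    and lipschitz: "L-lipschitz_on UNIV G"
    and tangent: "\<And>x y y'. \<phi> (x, y') \<le> \<phi> (x, y) + (y' - y) \<bullet> snd (G (x, y)) - \<mu> / 2 * (norm (y' - y))\<^sup>2"
begin

definition best :: "'a \<Rightarrow> 'b" where "best x = (ARG_MAX (\<lambda>y. \<phi> (x, y)) y. True)"

definition obj :: "'a \<Rightarrow> real" where "obj x = (SUP y. \<phi> (x, y))"

definition hgrad :: "'a \<Rightarrow> 'a" where "hgrad x = fst (G (x, best x))"

lemma norm_G_diff: "norm (G z - G w) \<le> L * norm (z - w)"
  by (rule lipschitz_norm_diff[OF lipschitz])

lemma norm_snd_G_diff: "norm (snd (G z) - snd (G w)) \<le> L * norm (z - w)"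
  using norm_G_diff[of z w] linear_norm_snd(2)[of "G z - G w"] by simp

lemma norm_fst_G_diff: "norm (fst (G z) - fst (G w)) \<le> L * norm (z - w)"
  using norm_G_diff[of z w] norm_fst_le_norm[of "G z - G w"] by simp

lemma monotone_y: "\<mu> * (norm (y' - y))\<^sup>2 \<le> (y' - y) \<bullet> (snd (G (x, y)) - snd (G (x, y')))"
  using tangent[of x y' y] tangent[of x y y'] 
  by (simp add: inner_diff_right inner_diff_left norm_minus_commute)

text \<open>In the expanded square, strong monotonicity contributes - 2 s \<mu> and the Lipschitz
  bound with \<open>s * L\<^sup>2 \<le> \<mu>\<close> gives back at most s \<mu>; the root of 1 - s
  \<mu> is at most 1 - s \<mu> / 2. This serves twice: for the existence of the maximiser, and as
  the decay of the tracking error over a window.\<close>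

lemma ascent_contraction:
  assumes s: "0 \<le> s" "s * L\<^sup>2 \<le> \<mu>"
  shows "norm ((y' + s *\<^sub>R snd (G (x, y'))) - (y + s *\<^sub>R snd (G (x, y)))) \<le> (1 - s * \<mu> / 2) * norm (y' - y)"
proof (cases "y' = y")
  case False
  define v where "v = y' - y"
  define \<Delta> where "\<Delta> = snd (G (x, y')) - snd (G (x, y))"
  have "v \<noteq> 0" using False by (simp add: v_def)
  have v\<Delta>: "v \<bullet> \<Delta> \<le> - \<mu> * (norm v)\<^sup>2"
    using monotone_y[of y' y x] by (simp add: v_def \<Delta>_def inner_diff_right)
  have "(norm \<Delta>)\<^sup>2 \<le> (L * norm v)\<^sup>2"
    using norm_snd_G_diff[of "(x, y')" "(x, y)"] by (intro power_mono) (simp_all add: v_def \<Delta>_def norm_Pair2)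
  then have "s * (s * (norm \<Delta>)\<^sup>2) \<le> s * (s * (L * norm v)\<^sup>2)"
    using s by (intro mult_left_mono)
  also have "\<dots> = s * ((s * L\<^sup>2) * (norm v)\<^sup>2)" by (simp add: power_mult_distrib)
  also have "\<dots> \<le> s * (\<mu> * (norm v)\<^sup>2)" using s by (intro mult_left_mono mult_right_mono) auto
  finally have "(norm (v + s *\<^sub>R \<Delta>))\<^sup>2 \<le> (norm v)\<^sup>2 + 2 * s * (v \<bullet> \<Delta>) + s * (\<mu> * (norm v)\<^sup>2)"
    unfolding power2_norm_eq_inner by (simp add: inner_add_left inner_add_right inner_commute)
  also have "\<dots> \<le> (1 - s * \<mu>) * (norm v)\<^sup>2"
    using mult_left_mono[OF v\<Delta>, of s] s by (simp add: algebra_simps)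
  finally have sq: "(norm (v + s *\<^sub>R \<Delta>))\<^sup>2 \<le> (1 - s * \<mu>) * (norm v)\<^sup>2" .
  \<comment> \<open>For nonzero v the inequality itself forces \<open>s * \<mu> \<le> 1\<close>, so
    the right-hand side is nonnegative when the root is taken.\<close>
  then have "0 \<le> (1 - s * \<mu>) * (norm v)\<^sup>2" using zero_le_power2 order_trans by blast
  then have "s * \<mu> \<le> 1" using \<open>v \<noteq> 0\<close> by (simp add: zero_le_mult_iff)
  have "(1 - s * \<mu>) * (norm v)\<^sup>2 \<le> (1 - s * \<mu> / 2)\<^sup>2 * (norm v)\<^sup>2"
    by (intro mult_right_mono) (auto simp: power2_diff)
  with sq have "(norm (v + s *\<^sub>R \<Delta>))\<^sup>2 \<le> ((1 - s * \<mu> / 2) * norm v)\<^sup>2"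
    by (simp add: power_mult_distrib)
  then have "norm (v + s *\<^sub>R \<Delta>) \<le> (1 - s * \<mu> / 2) * norm v"
    by (rule power2_le_imp_le) (use \<open>s * \<mu> \<le> 1\<close> in auto)
  then show ?thesis by (simp add: v_def \<Delta>_def algebra_simps)
qed simp

text \<open>By the quadratic term of \<open>tangent\<close> a critical point is a strict maximiser,
  and strictness is what determines the value of \<open>ARG_MAX\<close>.\<close>

lemma critical_imp_best:
  assumes "snd (G (x, y)) = 0"
  shows "best x = y"
proof -
  have *: "\<phi> (x, y') < \<phi> (x, y)" if "y' \<noteq> y" for y'
    using tangent[of x y' y] that assms pos by (simp add: add_pos_pos order.strict_trans1)
  have "is_arg_max (\<lambda>y. \<phi> (x, y)) (\<lambda>_. True) y" unfolding is_arg_max_def using * by fastforce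
  moreover have "y' = y" if "is_arg_max (\<lambda>y. \<phi> (x, y)) (\<lambda>_. True) y'" for y'
    using that * unfolding is_arg_max_def by blast
  ultimately show ?thesis unfolding best_def arg_max_def by (rule some_equality)
qed

text \<open>The maximiser exists by Banach's fixed point theorem: the ascent map with a small step
  is a contraction, and its fixed points are the critical points.\<close>

lemma G_best: "snd (G (x, best x)) = 0"
proof -
  define s where "s = \<mu> / L\<^sup>2"
  have s: "0 < s" "s * L\<^sup>2 \<le> \<mu>" using pos by (auto simp: s_def)
  have "\<exists>!y. y + s *\<^sub>R snd (G (x, y)) = y"
  proof (rule banach_fix_type)
    \<comment> \<open>The fixed point theorem asks for a nonnegative factor, and \<mu> \<le> L has
      not been derived; hence the maximum with 0.\<close>
    show "0 \<le> max 0 (1 - s * \<mu> / 2)" "max 0 (1 - s * \<mu> / 2) < 1" using s pos by auto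
    show "\<forall>y y' :: 'b. dist (y + s *\<^sub>R snd (G (x, y))) (y' + s *\<^sub>R snd (G (x, y'))) \<le> max 0 (1 - s * \<mu> / 2) * dist y y'"
    proof (intro allI)
      fix y y' :: 'b
      have "(1 - s * \<mu> / 2) * norm (y - y') \<le> max 0 (1 - s * \<mu> / 2) * norm (y - y')"
        by (intro mult_right_mono) auto
      then show "dist (y + s *\<^sub>R snd (G (x, y))) (y' + s *\<^sub>R snd (G (x, y'))) \<le> max 0 (1 - s * \<mu> / 2) * dist y y'"
        using ascent_contraction[of s y x y'] s unfolding dist_norm by linarith
    qed
  qed
  then obtain y where "y + s *\<^sub>R snd (G (x, y)) = y" by blast
  then have "snd (G (x, y)) = 0" using s by simp
  then show ?thesis using critical_imp_best by metis
qed

lemma le_best: "\<phi> (x, y) \<le> \<phi> (x, best x)"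
proof -
  have "0 \<le> \<mu> / 2 * (norm (y - best x))\<^sup>2" using pos by simp
  then show ?thesis using tangent[of x y "best x"] by (simp add: G_best)
qed

lemma obj_eq: "obj x = \<phi> (x, best x)"
  unfolding obj_def by (rule cSup_eq_maximum) (auto intro: le_best)

text \<open>Strong monotonicity at x between the two maximisers, where both y-gradients at their own
  points vanish, so that only the change from x to x' at the fixed y = \<open>best x'\<close>
  remains.\<close>

lemma best_lipschitz: "norm (best x - best x') \<le> L / \<mu> * norm (x - x')"
proof (cases "best x = best x'")
  case True
  then show ?thesis using pos by simp
next
  case False
  let ?v = "best x - best x'"
  have "\<mu> * (norm ?v)\<^sup>2 \<le> ?v \<bullet> (snd (G (x, best x')) - snd (G (x', best x')))"
    using monotone_y[of "best x" "best x'" x] by (simp add: G_best)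
  also have "\<dots> \<le> norm ?v * norm (snd (G (x, best x')) - snd (G (x', best x')))"
    by (rule norm_cauchy_schwarz)
  also have "\<dots> \<le> norm ?v * (L * norm (x - x'))"
    using norm_snd_G_diff[of "(x, best x')" "(x', best x')"]
    by (intro mult_left_mono) (simp_all add: norm_Pair1)
  finally have "norm ?v * (\<mu> * norm ?v) \<le> norm ?v * (L * norm (x - x'))"
    by (simp add: power2_eq_square mult_ac)
  then have "\<mu> * norm ?v \<le> L * norm (x - x')" using False by simp
  then show ?thesis using pos by (simp add: field_simps)
qed

text \<open>Danskin's argument. For the upper bound, \<phi> is expanded in x at the fixed y =
  \<open>best x'\<close>, which costs the move of \<open>best\<close>; for the lower bound, the
  competitor y = \<open>best x\<close> at x' suffices and costs only the curvature in x.\<close>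

lemma obj_remainder:
  "\<bar>obj x' - obj x - (x' - x) \<bullet> hgrad x\<bar> \<le> (L + L * (L / \<mu>)) * (norm (x' - x))\<^sup>2"
proof -
  have rem: "\<bar>\<phi> (x', y) - \<phi> (x, y) - (x' - x) \<bullet> fst (G (x, y))\<bar> \<le> L * (norm (x' - x))\<^sup>2" for y
    using lipschitz_gradient_remainder[OF gderiv lipschitz, of "(x', y)" "(x, y)"]
    by (simp add: inner_prod_def norm_Pair1)
  have "obj x' \<le> \<phi> (x, best x') + (x' - x) \<bullet> fst (G (x, best x')) + L * (norm (x' - x))\<^sup>2"
    using rem[of "best x'"] by (simp add: obj_eq)
  also have "(x' - x) \<bullet> fst (G (x, best x')) \<le> (x' - x) \<bullet> hgrad x + L * (L / \<mu>) * (norm (x' - x))\<^sup>2"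
  proof -
    have cs: "(x' - x) \<bullet> (fst (G (x, best x')) - hgrad x) \<le> norm (x' - x) * norm (fst (G (x, best x')) - hgrad x)"
      by (rule norm_cauchy_schwarz)
    have "norm (fst (G (x, best x')) - hgrad x) \<le> L * norm (best x' - best x)"
      using norm_fst_G_diff[of "(x, best x')" "(x, best x)"] by (simp add: hgrad_def norm_Pair2)
    also have "\<dots> \<le> L * (L / \<mu> * norm (x' - x))"
      using best_lipschitz pos by (intro mult_left_mono) auto
    finally have "norm (fst (G (x, best x')) - hgrad x) \<le> L * (L / \<mu> * norm (x' - x))" .
    from mult_left_mono[OF this norm_ge_zero[of "x' - x"]] cs
    have "(x' - x) \<bullet> (fst (G (x, best x')) - hgrad x) \<le> norm (x' - x) * (L * (L / \<mu> * norm (x' - x)))"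
      by linarith
    then show ?thesis by (simp add: inner_diff_right power2_eq_square mult_ac)
  qed
  finally have "obj x' \<le> obj x + (x' - x) \<bullet> hgrad x + (L + L * (L / \<mu>)) * (norm (x' - x))\<^sup>2"
    using le_best[of x "best x'"] by (simp add: obj_eq algebra_simps)
  moreover have "obj x + (x' - x) \<bullet> hgrad x - L * (norm (x' - x))\<^sup>2 \<le> obj x'"
    using rem[of "best x"] le_best[of x' "best x"] by (simp add: obj_eq hgrad_def)
  moreover have "L * (norm (x' - x))\<^sup>2 \<le> (L + L * (L / \<mu>)) * (norm (x' - x))\<^sup>2"
    using pos by (intro mult_right_mono) auto
  ultimately show ?thesis by linarith
qed

lemma GDERIV_obj: "GDERIV obj x :> hgrad x"
  by (rule GDERIV_quadratic_remainder[OF obj_remainder])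

text \<open>An instance of \<open>lyapunov_step\<close> with \<open>K0 = L\<close>,
  \<open>K1 = \<Lambda>\<close>, \<open>K2 = L / \<mu>\<close> (the Lipschitz constant of
  \<open>best\<close>), \<open>K3 = 1\<close>, \<open>\<beta> = c * \<mu> / 2\<close> and
  \<open>\<kappa> = 2 * H * \<Lambda>\<close>. The first bound in \<open>small\<close> is the step
  condition of \<open>ascent_contraction\<close>, the others are the smallness conditions of
  \<open>lyapunov_step\<close>.\<close>

lemma window_descent:
  fixes w :: "nat \<Rightarrow> 'a \<times> 'b" and Gs :: "nat \<Rightarrow> 'a \<times> 'b \<Rightarrow> 'a \<times> 'b"
  assumes step: "\<And>j. j < k \<Longrightarrow>
      w (Suc j) = w j + \<eta> *\<^sub>R (- fst (Gs j (w j)), c *\<^sub>R snd (Gs j (w j)))"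
    and Gs: "\<And>j. j < k \<Longrightarrow> L-lipschitz_on UNIV (Gs j)"
    and window: "\<And>l. l \<le> k \<Longrightarrow> norm ((\<Sum>j<l. Gs j (w 0)) - real l *\<^sub>R G (w 0)) \<le> real k * \<delta>"
    and H: "H = real k * \<eta>" "0 < H" and c: "0 \<le> c" and "0 \<le> \<eta>" "0 \<le> \<delta>"
    and b: "b = 10 * (L + 1) * (L / \<mu> + 1) + 1" and cb: "L / \<mu> * (L + 1) + 1 + b \<le> c * \<mu> / 2"
    and small: "H * c * L\<^sup>2 \<le> \<mu>" "32 * H * ((1 + c) * L) \<le> 1" "2 * H * ((1 + c) * L) * ((1 + c) * L) \<le> 1"
      "192 * (L + L * (L / \<mu>)) * H \<le> 1" "b * H \<le> 1"
  defines "\<nu> \<equiv> 3 * (L + 1)\<^sup>2 / b"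
  defines "V \<equiv> \<lambda>z. obj (fst z) + \<nu> * (norm (snd z - best (fst z)))\<^sup>2"
  shows "V (w k) \<le> V (w 0) - H / 4 * (norm (hgrad (fst (w 0))))\<^sup>2 + 10 * H * ((1 + c) * \<delta>)\<^sup>2"
proof -
  \<comment> \<open>P turns a gradient into the update direction: descent in x, ascent in y sped up
    by c. Being linear, it commutes with the sums over a window, so the window error is multiplied
    by at most 1 + c.\<close>
  define P :: "'a \<times> 'b \<Rightarrow> 'a \<times> 'b" where "P v = (- fst v, c *\<^sub>R snd v)" for v
  have P_add: "P (v + u) = P v + P u" and P_diff: "P (v - u) = P v - P u" 
    and P_scale: "P (r *\<^sub>R v) = r *\<^sub>R P v" for v u r
    by (auto simp: P_def scaleR_add_right scaleR_diff_right)
  have P_sum: "P (\<Sum>i\<in>A. v i) = (\<Sum>i\<in>A. P (v i))" for v and A :: "nat set"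
    by (induction A rule: infinite_finite_induct) (auto simp: P_add, auto simp: P_def zero_prod_def)
  have norm_P: "norm (P v) \<le> (1 + c) * norm v" for v
  proof -
    have "norm (P v) \<le> norm (fst v) + c * norm (snd v)"
      using norm_Pair_le[of "- fst v" "c *\<^sub>R snd v"] c by (simp add: P_def)
    moreover have "norm (fst v) \<le> norm v" by (rule norm_fst_le_norm)
    moreover have "c * norm (snd v) \<le> c * norm v" using c linear_norm_snd(2) by (intro mult_left_mono)
    ultimately show ?thesis by (simp add: algebra_simps)
  qed
  define \<Lambda> where "\<Lambda> = (1 + c) * L"
  have "0 \<le> \<Lambda>" using c pos by (simp add: \<Lambda>_def)
  obtain x y where w0: "w 0 = (x, y)" by fastforce
  define g where "g = norm (hgrad x)"
  define d where "d = norm (y - best x)"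
  define E where "E = norm (w k - w 0 - H *\<^sub>R P (G (w 0)))"
  have "norm (w k - w 0 - (real k * \<eta>) *\<^sub>R P (G (w 0)))
      \<le> (real k * \<eta>) * ((1 + c) * \<delta> + 2 * (real k * \<eta>) * \<Lambda> * (norm (P (G (w 0))) + (1 + c) * \<delta>))"
  proof (rule window_drift)
    show "w (Suc j) = w j + \<eta> *\<^sub>R P (Gs j (w j))" if "j < k" for j
      using step[OF that] by (simp add: P_def)
    show "norm (P (Gs j (w j)) - P (Gs j (w 0))) \<le> \<Lambda> * norm (w j - w 0)" if "j < k" for j
    proof -
      have "norm (P (Gs j (w j)) - P (Gs j (w 0))) \<le> (1 + c) * norm (Gs j (w j) - Gs j (w 0))"
        using norm_P[of "Gs j (w j) - Gs j (w 0)"] by (simp add: P_diff)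
      also have "\<dots> \<le> (1 + c) * (L * norm (w j - w 0))"
        using lipschitz_norm_diff[OF Gs[OF that]] c by (intro mult_left_mono) auto
      finally show ?thesis by (simp add: \<Lambda>_def mult_ac)
    qed
    show "norm ((\<Sum>j<l. P (Gs j (w 0))) - real l *\<^sub>R P (G (w 0))) \<le> real k * ((1 + c) * \<delta>)" if "l \<le> k" for l
    proof -
      have "norm ((\<Sum>j<l. P (Gs j (w 0))) - real l *\<^sub>R P (G (w 0)))
          \<le> (1 + c) * norm ((\<Sum>j<l. Gs j (w 0)) - real l *\<^sub>R G (w 0))"
        using norm_P[of "(\<Sum>j<l. Gs j (w 0)) - real l *\<^sub>R G (w 0)"] by (simp add: P_diff P_sum P_scale)
      also have "\<dots> \<le> (1 + c) * (real k * \<delta>)" using window[OF that] c by (intro mult_left_mono) auto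
      finally show ?thesis by (simp add: mult_ac)
    qed
    show "2 * (real k * \<eta>) * \<Lambda> \<le> 1" using small(2) \<open>0 \<le> \<Lambda>\<close> H by (simp add: \<Lambda>_def)
  qed (use \<open>0 \<le> \<eta>\<close> \<open>0 \<le> \<Lambda>\<close> in auto)
  then have "E \<le> H * ((1 + c) * \<delta> + 2 * H * \<Lambda> * (norm (P (G (w 0))) + (1 + c) * \<delta>))"
    by (simp add: E_def H)
  also have "norm (P (G (w 0))) \<le> g + \<Lambda> * d"
  proof -
    \<comment> \<open>Comparison with the point \<open>(x, best x)\<close>, at distance d, where the
      field has norm exactly g.\<close>
    have "norm (P (G (x, y)) - P (G (x, best x))) \<le> \<Lambda> * d"
    proof -
      have "norm (P (G (x, y)) - P (G (x, best x))) \<le> (1 + c) * norm (G (x, y) - G (x, best x))"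
        using norm_P[of "G (x, y) - G (x, best x)"] by (simp add: P_diff)
      also have "\<dots> \<le> (1 + c) * (L * d)"
        using norm_G_diff[of "(x, y)" "(x, best x)"] c by (intro mult_left_mono) (auto simp: norm_Pair2 d_def)
      finally show ?thesis by (simp add: \<Lambda>_def mult_ac)
    qed
    moreover have "P (G (x, best x)) = (- hgrad x, 0)" by (simp add: P_def hgrad_def G_best)
    then have "norm (P (G (x, best x))) = g" by (simp add: g_def norm_Pair1)
    ultimately show ?thesis
      using norm_triangle_ineq2[of "P (G (x, y))" "P (G (x, best x))"] by (simp add: w0)
  qed
  finally have E: "E \<le> H * ((1 + c) * \<delta> + 2 * H * \<Lambda> * (g + \<Lambda> * d + (1 + c) * \<delta>))"
    using H \<open>0 \<le> \<Lambda>\<close> by (simp add: mult_left_mono)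
  have E_x: "norm (fst (w k) - x + H *\<^sub>R fst (G (x, y))) \<le> E"
  proof -
    have "fst (w k - w 0 - H *\<^sub>R P (G (w 0))) = fst (w k) - x + H *\<^sub>R fst (G (x, y))"
      by (simp add: w0 P_def)
    then show ?thesis unfolding E_def by (metis norm_fst_le_norm)
  qed
  have E_y: "norm (snd (w k) - y - (H * c) *\<^sub>R snd (G (x, y))) \<le> E"
  proof -
    have "snd (w k - w 0 - H *\<^sub>R P (G (w 0))) = snd (w k) - y - (H * c) *\<^sub>R snd (G (x, y))"
      by (simp add: w0 P_def)
    then show ?thesis unfolding E_def by (metis linear_norm_snd(2))
  qed
  let ?x' = "fst (w k)"
  have "norm (?x' - x + H *\<^sub>R hgrad x) \<le> H * (L * d) + E"
  proof -
    have "norm (H *\<^sub>R (hgrad x - fst (G (x, y)))) \<le> H * (L * d)"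
      using mult_left_mono[OF norm_fst_G_diff[of "(x, best x)" "(x, y)"] less_imp_le[OF \<open>0 < H\<close>]] \<open>0 < H\<close>
      by (simp add: hgrad_def d_def norm_Pair2 norm_minus_commute)
    then show ?thesis
      using E_x norm_triangle_ineq[of "?x' - x + H *\<^sub>R fst (G (x, y))" "H *\<^sub>R (hgrad x - fst (G (x, y)))"]
      by (simp add: scaleR_diff_right)
  qed
  note descent = descent_step[OF obj_remainder this less_imp_le[OF \<open>0 < H\<close>]]
  have d': "norm (snd (w k) - best ?x') \<le> (1 - c * \<mu> / 2 * H) * d + L / \<mu> * norm (?x' - x) + 1 * E"
  proof -
    have "norm ((y + (H * c) *\<^sub>R snd (G (x, y))) - (best x + (H * c) *\<^sub>R snd (G (x, best x))))
        \<le> (1 - (H * c) * \<mu> / 2) * norm (y - best x)"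
      using small(1) H c by (intro ascent_contraction) auto
    then have "norm (y + (H * c) *\<^sub>R snd (G (x, y)) - best x) \<le> (1 - c * \<mu> / 2 * H) * d"
      by (simp add: G_best d_def mult_ac)
    \<comment> \<open>The three parts: drift error, one exact ascent step of length
      \<open>H * c\<close> with the target frozen at \<open>best x\<close>, and the move of the
      target.\<close>
    moreover have "snd (w k) - best ?x' = (snd (w k) - y - (H * c) *\<^sub>R snd (G (x, y)))
        + (y + (H * c) *\<^sub>R snd (G (x, y)) - best x) + (best x - best ?x')" by simp
    ultimately show ?thesis
      using E_y best_lipschitz[of x ?x']
        norm_triangle_ineq[of "(snd (w k) - y - (H * c) *\<^sub>R snd (G (x, y)))
        + (y + (H * c) *\<^sub>R snd (G (x, y)) - best x)" "best x - best ?x'"]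
        norm_triangle_ineq[of "snd (w k) - y - (H * c) *\<^sub>R snd (G (x, y))" "y + (H * c) *\<^sub>R snd (G (x, y)) - best x"]
      by (simp add: norm_minus_commute)
  qed
  have "obj ?x' + 3 * (L + 1)\<^sup>2 / b * (norm (snd (w k) - best ?x'))\<^sup>2
      \<le> obj x + 3 * (L + 1)\<^sup>2 / b * d\<^sup>2 - H / 4 * g\<^sup>2 + 10 * H * ((1 + c) * \<delta>)\<^sup>2"
  proof (rule lyapunov_step[where s = "norm (?x' - x)" and E = E and \<kappa> = "2 * H * \<Lambda>" and
        Lh = "L + L * (L / \<mu>)" and \<beta> = "c * \<mu> / 2" and ?K0.0 = L and ?K1.0 = \<Lambda> and ?K2.0 = "L / \<mu>" and ?K3.0 = 1])
    show "norm (?x' - x) \<le> H * (g + L * d) + E"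
      using descent(2) by (simp add: g_def distrib_left)
  qed (use pos H c small cb b E descent(1) d' \<open>0 \<le> \<delta>\<close> \<open>0 \<le> \<Lambda>\<close> in
      \<open>auto simp: g_def d_def \<Lambda>_def intro: mult_nonneg_nonneg\<close>)
  then show ?thesis by (simp add: V_def \<nu>_def w0 d_def g_def)
qed

end

section \<open>From the assumptions of the minimax problem to a guarantee\<close>

lemma strongly_concave_avg:
  assumes "0 < m" "0 < \<mu>" "0 < L" and A1: "assm_A1_smooth L m f" and A2: "assm_A2 \<mu> L Lxy Lyy m (neg_fam f)"
  shows "strongly_concave_in_y (avg m f) (grad (avg m f)) \<mu> L"
proof
  have diff: "f i differentiable (at z)" and lip: "L-lipschitz_on UNIV (grad (f i))" if "i < m" for i z
    using A1 that unfolding assm_A1_smooth_def smooth_with_def by blast+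
  have G: "GDERIV (avg m f) z :> avg m (\<lambda>i. grad (f i)) z" for z
    by (rule GDERIV_avg) (rule differentiable_imp_GDERIV[OF diff])
  have eq: "grad (avg m f) = avg m (\<lambda>i. grad (f i))" by (rule ext) (rule grad_eqI[OF G])
  show "GDERIV (avg m f) z :> grad (avg m f) z" for z unfolding eq by (rule G)
  show "L-lipschitz_on UNIV (grad (avg m f))" unfolding eq by (rule lipschitz_on_avg[OF \<open>0 < m\<close> lip])
  fix x y y'
  have "f i (x, y') \<le> f i (x, y) + (y' - y) \<bullet> snd (grad (f i) (x, y)) - \<mu> / 2 * (norm (y' - y))\<^sup>2"
    if "i < m" for i
  proof -
    have "GDERIV (\<lambda>y. f i (x, y)) y :> snd (grad (f i) (x, y))"
      using differentiable_imp_GDERIV[OF grad_y_eq_snd(1)[OF diff[OF that, of "(x, y)"]]]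
        grad_y_eq_snd(2)[OF diff[OF that, of "(x, y)"]] by (simp add: grad_y_def)
    then have "GDERIV (\<lambda>y. neg_fam f i (x, y)) y :> - snd (grad (f i) (x, y))"
      unfolding gderiv_def neg_fam_def by (auto dest: has_derivative_minus)
    moreover have "strongly_convex \<mu> (\<lambda>y. neg_fam f i (x, y))" using A2 that by (auto simp: assm_A2_def)
    ultimately show ?thesis
      using strongly_convex_above_tangent[of \<mu> "\<lambda>y. neg_fam f i (x, y)" y "- snd (grad (f i) (x, y))" y']
      by (simp add: neg_fam_def)
  qed
  then have "(\<Sum>i<m. f i (x, y'))
      \<le> (\<Sum>i<m. f i (x, y) + (y' - y) \<bullet> snd (grad (f i) (x, y)) - \<mu> / 2 * (norm (y' - y))\<^sup>2)"
    by (intro sum_mono) auto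
  also have "\<dots> = (\<Sum>i<m. f i (x, y)) + (y' - y) \<bullet> (\<Sum>i<m. snd (grad (f i) (x, y)))
      - real m * (\<mu> / 2 * (norm (y' - y))\<^sup>2)"
    by (simp add: sum.distrib sum_subtractf inner_sum_right)
  finally show "avg m f (x, y')
      \<le> avg m f (x, y) + (y' - y) \<bullet> snd (grad (avg m f) (x, y)) - \<mu> / 2 * (norm (y' - y))\<^sup>2"
    using \<open>0 < m\<close> unfolding eq by (simp add: avg_def snd_sum field_simps)
qed (use assms in auto)

lemma wior_minimax_Suc:
  fixes f :: "nat \<Rightarrow> 'a::euclidean_space \<times> 'b::euclidean_space \<Rightarrow> real" and x0 y0 \<xi> \<eta> c
  defines "w \<equiv> wior_minimax f \<eta> (c * \<eta>) \<xi> x0 y0"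
  assumes "f (\<xi> t) differentiable (at (w t))"
  shows "w (Suc t) = w t + \<eta> *\<^sub>R (- fst (grad (f (\<xi> t)) (w t)), c *\<^sub>R snd (grad (f (\<xi> t)) (w t)))"
  using grad_x_eq_fst[OF assms(2)] grad_y_eq_snd(2)[OF assms(2)]
  by (cases "w t") (simp_all add: w_def mult.commute)

text \<open>The constants stand outside the quantifiers over datasets, sizes and sampling
  parameters, since the step-size constants must be fixed before all of these. The choice of k and E
  is expressed by two inequalities that each sampling scheme satisfies in its own way.\<close>

definition minimax_guarantee ::
  "real \<Rightarrow> real \<Rightarrow> real \<Rightarrow> real \<Rightarrow> real \<Rightarrow> real \<Rightarrow> (nat \<Rightarrow> 'a::euclidean_space \<times> 'b::euclidean_space \<Rightarrow> real) \<Rightarrow> bool"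
where
  "minimax_guarantee \<mu> L c L0 K4 \<nu> f \<longleftrightarrow> (\<forall>m x0 y0 \<Delta> D Lxy Lyy \<alpha> C T k E \<epsilon> \<xi>.
      0 < m \<and> assm_A1_smooth L m f \<and> assm_A2 \<mu> L Lxy Lyy m (neg_fam f) \<and>
      (\<forall>x. minimax_obj m f x0 - minimax_obj m f x \<le> \<Delta>) \<and>
      dist y0 (ARG_MAX (\<lambda>y. avg m f (x0, y)) y. True) \<le> D \<and>
      \<alpha> \<le> 2 \<and> 0 < k \<and> E * k \<le> T \<and> 0 < \<epsilon> \<and>
      80 * (K4 * (real k powr (- \<alpha> / 2) * \<bar>C\<bar>))\<^sup>2 \<le> \<epsilon>\<^sup>2 \<and> 8 * L0 * (\<Delta> + \<nu> * D\<^sup>2) < real E * \<epsilon>\<^sup>2 \<and>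
      (\<forall>t<T. \<xi> t < m) \<longrightarrow>
      minimax_reaches \<alpha> C T (E * k) \<epsilon> m f \<xi>
        (wior_minimax f (1 / (real k * L0)) (c * (1 / (real k * L0))) \<xi> x0 y0))"

lemma minimax_guaranteeD:
  fixes f :: "nat \<Rightarrow> 'a::euclidean_space \<times> 'b::euclidean_space \<Rightarrow> real"
  assumes "minimax_guarantee \<mu> L c L0 K4 \<nu> f" "0 < m"
    "assm_A1_smooth L m f" "assm_A2 \<mu> L Lxy Lyy m (neg_fam f)"
    "\<forall>x. minimax_obj m f x0 - minimax_obj m f x \<le> \<Delta>" "dist y0 (ARG_MAX (\<lambda>y. avg m f (x0, y)) y. True) \<le> D"
    "0 < k" "0 < \<epsilon>" "8 * L0 * (\<Delta> + \<nu> * D\<^sup>2) < real E * \<epsilon>\<^sup>2"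
    "80 * (K4 * (real k powr (- \<alpha> / 2) * \<bar>C\<bar>))\<^sup>2 \<le> \<epsilon>\<^sup>2" "\<alpha> \<le> 2" "E * k \<le> T"
    "\<And>t. \<xi> t < m"
  shows "minimax_reaches \<alpha> C T (E * k) \<epsilon> m f \<xi>
    (wior_minimax f (1 / (real k * L0)) (c * (1 / (real k * L0))) \<xi> x0 y0)"
  by (rule assms(1)[unfolded minimax_guarantee_def, rule_format, where Lxy = Lxy and Lyy = Lyy and
        \<Delta> = \<Delta> and D = D]) (use assms in auto)

lemma minimax_converges:
  fixes \<mu> L :: real
  assumes "0 < \<mu>" "0 < L"
  shows "\<exists>c>0. \<exists>L0>0. \<exists>K4\<ge>0. \<exists>\<nu>\<ge>0.
    \<forall>f :: nat \<Rightarrow> 'a::euclidean_space \<times> 'b::euclidean_space \<Rightarrow> real. minimax_guarantee \<mu> L c L0 K4 \<nu> f"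
proof -
  define b where "b = 10 * (L + 1) * (L / \<mu> + 1) + 1"
  have "1 \<le> b" using assms by (simp add: b_def)
  \<comment> \<open>This makes \<open>c * \<mu> / 2\<close> equal to the decay rate that
    \<open>window_descent\<close> asks for.\<close>
  define c where "c = 2 * (L / \<mu> * (L + 1) + 1 + b) / \<mu>"
  have "0 < c" using assms \<open>1 \<le> b\<close> by (simp add: c_def add_pos_pos)
  define \<Lambda> where "\<Lambda> = (1 + c) * L"
  have "0 < \<Lambda>" using assms \<open>0 < c\<close> by (simp add: \<Lambda>_def)
  \<comment> \<open>Each summand is a quantity whose product with H must not exceed 1; all are
    nonnegative, so the sum dominates each of them.\<close>
  define L0 where "L0 = c * L\<^sup>2 / \<mu> + 32 * \<Lambda> + 2 * \<Lambda> * \<Lambda> + 192 * (L + L * (L / \<mu>)) + b"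
  have parts: "0 \<le> c * L\<^sup>2 / \<mu>" "0 \<le> 32 * \<Lambda>" "0 \<le> 2 * \<Lambda> * \<Lambda>" "0 \<le> 192 * (L + L * (L / \<mu>))" "1 \<le> b"
    using assms \<open>0 < c\<close> \<open>0 < \<Lambda>\<close> \<open>1 \<le> b\<close> by auto
  have "0 < L0" unfolding L0_def using parts by linarith
  define H where "H = 1 / L0"
  have "0 < H" using \<open>0 < L0\<close> by (simp add: H_def)
  have small: "u * H \<le> 1" if "u \<le> L0" for u using that \<open>0 < L0\<close> by (simp add: H_def)
  have "c * L\<^sup>2 / \<mu> * H \<le> 1" "32 * \<Lambda> * H \<le> 1" "2 * \<Lambda> * \<Lambda> * H \<le> 1" "192 * (L + L * (L / \<mu>)) * H \<le> 1" "b * H \<le> 1"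
    using parts by (auto intro!: small simp only: L0_def) 
  then have small: "H * c * L\<^sup>2 \<le> \<mu>" "32 * H * \<Lambda> \<le> 1" "2 * H * \<Lambda> * \<Lambda> \<le> 1"
      "192 * (L + L * (L / \<mu>)) * H \<le> 1" "b * H \<le> 1"
    using assms by (auto simp: field_simps)
  define \<nu> where "\<nu> = 3 * (L + 1)\<^sup>2 / b"
  have "0 \<le> \<nu>" using \<open>1 \<le> b\<close> by (simp add: \<nu>_def)
  have "0 \<le> 1 + c" using \<open>0 < c\<close> by simp
  show ?thesis
    unfolding minimax_guarantee_def minimax_reaches_def
  proof (rule exI[of _ c], rule conjI[OF \<open>0 < c\<close>], rule exI[of _ L0], rule conjI[OF \<open>0 < L0\<close>],
      rule exI[of _ "1 + c"], rule conjI[OF \<open>0 \<le> 1 + c\<close>], rule exI[of _ \<nu>], rule conjI[OF \<open>0 \<le> \<nu>\<close>],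
      intro allI impI, elim conjE)
    fix m x0 y0 \<Delta> D Lxy Lyy \<alpha> C T k E \<epsilon> \<xi> and f :: "nat \<Rightarrow> 'a \<times> 'b \<Rightarrow> real"
    let ?w = "wior_minimax f (1 / (real k * L0)) (c * (1 / (real k * L0))) \<xi> x0 y0"
    assume A1: "assm_A1_smooth L m f" and A2: "assm_A2 \<mu> L Lxy Lyy m (neg_fam f)"
      and \<Delta>: "\<forall>x. minimax_obj m f x0 - minimax_obj m f x \<le> \<Delta>"
      and D: "dist y0 (ARG_MAX (\<lambda>y. avg m f (x0, y)) y. True) \<le> D"
      and le: "0 < m" "\<alpha> \<le> 2" "0 < k" "E * k \<le> T" "0 < \<epsilon>"
      and \<delta>: "80 * ((1 + c) * (real k powr (- \<alpha> / 2) * \<bar>C\<bar>))\<^sup>2 \<le> \<epsilon>\<^sup>2"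
      and E: "8 * L0 * (\<Delta> + \<nu> * D\<^sup>2) < real E * \<epsilon>\<^sup>2"
      and \<xi>: "\<forall>t<T. \<xi> t < m" and A5: "assm_A5 \<alpha> C T m m f (neg_fam f) \<xi> \<xi> ?w"
    interpret strongly_concave_in_y "avg m f" "grad (avg m f)" \<mu> L
      by (rule strongly_concave_avg[OF le(1) assms A1 A2])
    have obj: "minimax_obj m f = obj" by (rule ext) (simp add: minimax_obj_def obj_def)
    have smooth: "f i differentiable (at z)" "L-lipschitz_on UNIV (grad (f i))" if "i < m" for i z
      using A1 that unfolding assm_A1_smooth_def smooth_with_def by blast+
    define V where "V z = obj (fst z) + \<nu> * (norm (snd z - best (fst z)))\<^sup>2" for z :: "'a \<times> 'b"
    have "\<exists>e<E. norm (hgrad (fst (?w (e * k)))) \<le> \<epsilon>"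
    proof (rule small_gradient_of_descent[where V = "\<lambda>e. V (?w (e * k))" and H = H and W = "\<Delta> + \<nu> * D\<^sup>2" and
          \<delta> = "(1 + c) * (real k powr (- \<alpha> / 2) * \<bar>C\<bar>)"])
      fix e assume "e < E"
      then have "(e + 1) * k \<le> E * k" by (intro mult_right_mono) auto
      then have T: "e * k + k \<le> T" using le by simp
      have "V (?w (e * k + k)) \<le> V (?w (e * k + 0)) - H / 4 * (norm (hgrad (fst (?w (e * k + 0)))))\<^sup>2
          + 10 * H * ((1 + c) * (real k powr (- \<alpha> / 2) * \<bar>C\<bar>))\<^sup>2"
        unfolding V_def \<nu>_def
      proof (rule window_descent[where Gs = "\<lambda>j. grad (f (\<xi> (e * k + j)))" and \<eta> = "1 / (real k * L0)"])
        show "?w (e * k + Suc j) = ?w (e * k + j) + (1 / (real k * L0)) *\<^sub>R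
            (- fst (grad (f (\<xi> (e * k + j))) (?w (e * k + j))), c *\<^sub>R snd (grad (f (\<xi> (e * k + j))) (?w (e * k + j))))"
          if "j < k" for j
          unfolding add_Suc_right by (rule wior_minimax_Suc) (use smooth(1) \<xi> T that in simp)
        show "L-lipschitz_on UNIV (grad (f (\<xi> (e * k + j))))" if "j < k" for j
          using smooth(2) \<xi> T that by simp
        show "norm ((\<Sum>j<l. grad (f (\<xi> (e * k + j))) (?w (e * k + 0))) - real l *\<^sub>R grad (avg m f) (?w (e * k + 0)))
            \<le> real k * (real k powr (- \<alpha> / 2) * \<bar>C\<bar>)" if "l \<le> k" for l
          using window_error_partial_sum[of \<alpha> C T \<xi> ?w "\<lambda>i. grad (f i)" "grad (avg m f)" "e * k" k l]
            A5 T le that by (simp add: assm_A5_def)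
        show "L / \<mu> * (L + 1) + 1 + b \<le> c * \<mu> / 2" using assms by (simp add: c_def mult.commute)
        show "H = real k * (1 / (real k * L0))" using le by (simp add: H_def)
      qed (use \<open>0 < H\<close> \<open>0 < c\<close> \<open>0 < L0\<close> small b_def in \<open>auto simp: \<Lambda>_def\<close>)
      then show "V (?w (Suc e * k)) \<le> V (?w (e * k)) - H / 4 * (norm (hgrad (fst (?w (e * k)))))\<^sup>2
          + 10 * H * ((1 + c) * (real k powr (- \<alpha> / 2) * \<bar>C\<bar>))\<^sup>2"
        by (simp add: add.commute)
    next
      have "obj (fst (?w (E * k))) \<le> V (?w (E * k))" using \<open>0 \<le> \<nu>\<close> by (simp add: V_def)
      moreover have "(norm (y0 - best x0))\<^sup>2 \<le> D\<^sup>2"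
        using D by (intro power_mono) (auto simp: best_def dist_norm)
      then have "V (?w 0) \<le> obj x0 + \<nu> * D\<^sup>2" using \<open>0 \<le> \<nu>\<close> by (simp add: V_def mult_left_mono)
      ultimately show "V (?w (0 * k)) - V (?w (E * k)) \<le> \<Delta> + \<nu> * D\<^sup>2"
        using \<Delta>[rule_format, of "fst (?w (E * k))"] by (simp add: obj)
      show "8 * (\<Delta> + \<nu> * D\<^sup>2) < real E * H * \<epsilon>\<^sup>2" using E \<open>0 < L0\<close> by (simp add: H_def field_simps)
    qed (use \<open>0 < H\<close> le \<delta> in auto)
    then obtain e where "e < E" "norm (hgrad (fst (?w (e * k)))) \<le> \<epsilon>" by blast
    then show "\<exists>t\<le>E * k. stationary \<epsilon> (minimax_obj m f) (fst (?w t))"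
      unfolding stationary_def obj using GDERIV_obj by (intro exI[of _ "e * k"]) auto
  qed
qed

section \<open>Compositional optimization\<close>

text \<open>The argument is a bounded linear map and not a bare function, so that the adjoint is
  additive in it and averages and window sums of Jacobians can be pulled through.\<close>

definition transp :: "('a::euclidean_space \<Rightarrow>\<^sub>L 'b::euclidean_space) \<Rightarrow> 'b \<Rightarrow> 'a" where
  "transp A u = adjoint (blinfun_apply A) u"

lemma inner_transp: "h \<bullet> transp A u = blinfun_apply A h \<bullet> u"
  unfolding transp_def 
  by (rule adjoint_works) (rule bounded_linear.linear[OF blinfun.bounded_linear_right])

lemma transp_eqI: "(\<And>h. h \<bullet> v = blinfun_apply A h \<bullet> u) \<Longrightarrow> transp A u = v"
  by (metis inner_transp inner_commute vector_eq_rdot)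

lemma transp_simps:
  "transp (A + B) u = transp A u + transp B u"
  "transp (A - B) u = transp A u - transp B u"
  "transp (s *\<^sub>R A) u = s *\<^sub>R transp A u"
  "transp A (u - v) = transp A u - transp A v"
  by (rule transp_eqI; simp add: inner_transp blinfun.bilinear_simps inner_add_right inner_diff_right
      inner_add_left inner_diff_left)+

lemma transp_sum: "transp (\<Sum>i\<in>S. A i) u = (\<Sum>i\<in>S. transp (A i) u)"
  by (rule transp_eqI) (simp add: inner_sum_right inner_transp inner_sum_left blinfun.sum_left)

lemma norm_transp: "norm (transp A u) \<le> norm A * norm u"
proof -
  have "norm (transp A u) * norm (transp A u) = blinfun_apply A (transp A u) \<bullet> u"
    by (metis inner_transp power2_eq_square power2_norm_eq_inner)
  also have "\<dots> \<le> norm (blinfun_apply A (transp A u)) * norm u" by (rule norm_cauchy_schwarz)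
  also have "\<dots> \<le> norm A * norm (transp A u) * norm u" by (intro mult_right_mono norm_blinfun) auto
  finally have "norm (transp A u) * norm (transp A u) \<le> norm (transp A u) * (norm A * norm u)"
    by (simp add: mult_ac)
  then show ?thesis by (cases "transp A u = 0") auto
qed

section \<open>Maps with Lipschitz values and Lipschitz Jacobian\<close>

definition smooth_map ::
  "real \<Rightarrow> real \<Rightarrow> ('a::real_normed_vector \<Rightarrow> 'b::real_normed_vector) \<Rightarrow> ('a \<Rightarrow> 'a \<Rightarrow>\<^sub>L 'b) \<Rightarrow> bool" where
  "smooth_map L K R J \<longleftrightarrow> (\<forall>x. (R has_derivative blinfun_apply (J x)) (at x)) \<and>
     L-lipschitz_on UNIV R \<and> K-lipschitz_on UNIV J"

lemma smooth_map_remainder: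
  assumes "smooth_map L K R J"
  shows "norm (R w - R z - blinfun_apply (J z) (w - z)) \<le> K * (norm (w - z))\<^sup>2"
proof (rule lipschitz_derivative_remainder)
  show "(R has_derivative blinfun_apply (J z)) (at z)" for z using assms by (simp add: smooth_map_def)
  have J: "K-lipschitz_on UNIV J" using assms by (simp add: smooth_map_def)
  then show "0 \<le> K" by (simp add: lipschitz_on_def)
  show "norm (blinfun_apply (J w) h - blinfun_apply (J z) h) \<le> K * norm (w - z) * norm h" for z w h
    using norm_blinfun[of "J w - J z" h] mult_right_mono[OF lipschitz_norm_diff[OF J, of w z] norm_ge_zero[of h]]
    by (simp add: blinfun.diff_left)
qed

text \<open>The difference quotient of R along h with step t is within
  \<open>t * (K * (norm h)\<^sup>2)\<close> of the derivative, and t is taken so small that this is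
  at most e. The + 1 in the denominator of t covers h = 0 and K = 0.\<close>

lemma smooth_map_norm_derivative:
  assumes "smooth_map L K R J"
  shows "norm (J x) \<le> L"
proof (rule norm_blinfun_bound)
  have R: "L-lipschitz_on UNIV R" and K: "0 \<le> K" using assms by (auto simp: smooth_map_def lipschitz_on_def)
  then show "0 \<le> L" by (simp add: lipschitz_on_def)
  fix h
  let ?v = "norm (blinfun_apply (J x) h)"
  have "?v \<le> L * norm h + e" if "0 < e" for e
  proof -
    define t where "t = e / (K * (norm h)\<^sup>2 + 1)"
    have pos: "0 < K * (norm h)\<^sup>2 + 1" using K by (simp add: add_nonneg_pos)
    have "0 < t" using that pos by (simp add: t_def)
    have "norm (R (x + t *\<^sub>R h) - R x - t *\<^sub>R blinfun_apply (J x) h) \<le> K * (t * norm h)\<^sup>2"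
      using smooth_map_remainder[OF assms, of "x + t *\<^sub>R h" x] by (simp add: blinfun.scaleR_right power_mult_distrib)
    moreover have "norm (R (x + t *\<^sub>R h) - R x) \<le> L * (t * norm h)"
      using lipschitz_norm_diff[OF R, of "x + t *\<^sub>R h" x] \<open>0 < t\<close> by simp
    moreover have "t * ?v = norm ((R (x + t *\<^sub>R h) - R x) - (R (x + t *\<^sub>R h) - R x - t *\<^sub>R blinfun_apply (J x) h))"
      using \<open>0 < t\<close> by simp
    ultimately have "t * ?v \<le> L * (t * norm h) + K * (t * norm h)\<^sup>2"
      using norm_triangle_ineq4[of "R (x + t *\<^sub>R h) - R x" "R (x + t *\<^sub>R h) - R x - t *\<^sub>R blinfun_apply (J x) h"]
      by linarith
    also have "\<dots> = t * (L * norm h + t * (K * (norm h)\<^sup>2))" by (simp add: power2_eq_square algebra_simps)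
    finally have "?v \<le> L * norm h + t * (K * (norm h)\<^sup>2)" using \<open>0 < t\<close> by simp
    also have "t * (K * (norm h)\<^sup>2) \<le> t * (K * (norm h)\<^sup>2 + 1)" using \<open>0 < t\<close> by simp
    finally show ?thesis using pos by (simp add: t_def)
  qed
  then show "?v \<le> L * norm h" by (rule field_le_epsilon)
qed

lemma smooth_map_avg:
  assumes "0 < n" and *: "\<And>j. j < n \<Longrightarrow> smooth_map L K (r j) (J j)"
  shows "smooth_map L K (avg n r) (avg n J)"
  unfolding smooth_map_def
proof (intro conjI allI)
  have "((\<lambda>x. (1 / real n) *\<^sub>R (\<Sum>j<n. r j x)) has_derivative
      (\<lambda>h. (1 / real n) *\<^sub>R (\<Sum>j<n. blinfun_apply (J j x) h))) (at x)" for x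
    using * unfolding smooth_map_def by (intro has_derivative_scaleR_right has_derivative_sum) auto
  moreover have "blinfun_apply (avg n J x) = (\<lambda>h. (1 / real n) *\<^sub>R (\<Sum>j<n. blinfun_apply (J j x) h))" for x
    by (simp add: avg_def blinfun.scaleR_left blinfun.sum_left fun_eq_iff)
  ultimately show "(avg n r has_derivative blinfun_apply (avg n J x)) (at x)" for x
    by (simp add: avg_def[of n r, abs_def])
qed (use assms in \<open>auto intro!: lipschitz_on_avg simp: smooth_map_def\<close>)

lemma norm_triple_le: "norm (a, b, c) \<le> norm a + norm b + norm c"
  using norm_Pair_le[of a "(b, c)"] norm_Pair_le[of b c] by linarith

section \<open>The joint update field of \<open>x\<close>, \<open>y\<close> and
  \<open>u\<close>\<close>

text \<open>The velocity of the joint state: with \<open>\<gamma> = \<rho> = c * \<eta>\<close>, a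
  step of the algorithm adds \<eta> times this vector to the state after projection.\<close>

definition comp_step ::
  "real \<Rightarrow> ('a::euclidean_space \<Rightarrow> 'b::euclidean_space) \<Rightarrow> ('a \<Rightarrow> 'a \<Rightarrow>\<^sub>L 'b) \<Rightarrow> ('b \<Rightarrow> 'b) \<Rightarrow> 'a \<times> 'b \<times> 'b \<Rightarrow> 'a \<times> 'b \<times> 'b"
where
  "comp_step c R J G = (\<lambda>(x, y, u). (- transp (J x) u, c *\<^sub>R (R x - y), c *\<^sub>R (G y - u)))"

text \<open>The critical component is bilinear in the Jacobian and u. The splitting
  \<open>transp (J x) (u - u') + transp (J x - J x') u'\<close> uses the ball only for the reference
  state, which is the start of a window.\<close>

lemma comp_step_lipschitz:
  fixes x x' :: "'a::euclidean_space" and y y' u u' :: "'b::euclidean_space"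
  assumes R: "smooth_map L K R J" and G: "L-lipschitz_on UNIV G" and u: "norm u' \<le> \<iota>" and c: "0 \<le> c"
  shows "norm (comp_step c R J G (x, y, u) - comp_step c R J G (x', y', u'))
      \<le> (L + K * \<iota> + 2 * c * (L + 1)) * norm ((x, y, u) - (x', y', u'))"
proof -
  let ?N = "norm ((x, y, u) - (x', y', u'))"
  have "norm (x - x') \<le> ?N" using norm_fst_le_norm[of "(x, y, u) - (x', y', u')"] by simp
  moreover have yu: "norm (y - y', u - u') \<le> ?N" using linear_norm_snd(2)[of "(x, y, u) - (x', y', u')"] by simp
  moreover have "norm (y - y') \<le> ?N" "norm (u - u') \<le> ?N"
    using yu norm_fst_le_norm[of "(y - y', u - u')"] linear_norm_snd(2)[of "(y - y', u - u')"] by auto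
  ultimately have le: "norm (x - x') \<le> ?N" "norm (y - y') \<le> ?N" "norm (u - u') \<le> ?N" by auto
  have lip: "L-lipschitz_on UNIV R" "K-lipschitz_on UNIV J" "0 \<le> L" "0 \<le> K" "0 \<le> \<iota>"
    using R order_trans[OF norm_ge_zero u] by (auto simp: smooth_map_def lipschitz_on_def)
  have "norm (transp (J x) u - transp (J x') u') \<le> L * ?N + K * ?N * \<iota>"
  proof -
    have "transp (J x) u - transp (J x') u' = transp (J x) (u - u') + transp (J x - J x') u'"
      by (simp add: transp_simps)
    moreover have "norm (transp (J x) (u - u')) \<le> L * ?N"
      using norm_transp[of "J x" "u - u'"] smooth_map_norm_derivative[OF R, of x] le(3) lip
      by (meson mult_mono norm_ge_zero order_trans)
    moreover have "norm (transp (J x - J x') u') \<le> K * ?N * \<iota>"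
    proof -
      have "norm (J x - J x') \<le> K * ?N"
        using lipschitz_norm_diff[OF lip(2), of x x'] mult_left_mono[OF le(1) \<open>0 \<le> K\<close>] by linarith
      then show ?thesis using norm_transp[of "J x - J x'" u'] u lip
        by (meson mult_mono norm_ge_zero order_trans mult_nonneg_nonneg)
    qed
    ultimately show ?thesis using norm_triangle_ineq[of "transp (J x) (u - u')" "transp (J x - J x') u'"] by simp
  qed
  moreover have "norm (c *\<^sub>R (R x - y) - c *\<^sub>R (R x' - y')) \<le> c * ((L + 1) * ?N)"
  proof -
    have "norm (R x - R x') \<le> L * ?N"
      using lipschitz_norm_diff[OF lip(1), of x x'] mult_left_mono[OF le(1) \<open>0 \<le> L\<close>] by linarith
    then have "norm ((R x - R x') - (y - y')) \<le> (L + 1) * ?N"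
      using norm_triangle_ineq4[of "R x - R x'" "y - y'"] le(2) by (simp add: algebra_simps)
    moreover have "c *\<^sub>R (R x - y) - c *\<^sub>R (R x' - y') = c *\<^sub>R ((R x - R x') - (y - y'))" by (simp add: algebra_simps)
    ultimately show ?thesis using c by (simp add: mult_left_mono)
  qed
  moreover have "norm (c *\<^sub>R (G y - u) - c *\<^sub>R (G y' - u')) \<le> c * ((L + 1) * ?N)"
  proof -
    have "norm (G y - G y') \<le> L * ?N"
      using lipschitz_norm_diff[OF G, of y y'] mult_left_mono[OF le(2) \<open>0 \<le> L\<close>] by linarith
    then have "norm ((G y - G y') - (u - u')) \<le> (L + 1) * ?N"
      using norm_triangle_ineq4[of "G y - G y'" "u - u'"] le(3) by (simp add: algebra_simps)
    moreover have "c *\<^sub>R (G y - u) - c *\<^sub>R (G y' - u') = c *\<^sub>R ((G y - G y') - (u - u'))" by (simp add: algebra_simps)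
    ultimately show ?thesis using c by (simp add: mult_left_mono)
  qed
  moreover have "norm (comp_step c R J G (x, y, u) - comp_step c R J G (x', y', u'))
      \<le> norm (transp (J x) u - transp (J x') u') + norm (c *\<^sub>R (R x - y) - c *\<^sub>R (R x' - y'))
        + norm (c *\<^sub>R (G y - u) - c *\<^sub>R (G y' - u'))"
    using norm_triple_le[of "transp (J x') u' - transp (J x) u" "c *\<^sub>R (R x - y) - c *\<^sub>R (R x' - y')"
        "c *\<^sub>R (G y - u) - c *\<^sub>R (G y' - u')"]
    by (simp add: comp_step_def norm_minus_commute)
  ultimately show ?thesis by (simp add: algebra_simps)
qed

text \<open>At a fixed state the field is affine in the Jacobian, the map and the gradient together,
  so the three window errors add up with weights \<iota>, c and c.\<close>

lemma comp_step_window: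
  assumes "norm ((\<Sum>j<l. Js j x) - real l *\<^sub>R J x) \<le> B" "norm ((\<Sum>j<l. Rs j x) - real l *\<^sub>R R x) \<le> B"
    "norm ((\<Sum>j<l. Gs j y) - real l *\<^sub>R G y) \<le> B" and u: "norm u \<le> \<iota>" and c: "0 \<le> c"
  shows "norm ((\<Sum>j<l. comp_step c (Rs j) (Js j) (Gs j) (x, y, u)) - real l *\<^sub>R comp_step c R J G (x, y, u))
      \<le> (\<iota> + 2 * c) * B"
proof -
  let ?a = "(\<Sum>j<l. Js j x) - real l *\<^sub>R J x" and ?b = "(\<Sum>j<l. Rs j x) - real l *\<^sub>R R x"
    and ?c = "(\<Sum>j<l. Gs j y) - real l *\<^sub>R G y"
  have "(\<Sum>j<l. comp_step c (Rs j) (Js j) (Gs j) (x, y, u)) - real l *\<^sub>R comp_step c R J G (x, y, u)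
      = (- transp ?a u, c *\<^sub>R ?b, c *\<^sub>R ?c)"
    by (simp add: comp_step_def sum_prod sum_negf transp_simps transp_sum sum_subtractf
        scaleR_sum_right[symmetric] algebra_simps prod_eq_iff fst_sum snd_sum sum_constant_scaleR)
  moreover have "norm (transp ?a u) \<le> B * \<iota>"
    using norm_transp[of ?a u] assms(1) u by (meson mult_mono norm_ge_zero order_trans)
  moreover have "norm (c *\<^sub>R ?b) \<le> c * B" "norm (c *\<^sub>R ?c) \<le> c * B" using assms by (auto intro: mult_left_mono)
  ultimately show ?thesis using norm_triple_le[of "- transp ?a u" "c *\<^sub>R ?b" "c *\<^sub>R ?c"]
    by (simp add: algebra_simps)
qed

section \<open>The composed objective and one window of WiOR-Comp\<close>

locale composition =
  fixes F :: "'b::euclidean_space \<Rightarrow> real" and GF and R :: "'a::euclidean_space \<Rightarrow> 'b" and J L K Cf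
  assumes pos: "0 < L" "0 \<le> Cf"
    and gderiv: "\<And>y. GDERIV F y :> GF y"
    and lipschitz: "L-lipschitz_on UNIV GF"
    and bounded: "\<And>y. norm (GF y) \<le> Cf"
    and smooth: "smooth_map L K R J"
begin

definition obj :: "'a \<Rightarrow> real" where "obj x = F (R x)"

definition hgrad :: "'a \<Rightarrow> 'a" where "hgrad x = transp (J x) (GF (R x))"

lemma norm_R_diff: "norm (R x - R x') \<le> L * norm (x - x')"
  using smooth by (intro lipschitz_norm_diff) (simp add: smooth_map_def)

lemma norm_GF_diff: "norm (GF y - GF y') \<le> L * norm (y - y')"
  by (rule lipschitz_norm_diff[OF lipschitz])

lemma norm_transp_J: "norm (transp (J x) u) \<le> L * norm u"
  using norm_transp[of "J x" u] mult_right_mono[OF smooth_map_norm_derivative[OF smooth, of x] norm_ge_zero[of u]]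
  by linarith

text \<open>Two sources of curvature: that of F over a move of R of length at most
  \<open>L * norm (x' - x)\<close> gives L cubed, and that of R, tested against a gradient of norm
  at most Cf, gives \<open>K * Cf\<close>.\<close>

lemma obj_remainder:
  "\<bar>obj x' - obj x - (x' - x) \<bullet> hgrad x\<bar> \<le> (L ^ 3 + K * Cf) * (norm (x' - x))\<^sup>2"
proof -
  have "\<bar>obj x' - obj x - (R x' - R x) \<bullet> GF (R x)\<bar> \<le> L * (norm (R x' - R x))\<^sup>2"
    unfolding obj_def by (rule lipschitz_gradient_remainder[OF gderiv lipschitz])
  also have "\<dots> \<le> L * (L * norm (x' - x))\<^sup>2"
    using norm_R_diff pos by (intro mult_left_mono power_mono) auto
  also have "\<dots> = L ^ 3 * (norm (x' - x))\<^sup>2" by (simp add: power2_eq_square power3_eq_cube)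
  finally have 1: "\<bar>obj x' - obj x - (R x' - R x) \<bullet> GF (R x)\<bar> \<le> L ^ 3 * (norm (x' - x))\<^sup>2" .
  let ?e = "R x' - R x - blinfun_apply (J x) (x' - x)"
  have "\<bar>?e \<bullet> GF (R x)\<bar> \<le> norm ?e * norm (GF (R x))" by (rule Cauchy_Schwarz_ineq2)
  also have "\<dots> \<le> (K * (norm (x' - x))\<^sup>2) * Cf"
    using smooth_map_remainder[OF smooth, of x' x] bounded[of "R x"]
    by (intro mult_mono) (auto intro: order_trans[OF norm_ge_zero])
  finally have "\<bar>?e \<bullet> GF (R x)\<bar> \<le> K * Cf * (norm (x' - x))\<^sup>2" by (simp add: mult_ac)
  moreover have "?e \<bullet> GF (R x) = (R x' - R x) \<bullet> GF (R x) - (x' - x) \<bullet> hgrad x"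
    by (simp add: inner_diff_left hgrad_def inner_transp)
  ultimately show ?thesis using 1 by (simp add: distrib_right abs_le_iff) 
qed

lemma GDERIV_obj: "GDERIV obj x :> hgrad x"
  by (rule GDERIV_quadratic_remainder[OF obj_remainder])

text \<open>The weight \<open>1 / (2 L)\<close> of the error of \<open>u\<close> lets the decay of the error of \<open>y\<close> absorb the
  influence of \<open>y\<close> on \<open>u\<close>.\<close>

definition track :: "'a \<times> 'b \<times> 'b \<Rightarrow> real" where
  "track = (\<lambda>(x, y, u). norm (y - R x) + 1 / (2 * L) * norm (u - GF (R x)))"

text \<open>Origin of the constants: \<open>3 * L / 2\<close> is L from the moving target of y plus
  the weighted \<open>L\<^sup>2 / (2 * L)\<close> from that of u; \<open>1 + 1 / (2 * L)\<close>
  counts the drift error once for y and once, weighted, for u;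
  \<open>2 * L\<^sup>2 + c + 3 * c * L\<close> collects the three components of the field.\<close>

lemma window_descent:
  fixes w :: "nat \<Rightarrow> 'a \<times> 'b \<times> 'b"
  assumes step: "\<And>j. j < k \<Longrightarrow> w (Suc j) = w j + \<eta> *\<^sub>R comp_step c (Rs j) (Js j) (Gs j) (w j)"
    and Rs: "\<And>j. j < k \<Longrightarrow> smooth_map L K (Rs j) (Js j)" and Gs: "\<And>j. j < k \<Longrightarrow> L-lipschitz_on UNIV (Gs j)"
    and w0: "w 0 = (x, y, u)"
    and window: "\<And>l. l \<le> k \<Longrightarrow> norm ((\<Sum>j<l. Js j x) - real l *\<^sub>R J x) \<le> real k * \<delta>"
      "\<And>l. l \<le> k \<Longrightarrow> norm ((\<Sum>j<l. Rs j x) - real l *\<^sub>R R x) \<le> real k * \<delta>"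
      "\<And>l. l \<le> k \<Longrightarrow> norm ((\<Sum>j<l. Gs j y) - real l *\<^sub>R GF y) \<le> real k * \<delta>"
    and u: "norm u \<le> \<iota>"
    and H: "H = real k * \<eta>" "0 < H" and c: "0 \<le> c" and "0 \<le> \<eta>" "0 \<le> \<delta>"
    and b: "b = 10 * (2 * L\<^sup>2 + 1) * (3 * L / 2 + (1 + 1 / (2 * L))) + 1"
    and cb: "3 * L / 2 * (2 * L\<^sup>2 + 1) + (1 + 1 / (2 * L)) + b \<le> c / 2"
    and \<Lambda>: "\<Lambda> = L + K * \<iota> + 2 * c * (L + 1)"
    and small: "H * c \<le> 1" "32 * H * \<Lambda> \<le> 1" "2 * H * \<Lambda> * (2 * L\<^sup>2 + c + 3 * c * L) \<le> 1"
      "192 * (L ^ 3 + K * Cf) * H \<le> 1" "b * H \<le> 1"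
  defines "\<nu> \<equiv> 3 * (2 * L\<^sup>2 + 1)\<^sup>2 / b"
  defines "V \<equiv> \<lambda>z. obj (fst z) + \<nu> * (track z)\<^sup>2"
  shows "V (w k) \<le> V (w 0) - H / 4 * (norm (hgrad (fst (w 0))))\<^sup>2 + 10 * H * ((\<iota> + 2 * c) * \<delta>)\<^sup>2"
proof -
  have "0 \<le> K" using smooth by (auto simp: smooth_map_def lipschitz_on_def)
  have "0 \<le> \<iota>" using u norm_ge_zero[of u] by linarith
  have "0 \<le> \<Lambda>" using \<open>0 \<le> K\<close> \<open>0 \<le> \<iota>\<close> pos c by (simp add: \<Lambda>)
  define Fb where "Fb = comp_step c R J GF (x, y, u)"
  have Fb: "Fb = (- transp (J x) u, c *\<^sub>R (R x - y), c *\<^sub>R (GF y - u))" by (simp add: Fb_def comp_step_def)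
  define g where "g = norm (hgrad x)"
  define d where "d = track (x, y, u)"
  define E where "E = norm (w k - w 0 - H *\<^sub>R Fb)"
  \<comment> \<open>The factor 2 L undoes the weight of the u-error in \<open>track\<close>; times
    the bound L on the Jacobian it yields \<open>K0 = 2 * L\<^sup>2\<close>.\<close>
  have a: "norm (y - R x) \<le> d" and v: "norm (u - GF (R x)) \<le> 2 * L * d" and "0 \<le> d"
    using pos by (auto simp: d_def track_def field_simps)
  have dir: "norm (hgrad x - transp (J x) u) \<le> 2 * L\<^sup>2 * d"
  proof -
    have "norm (hgrad x - transp (J x) u) \<le> L * norm (GF (R x) - u)"
      using norm_transp_J[of x "GF (R x) - u"] by (simp add: hgrad_def transp_simps)
    also have "\<dots> \<le> L * (2 * L * d)" using v pos by (intro mult_left_mono) (auto simp: norm_minus_commute)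
    finally show ?thesis by (simp add: power2_eq_square)
  qed
  have "norm (w k - w 0 - (real k * \<eta>) *\<^sub>R Fb)
      \<le> (real k * \<eta>) * ((\<iota> + 2 * c) * \<delta> + 2 * (real k * \<eta>) * \<Lambda> * (norm Fb + (\<iota> + 2 * c) * \<delta>))"
  proof (rule window_drift)
    show "norm (comp_step c (Rs j) (Js j) (Gs j) (w j) - comp_step c (Rs j) (Js j) (Gs j) (w 0))
        \<le> \<Lambda> * norm (w j - w 0)" if "j < k" for j
      using comp_step_lipschitz[OF Rs[OF that] Gs[OF that] u c] unfolding w0 \<Lambda> by (cases "w j") simp
    show "norm ((\<Sum>j<l. comp_step c (Rs j) (Js j) (Gs j) (w 0)) - real l *\<^sub>R Fb) \<le> real k * ((\<iota> + 2 * c) * \<delta>)"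
      if "l \<le> k" for l
      using comp_step_window[where Js = Js and Rs = Rs and Gs = Gs and J = J and R = R and G = GF,
          OF window[OF that] u c] unfolding w0 Fb_def by (simp add: mult_ac)
    show "2 * (real k * \<eta>) * \<Lambda> \<le> 1" using small(2) \<open>0 \<le> \<Lambda>\<close> H by simp
  qed (use step \<open>0 \<le> \<eta>\<close> \<open>0 \<le> \<Lambda>\<close> in auto)
  then have "E \<le> H * ((\<iota> + 2 * c) * \<delta> + 2 * H * \<Lambda> * (norm Fb + (\<iota> + 2 * c) * \<delta>))"
    by (simp add: E_def H)
  also have "norm Fb \<le> g + (2 * L\<^sup>2 + c + 3 * c * L) * d"
  proof -
    have "norm (transp (J x) u) \<le> g + 2 * L\<^sup>2 * d"
      using dir norm_triangle_ineq4[of "hgrad x" "hgrad x - transp (J x) u"] by (simp add: g_def)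
    moreover have "norm (c *\<^sub>R (R x - y)) \<le> c * d" using a c by (simp add: norm_minus_commute mult_left_mono)
    moreover have "norm (c *\<^sub>R (GF y - u)) \<le> c * (3 * L * d)"
    proof -
      have "norm (GF y - GF (R x)) \<le> L * d"
        using norm_GF_diff[of y "R x"] mult_left_mono[OF a, of L] pos by linarith
      then have "norm (GF y - u) \<le> 3 * L * d"
        using v norm_triangle_ineq4[of "GF y - GF (R x)" "u - GF (R x)"] by simp
      then show ?thesis using c by (simp add: mult_left_mono)
    qed
    ultimately show ?thesis
      using norm_triple_le[of "- transp (J x) u" "c *\<^sub>R (R x - y)" "c *\<^sub>R (GF y - u)"]
      by (simp add: Fb algebra_simps)
  qed
  finally have E: "E \<le> H * ((\<iota> + 2 * c) * \<delta> + 2 * H * \<Lambda> * (g + (2 * L\<^sup>2 + c + 3 * c * L) * d + (\<iota> + 2 * c) * \<delta>))"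
    using H \<open>0 \<le> \<Lambda>\<close> by (simp add: mult_left_mono)
  obtain x' y' u' where wk: "w k = (x', y', u')" by (cases "w k")
  have diff: "w k - w 0 - H *\<^sub>R Fb = (x' - x + H *\<^sub>R transp (J x) u,
      y' - y - (H * c) *\<^sub>R (R x - y), u' - u - (H * c) *\<^sub>R (GF y - u))"
    by (simp add: wk w0 Fb)
  have E_x: "norm (x' - x + H *\<^sub>R transp (J x) u) \<le> E"
    using norm_fst_le_norm[of "w k - w 0 - H *\<^sub>R Fb"] unfolding E_def diff by simp
  have "norm (y' - y - (H * c) *\<^sub>R (R x - y), u' - u - (H * c) *\<^sub>R (GF y - u)) \<le> E"
    using linear_norm_snd(2)[of "w k - w 0 - H *\<^sub>R Fb"] unfolding E_def diff by simp
  then have E_y: "norm (y' - y - (H * c) *\<^sub>R (R x - y)) \<le> E" and E_u: "norm (u' - u - (H * c) *\<^sub>R (GF y - u)) \<le> E"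
    using norm_fst_le_norm[of "(y' - y - (H * c) *\<^sub>R (R x - y), u' - u - (H * c) *\<^sub>R (GF y - u))"]
      linear_norm_snd(2)[of "(y' - y - (H * c) *\<^sub>R (R x - y), u' - u - (H * c) *\<^sub>R (GF y - u))"] by auto
  have "norm (x' - x + H *\<^sub>R hgrad x) \<le> H * (2 * L\<^sup>2 * d) + E"
  proof -
    have "norm (H *\<^sub>R (hgrad x - transp (J x) u)) \<le> H * (2 * L\<^sup>2 * d)"
      using mult_left_mono[OF dir less_imp_le[OF \<open>0 < H\<close>]] \<open>0 < H\<close> by simp
    then show ?thesis
      using E_x norm_triangle_ineq[of "x' - x + H *\<^sub>R transp (J x) u" "H *\<^sub>R (hgrad x - transp (J x) u)"]
      by (simp add: scaleR_diff_right)
  qed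
  note descent = descent_step[OF obj_remainder this less_imp_le[OF \<open>0 < H\<close>]]
  let ?s = "norm (x' - x)"
  have RR: "norm (R x - R x') \<le> L * ?s" using norm_R_diff[of x x'] by (simp add: norm_minus_commute)
  have Hc: "0 \<le> H * c" "0 \<le> 1 - H * c" using H c small by auto
  have a': "norm (y' - R x') \<le> (1 - H * c) * norm (y - R x) + E + L * ?s"
  proof -
    have "y' - R x' = (1 - H * c) *\<^sub>R (y - R x) + (y' - y - (H * c) *\<^sub>R (R x - y)) + (R x - R x')"
      by (simp add: algebra_simps)
    also have "norm \<dots> \<le> norm ((1 - H * c) *\<^sub>R (y - R x)) + E + L * ?s"
      using E_y RR by (intro norm_triangle_mono) auto
    finally show ?thesis using Hc by simp
  qed
  have v': "norm (u' - GF (R x')) \<le> (1 - H * c) * norm (u - GF (R x)) + H * c * (L * norm (y - R x)) + E + L * (L * ?s)"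
  proof -
    have "u' - GF (R x') = (1 - H * c) *\<^sub>R (u - GF (R x)) + (H * c) *\<^sub>R (GF y - GF (R x))
        + (u' - u - (H * c) *\<^sub>R (GF y - u)) + (GF (R x) - GF (R x'))"
      by (simp add: algebra_simps)
    also have "norm \<dots> \<le> norm ((1 - H * c) *\<^sub>R (u - GF (R x))) + H * c * (L * norm (y - R x)) + E + L * (L * ?s)"
    proof (intro norm_triangle_mono)
      show "norm ((H * c) *\<^sub>R (GF y - GF (R x))) \<le> H * c * (L * norm (y - R x))"
        using mult_left_mono[OF norm_GF_diff[of y "R x"] Hc(1)] Hc by simp
      show "norm (GF (R x) - GF (R x')) \<le> L * (L * ?s)"
        using norm_GF_diff[of "R x" "R x'"] mult_left_mono[OF RR, of L] pos by linarith
    qed (use E_u in auto)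
    finally show ?thesis using Hc by simp
  qed
  have d': "track (w k) \<le> (1 - c / 2 * H) * d + 3 * L / 2 * ?s + (1 + 1 / (2 * L)) * E"
  proof -
    have "track (w k) \<le> ((1 - H * c) * norm (y - R x) + E + L * ?s) + 1 / (2 * L) *
        ((1 - H * c) * norm (u - GF (R x)) + H * c * (L * norm (y - R x)) + E + L * (L * ?s))"
      unfolding wk track_def prod.case using a' v' pos by (intro add_mono mult_left_mono) auto
    \<comment> \<open>After weighting, the influence of y on u has coefficient
      \<open>H * c / 2\<close>, half of the decay \<open>H * c\<close>; the other half is the rate
      \<open>\<beta> = c / 2\<close>.\<close>
    also have "\<dots> = (1 - H * c) * d + H * c / 2 * norm (y - R x) + 3 * L / 2 * ?s + (1 + 1 / (2 * L)) * E"
      using pos by (simp add: d_def track_def field_simps)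
    also have "H * c / 2 * norm (y - R x) \<le> H * c / 2 * d" using a Hc by (intro mult_left_mono) auto
    finally show ?thesis by (simp add: algebra_simps)
  qed
  have "obj x' + 3 * (2 * L\<^sup>2 + 1)\<^sup>2 / b * (track (w k))\<^sup>2
      \<le> obj x + 3 * (2 * L\<^sup>2 + 1)\<^sup>2 / b * d\<^sup>2 - H / 4 * g\<^sup>2 + 10 * H * ((\<iota> + 2 * c) * \<delta>)\<^sup>2"
  proof (rule lyapunov_step[where s = ?s and E = E and \<kappa> = "2 * H * \<Lambda>" and Lh = "L ^ 3 + K * Cf" and
        \<beta> = "c / 2" and ?K0.0 = "2 * L\<^sup>2" and ?K1.0 = "2 * L\<^sup>2 + c + 3 * c * L" and ?K2.0 = "3 * L / 2" and
        ?K3.0 = "1 + 1 / (2 * L)"])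
    show "?s \<le> H * (g + 2 * L\<^sup>2 * d) + E"
      using descent(2) by (simp add: g_def distrib_left)
    show "0 \<le> track (w k)" using pos by (simp add: wk track_def)
  qed (use pos H c small cb b E descent(1) d' \<open>0 \<le> \<delta>\<close> \<open>0 \<le> \<Lambda>\<close> \<open>0 \<le> d\<close> \<open>0 \<le> K\<close> \<open>0 \<le> \<iota>\<close> in
      \<open>auto simp: g_def\<close>)
  then show ?thesis unfolding V_def \<nu>_def w0 wk by (simp add: d_def g_def)
qed

end

section \<open>Reading the bilevel assumptions as conditions on \<open>f\<close> and
  \<open>r\<close>\<close>

lemma GDERIV_snd:
  assumes "GDERIV F (snd z) :> D"
  shows "GDERIV (\<lambda>z. F (snd z)) z :> (0, D)"
proof -
  have "((\<lambda>z. F (snd z)) has_derivative (\<lambda>h. snd h \<bullet> D)) (at z)"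
    using has_derivative_compose[OF has_derivative_snd[OF has_derivative_ident], of F "\<lambda>h. h \<bullet> D"] assms
    by (simp add: gderiv_def)
  then show ?thesis by (simp add: gderiv_def inner_prod_def)
qed

lemma comp_outer_gradient:
  fixes f :: "nat \<Rightarrow> 'b::euclidean_space \<Rightarrow> real"
  assumes A1: "assm_A1_smooth L m (comp_outer f :: nat \<Rightarrow> 'a::euclidean_space \<times> 'b \<Rightarrow> real)" and i: "i < m"
  shows "GDERIV (f i) y :> grad (f i) y"
    and "grad (comp_outer f i :: 'a \<times> 'b \<Rightarrow> real) z = (0, grad (f i) (snd z))"
    and "L-lipschitz_on UNIV (grad (f i))"
proof -
  have outer: "comp_outer f i = (\<lambda>z :: 'a \<times> 'b. f i (snd z))" by (auto simp: comp_outer_def)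
  have lip: "L-lipschitz_on UNIV (grad (comp_outer f i :: 'a \<times> 'b \<Rightarrow> real))"
    and diff: "(comp_outer f i :: 'a \<times> 'b \<Rightarrow> real) differentiable (at z)" for z
    using A1 i unfolding assm_A1_smooth_def smooth_with_def by blast+
  show G: "GDERIV (f i) y :> grad (f i) y" for y
    using grad_y_eq_snd(1)[OF diff, of "(0, y)"] by (intro differentiable_imp_GDERIV) (simp add: comp_outer_def)
  show eq: "grad (comp_outer f i :: 'a \<times> 'b \<Rightarrow> real) z = (0, grad (f i) (snd z))" for z
    unfolding outer by (rule grad_eqI[OF GDERIV_snd[OF G]])
  show "L-lipschitz_on UNIV (grad (f i))"
  proof (rule lipschitz_onI)
    show "0 \<le> L" using lip by (simp add: lipschitz_on_def)
    show "dist (grad (f i) y) (grad (f i) y') \<le> L * dist y y'" for y y'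
      using lipschitz_onD[OF lip, of "(0, y)" "(0, y')"] by (simp add: eq dist_Pair_Pair)
  qed
qed

definition jac :: "('a::euclidean_space \<Rightarrow> 'b::euclidean_space) \<Rightarrow> 'a \<Rightarrow> 'a \<Rightarrow>\<^sub>L 'b" where
  "jac R x = Blinfun (frechet_derivative R (at x))"

lemma jac_works:
  assumes "R differentiable (at x)"
  shows "blinfun_apply (jac R x) = frechet_derivative R (at x)" "(R has_derivative blinfun_apply (jac R x)) (at x)"
proof -
  have D: "(R has_derivative frechet_derivative R (at x)) (at x)" using assms by (simp add: frechet_derivative_works)
  then show eq: "blinfun_apply (jac R x) = frechet_derivative R (at x)"
    unfolding jac_def by (simp add: bounded_linear_Blinfun_apply has_derivative_bounded_linear)
  show "(R has_derivative blinfun_apply (jac R x)) (at x)" unfolding eq by (rule D)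
qed

text \<open>Only the form of the y-gradient is prescribed, because the average of the inner
  functions is not itself half a squared distance but does have such a gradient.\<close>

lemma hess_xy_of_grad_y:
  assumes gy: "\<And>z. grad_y g z = snd z - R (fst z)" and "\<And>x. (R has_derivative blinfun_apply (J x)) (at x)"
  shows "hess_xy g z = - J (fst z)"
proof -
  have "((\<lambda>x. grad_y g (x, snd z)) has_derivative blinfun_apply (- J (fst z))) (at (fst z))"
    unfolding gy using assms(2)[of "fst z"] by (auto intro!: derivative_eq_intros simp: blinfun.minus_left)
  then have "frechet_derivative (\<lambda>x. grad_y g (x, snd z)) (at (fst z)) = blinfun_apply (- J (fst z))"
    by (rule frechet_derivative_at[symmetric])
  then show ?thesis unfolding hess_xy_def by (simp add: blinfun_apply_inverse)
qed

lemma GDERIV_half_square_dist: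
  fixes c :: "'b::euclidean_space"
  shows "GDERIV (\<lambda>y. 1 / 2 * (norm (y - c))\<^sup>2) y :> y - c"
  unfolding gderiv_def power2_norm_eq_inner
  by (auto intro!: derivative_eq_intros simp: inner_commute inner_diff_right inner_diff_left)

lemma grad_y_comp_inner:
  fixes r :: "nat \<Rightarrow> 'a::euclidean_space \<Rightarrow> 'b::euclidean_space"
  shows "grad_y (comp_inner r j) z = snd z - r j (fst z)"
    and "0 < n \<Longrightarrow> grad_y (avg n (comp_inner r)) z = snd z - avg n r (fst z)"
proof -
  have inner: "(\<lambda>y. comp_inner r j (x, y)) = (\<lambda>y. 1 / 2 * (norm (y - r j x))\<^sup>2)" for j x
    by (simp add: comp_inner_def)
  have G: "GDERIV (\<lambda>y. comp_inner r j (x, y)) y :> y - r j x" for j x y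
    unfolding inner by (rule GDERIV_half_square_dist)
  show "grad_y (comp_inner r j) z = snd z - r j (fst z)" unfolding grad_y_def by (rule grad_eqI[OF G])
  have "GDERIV (avg n (\<lambda>j y. comp_inner r j (fst z, y))) (snd z) :> avg n (\<lambda>j y. y - r j (fst z)) (snd z)"
    by (rule GDERIV_avg) (rule G)
  moreover have "avg n (\<lambda>j y. comp_inner r j (fst z, y)) = (\<lambda>y. avg n (comp_inner r) (fst z, y))"
    by (simp add: avg_def fun_eq_iff)
  moreover have "avg n (\<lambda>j y. y - r j (fst z)) (snd z) = snd z - avg n r (fst z)" if "0 < n"
    using that by (simp add: avg_def sum_subtractf scaleR_diff_right sum_constant_scaleR)
  ultimately show "grad_y (avg n (comp_inner r)) z = snd z - avg n r (fst z)" if "0 < n"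
    using that unfolding grad_y_def by (metis grad_eqI)
qed

lemma hess_xy_comp_inner:
  fixes r :: "nat \<Rightarrow> 'a::euclidean_space \<Rightarrow> 'b::euclidean_space"
  assumes "\<And>x. r j differentiable (at x)"
  shows "hess_xy (comp_inner r j) z = - jac (r j) (fst z)"
  by (rule hess_xy_of_grad_y[where R = "r j"]) (simp_all add: grad_y_comp_inner(1) jac_works(2) assms)

text \<open>On the slice y = 0 the y-gradient is \<open>- r j x\<close> and the mixed derivative is
  minus the Jacobian, so \<open>r j\<close> inherits differentiability and both Lipschitz
  constants.\<close>

lemma comp_inner_smooth_map:
  fixes r :: "nat \<Rightarrow> 'a::euclidean_space \<Rightarrow> 'b::euclidean_space"
  assumes A2: "inner_A2 \<mu> L Lxy Lyy n (comp_inner r)" and j: "j < n"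
  shows "r j differentiable (at x)" "smooth_map L Lxy (r j) (jac (r j))"
proof -
  have lip: "L-lipschitz_on UNIV (grad_y (comp_inner r j))" "Lxy-lipschitz_on UNIV (hess_xy (comp_inner r j))"
    and diff: "grad_y (comp_inner r j) differentiable (at z)" for z
    using A2 j unfolding inner_A2_def by blast+
  show d: "r j differentiable (at x)" for x
  proof -
    obtain D where D: "(grad_y (comp_inner r j) has_derivative D) (at (x, 0))"
      using diff by (auto simp: differentiable_def)
    have "((\<lambda>x. (x, 0 :: 'b)) has_derivative (\<lambda>h. (h, 0))) (at x)"
      by (intro has_derivative_Pair has_derivative_ident has_derivative_const)
    from has_derivative_compose[OF this D]
    have "((\<lambda>x. - r j x) has_derivative (\<lambda>h. D (h, 0))) (at x)" by (simp add: grad_y_comp_inner(1))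
    from has_derivative_minus[OF this] show ?thesis by (auto simp: differentiable_def)
  qed
  note J = jac_works(2)[OF d]
  show "smooth_map L Lxy (r j) (jac (r j))"
    unfolding smooth_map_def
  proof (intro conjI allI J lipschitz_onI)
    show "0 \<le> L" "0 \<le> Lxy" using lip by (auto simp: lipschitz_on_def)
    show "dist (r j x) (r j y) \<le> L * dist x y" for x y
      using lipschitz_onD[OF lip(1), of "(x, 0)" "(y, 0)"] by (simp add: grad_y_comp_inner(1) dist_Pair_Pair dist_minus)
    show "dist (jac (r j) x) (jac (r j) y) \<le> Lxy * dist x y" for x y
      using lipschitz_onD[OF lip(2), of "(x, 0)" "(y, 0)"] hess_xy_comp_inner[of r j, OF d]
      by (simp add: dist_Pair_Pair dist_minus)
  qed
qed

lemma composition_avg: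
  fixes f :: "nat \<Rightarrow> 'b::euclidean_space \<Rightarrow> real" and r :: "nat \<Rightarrow> 'a::euclidean_space \<Rightarrow> 'b"
  assumes "0 < m" "0 < n" "0 < L" "0 \<le> Cf"
    and A1: "assm_A1_smooth L m (comp_outer f :: nat \<Rightarrow> 'a \<times> 'b \<Rightarrow> real)"
      "assm_A1_bounded Cf m (comp_outer f :: nat \<Rightarrow> 'a \<times> 'b \<Rightarrow> real)"
    and A2: "inner_A2 \<mu> L Lxy Lyy n (comp_inner r)"
  shows "composition (avg m f) (grad (avg m f)) (avg n r) (avg n (\<lambda>j. jac (r j))) L Lxy Cf"
    and "\<And>i y. i < m \<Longrightarrow> norm (grad (f i) y) \<le> Cf"
proof -
  have G: "GDERIV (avg m f) y :> avg m (\<lambda>i. grad (f i)) y" for y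
    by (rule GDERIV_avg) (rule comp_outer_gradient(1)[OF A1(1)])
  have eq: "grad (avg m f) = avg m (\<lambda>i. grad (f i))" by (rule ext) (rule grad_eqI[OF G])
  show bd: "norm (grad (f i) y) \<le> Cf" if "i < m" for i y
  proof -
    have "grad_y (comp_outer f i :: 'a \<times> 'b \<Rightarrow> real) (0, y) = grad (f i) y"
      by (simp add: grad_y_def comp_outer_def)
    then show ?thesis using A1(2) that unfolding assm_A1_bounded_def by metis
  qed
  show "composition (avg m f) (grad (avg m f)) (avg n r) (avg n (\<lambda>j. jac (r j))) L Lxy Cf"
  proof
    show "GDERIV (avg m f) y :> grad (avg m f) y" for y unfolding eq by (rule G)
    show "L-lipschitz_on UNIV (grad (avg m f))"
      unfolding eq by (rule lipschitz_on_avg[OF \<open>0 < m\<close> comp_outer_gradient(3)[OF A1(1)]])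
    show "norm (grad (avg m f) y) \<le> Cf" for y
      unfolding eq avg_def by (rule norm_avg_le[OF \<open>0 < m\<close> bd])
    show "smooth_map L Lxy (avg n r) (avg n (\<lambda>j. jac (r j)))"
      by (rule smooth_map_avg[OF \<open>0 < n\<close> comp_inner_smooth_map(2)[OF A2]])
  qed (use assms in auto)
qed

text \<open>The assumption controls sums of y - r and of minus the Jacobian; the y-terms cancel
  against the mean, and the sign disappears in the norm. The gradient of an outer function has
  x-component 0, so its norm is that of the gradient of f.\<close>

lemma inner_A5_windows:
  fixes f :: "nat \<Rightarrow> 'b::euclidean_space \<Rightarrow> real" and r :: "nat \<Rightarrow> 'a::euclidean_space \<Rightarrow> 'b"
  assumes "0 < m" "0 < n"
    and A1: "assm_A1_smooth L m (comp_outer f :: nat \<Rightarrow> 'a \<times> 'b \<Rightarrow> real)"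
    and A2: "inner_A2 \<mu> L Lxy Lyy n (comp_inner r)"
    and A5: "inner_A5 \<alpha> C T m n (comp_outer f) (comp_inner r) \<xi> \<zeta> p"
    and range: "\<And>t. t < T \<Longrightarrow> \<xi> t < m" "\<And>t. t < T \<Longrightarrow> \<zeta> t < n"
    and \<alpha>: "\<alpha> \<le> 2" and T: "t + k \<le> T" and l: "l \<le> k" and p: "p t = (x, y)"
  defines "B \<equiv> real k * (real k powr (- \<alpha> / 2) * \<bar>C\<bar>)"
  shows "norm ((\<Sum>j<l. jac (r (\<zeta> (t + j))) x) - real l *\<^sub>R avg n (\<lambda>j. jac (r j)) x) \<le> B"
    and "norm ((\<Sum>j<l. r (\<zeta> (t + j)) x) - real l *\<^sub>R avg n r x) \<le> B"
    and "norm ((\<Sum>j<l. grad (f (\<xi> (t + j))) y) - real l *\<^sub>R grad (avg m f) y) \<le> B"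
proof -
  note bound = window_error_partial_sum[OF _ \<alpha> T l]
  have lt: "\<xi> (t + j) < m" "\<zeta> (t + j) < n" if "j < l" for j using range that T l by auto
  have hess: "hess_xy (comp_inner r j) z = - jac (r j) (fst z)" if "j < n" for j z
    by (rule hess_xy_comp_inner[of r j, OF comp_inner_smooth_map(1)[OF A2 that]])
  have "smooth_map L Lxy (avg n r) (avg n (\<lambda>j. jac (r j)))"
    by (rule smooth_map_avg[OF \<open>0 < n\<close> comp_inner_smooth_map(2)[OF A2]])
  then have hess_avg: "hess_xy (avg n (comp_inner r)) z = - avg n (\<lambda>j. jac (r j)) (fst z)" for z
    by (intro hess_xy_of_grad_y[where R = "avg n r"])
      (auto simp: smooth_map_def grad_y_comp_inner(2)[OF \<open>0 < n\<close>])
  have "norm ((\<Sum>j<l. hess_xy (comp_inner r (\<zeta> (t + j))) (p t)) - real l *\<^sub>R hess_xy (avg n (comp_inner r)) (p t)) \<le> B"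
    unfolding B_def by (rule bound) (use A5 in \<open>simp add: inner_A5_def\<close>)
  then show "norm ((\<Sum>j<l. jac (r (\<zeta> (t + j))) x) - real l *\<^sub>R avg n (\<lambda>j. jac (r j)) x) \<le> B"
    using lt by (simp add: p hess hess_avg sum_negf norm_minus_commute)
  have "norm ((\<Sum>j<l. grad_y (comp_inner r (\<zeta> (t + j))) (p t)) - real l *\<^sub>R grad_y (avg n (comp_inner r)) (p t)) \<le> B"
    unfolding B_def by (rule bound) (use A5 in \<open>simp add: inner_A5_def\<close>)
  then show "norm ((\<Sum>j<l. r (\<zeta> (t + j)) x) - real l *\<^sub>R avg n r x) \<le> B"
    using \<open>0 < n\<close> by (simp add: p grad_y_comp_inner sum_subtractf sum_constant_scaleR scaleR_diff_right norm_minus_commute)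
  have outer: "avg m (comp_outer f) = (\<lambda>z :: 'a \<times> 'b. avg m f (snd z))"
    by (auto simp: fun_eq_iff avg_def comp_outer_def)
  have "GDERIV (avg m f) y :> avg m (\<lambda>i. grad (f i)) y" for y
    by (rule GDERIV_avg) (rule comp_outer_gradient(1)[OF A1])
  then have G: "GDERIV (avg m f) y :> grad (avg m f) y" for y using grad_eqI by metis
  have "norm ((\<Sum>j<l. grad (comp_outer f (\<xi> (t + j))) (p t)) - real l *\<^sub>R grad (avg m (comp_outer f)) (p t)) \<le> B"
    unfolding B_def by (rule bound) (use A5 in \<open>simp add: inner_A5_def\<close>)
  moreover have "grad (avg m (comp_outer f)) (p t) = (0, grad (avg m f) y)"
    unfolding outer p by (rule grad_eqI) (rule GDERIV_snd, simp add: G)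
  moreover have "(\<Sum>j<l. grad (comp_outer f (\<xi> (t + j))) (p t)) = (0, \<Sum>j<l. grad (f (\<xi> (t + j))) y)"
    using comp_outer_gradient(2)[OF A1] lt by (simp add: p prod_eq_iff fst_sum snd_sum)
  ultimately show "norm ((\<Sum>j<l. grad (f (\<xi> (t + j))) y) - real l *\<^sub>R grad (avg m f) y) \<le> B"
    by (simp add: norm_Pair2)
qed

text \<open>After the first projection the iterates of \<open>u\<close> are convex combinations of vectors of norm at
  most \<open>\<iota>\<close>, so that all later projections do nothing, and the run is one of the projected states.\<close>

lemma wior_comp_projected:
  fixes f :: "nat \<Rightarrow> 'b::euclidean_space \<Rightarrow> real" and r :: "nat \<Rightarrow> 'a::euclidean_space \<Rightarrow> 'b"
    and I \<iota> \<eta> c \<xi> \<zeta> x0 y0 u0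
  defines "w \<equiv> wior_comp f r I \<iota> \<eta> (c * \<eta>) (c * \<eta>) \<xi> \<zeta> x0 y0 u0"
  defines "proj \<equiv> \<lambda>(x :: 'a, y :: 'b, u :: 'b). (x, y, closest_point (cball 0 \<iota>) u)"
  assumes \<iota>: "0 \<le> \<iota>" and c: "0 \<le> c * \<eta>" "c * \<eta> \<le> 1"
    and bd: "\<And>t y. t < T \<Longrightarrow> norm (grad (f (\<xi> t)) y) \<le> \<iota>"
    and diff: "\<And>t x. t < T \<Longrightarrow> r (\<zeta> t) differentiable (at x)"
    and t: "t < T"
  shows "proj (w (Suc t)) = proj (w t) + \<eta> *\<^sub>R comp_step c (r (\<zeta> t)) (jac (r (\<zeta> t))) (grad (f (\<xi> t))) (proj (w t))"
proof -
  have cp: "norm (closest_point (cball 0 \<iota>) u) \<le> \<iota>" for u :: 'b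
    using closest_point_in_set[of "cball 0 \<iota>" u] \<iota> by simp
  have self: "closest_point (cball 0 \<iota>) u = u" if "norm u \<le> \<iota>" for u :: 'b
    using that by (intro closest_point_self) simp
  have conv: "norm ((1 - c * \<eta>) *\<^sub>R u + (c * \<eta>) *\<^sub>R v) \<le> \<iota>" if "norm u \<le> \<iota>" "norm v \<le> \<iota>" for u v :: 'b
  proof -
    have "norm ((1 - c * \<eta>) *\<^sub>R u + (c * \<eta>) *\<^sub>R v) \<le> (1 - c * \<eta>) * norm u + (c * \<eta>) * norm v"
      using norm_triangle_ineq[of "(1 - c * \<eta>) *\<^sub>R u" "(c * \<eta>) *\<^sub>R v"] c by simp
    also have "\<dots> \<le> (1 - c * \<eta>) * \<iota> + (c * \<eta>) * \<iota>" using that c by (intro add_mono mult_left_mono) auto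
    finally show ?thesis by (simp add: algebra_simps)
  qed
  have main: "norm (snd (snd (w (Suc s)))) \<le> \<iota> \<and> w (Suc s) = proj (w s) +
      \<eta> *\<^sub>R comp_step c (r (\<zeta> s)) (jac (r (\<zeta> s))) (grad (f (\<xi> s))) (proj (w s))" if "s < T" for s
    using that
  proof (induction s)
    \<comment> \<open>The initial u may lie outside the ball, so here the projection can move it; at
      every later step of the run u is in the ball already.\<close>
    case (0)
    obtain x y u where w: "w 0 = (x, y, u)" by (cases "w 0")
    have "w (Suc 0) = (x - \<eta> *\<^sub>R transp (jac (r (\<zeta> 0)) x) (closest_point (cball 0 \<iota>) u),
        (1 - c * \<eta>) *\<^sub>R y + (c * \<eta>) *\<^sub>R r (\<zeta> 0) x,
        (1 - c * \<eta>) *\<^sub>R closest_point (cball 0 \<iota>) u + (c * \<eta>) *\<^sub>R grad (f (\<xi> 0)) y)"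
      using w jac_works(1)[OF diff[OF 0]] by (simp add: w_def transp_def Let_def)
    then show ?case using conv[OF cp bd[OF 0]] by (simp add: w proj_def comp_step_def algebra_simps)
  next
    case (Suc s)
    obtain x y u where w: "w (Suc s) = (x, y, u)" by (cases "w (Suc s)")
    \<comment> \<open>With u in the ball, \<open>self\<close> removes the projection whether or not
      an epoch starts at this step.\<close>
    have u: "norm u \<le> \<iota>" using Suc w by simp
    have "w (Suc (Suc s)) = (x - \<eta> *\<^sub>R transp (jac (r (\<zeta> (Suc s))) x) u,
        (1 - c * \<eta>) *\<^sub>R y + (c * \<eta>) *\<^sub>R r (\<zeta> (Suc s)) x,
        (1 - c * \<eta>) *\<^sub>R u + (c * \<eta>) *\<^sub>R grad (f (\<xi> (Suc s))) y)"
      using w jac_works(1)[OF diff[OF Suc.prems]] self[OF u]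
      unfolding w_def wior_comp.simps(2)[of _ _ _ _ _ _ _ _ _ _ _ _ "Suc s"] by (simp add: transp_def Let_def)
    then show ?case using conv[OF u bd[OF Suc.prems]] self[OF u]
      by (simp add: w proj_def comp_step_def algebra_simps)
  qed
  have "proj (w (Suc t)) = w (Suc t)"
    using main[OF t] self by (auto simp: proj_def split: prod.split)
  then show ?thesis using main[OF t] by simp
qed

section \<open>The guarantee for the compositional problem\<close>

text \<open>\<open>D + \<iota> / L\<close> bounds the initial \<open>track\<close> for any u0: D for
  y, and 1 / (2 L) times at most 2 \<iota> for u after the first projection. One \<open>c\<close>
  serves both learning-rate ratios.\<close>

definition comp_guarantee ::
  "real \<Rightarrow> real \<Rightarrow> real \<Rightarrow> real \<Rightarrow> real \<Rightarrow> real \<Rightarrow> real \<Rightarrow> real \<Rightarrow>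
   (nat \<Rightarrow> 'b \<Rightarrow> real) \<Rightarrow> (nat \<Rightarrow> 'a::euclidean_space \<Rightarrow> 'b::euclidean_space) \<Rightarrow> bool" where
  "comp_guarantee L Cf Lxy \<iota> c L0 K4 \<nu> f r \<longleftrightarrow> (\<forall>m n x0 y0 u0 \<Delta> D \<mu> Lyy \<alpha> C T k E \<epsilon> \<xi> \<zeta> I.
      0 < m \<and> 0 < n \<and>
      assm_A1_smooth L m (comp_outer f :: nat \<Rightarrow> 'a \<times> 'b \<Rightarrow> real) \<and>
      assm_A1_bounded Cf m (comp_outer f :: nat \<Rightarrow> 'a \<times> 'b \<Rightarrow> real) \<and>
      inner_A2 \<mu> L Lxy Lyy n (comp_inner r) \<and>
      (\<forall>x. comp_obj m n f r x0 - comp_obj m n f r x \<le> \<Delta>) \<and> dist y0 (avg n r x0) \<le> D \<and>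
      \<alpha> \<le> 2 \<and> 0 < k \<and> E * k \<le> T \<and> 0 < \<epsilon> \<and>
      80 * (K4 * (real k powr (- \<alpha> / 2) * \<bar>C\<bar>))\<^sup>2 \<le> \<epsilon>\<^sup>2 \<and> 8 * L0 * (\<Delta> + \<nu> * (D + \<iota> / L)\<^sup>2) < real E * \<epsilon>\<^sup>2 \<and>
      (\<forall>t<T. \<xi> t < m \<and> \<zeta> t < n) \<longrightarrow>
      comp_reaches \<alpha> C T (E * k) \<epsilon> m n f r \<xi> \<zeta>
        (wior_comp f r I \<iota> (1 / (real k * L0)) (c * (1 / (real k * L0))) (c * (1 / (real k * L0))) \<xi> \<zeta> x0 y0 u0))"

lemma comp_guaranteeD:
  fixes f :: "nat \<Rightarrow> 'b::euclidean_space \<Rightarrow> real" and r :: "nat \<Rightarrow> 'a::euclidean_space \<Rightarrow> 'b"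
  assumes "comp_guarantee L Cf Lxy \<iota> c L0 K4 \<nu> f r" "0 < m" "0 < n"
    "assm_A1_smooth L m (comp_outer f :: nat \<Rightarrow> 'a \<times> 'b \<Rightarrow> real)"
    "assm_A1_bounded Cf m (comp_outer f :: nat \<Rightarrow> 'a \<times> 'b \<Rightarrow> real)"
    "inner_A2 \<mu> L Lxy Lyy n (comp_inner r)"
    "\<forall>x. comp_obj m n f r x0 - comp_obj m n f r x \<le> \<Delta>" "dist y0 (avg n r x0) \<le> D"
    "0 < k" "0 < \<epsilon>" "8 * L0 * (\<Delta> + \<nu> * (D + \<iota> / L)\<^sup>2) < real E * \<epsilon>\<^sup>2"
    "80 * (K4 * (real k powr (- \<alpha> / 2) * \<bar>C\<bar>))\<^sup>2 \<le> \<epsilon>\<^sup>2" "\<alpha> \<le> 2" "E * k \<le> T"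
    "\<And>t. \<xi> t < m" "\<And>t. \<zeta> t < n"
  shows "comp_reaches \<alpha> C T (E * k) \<epsilon> m n f r \<xi> \<zeta>
    (wior_comp f r I \<iota> (1 / (real k * L0)) (c * (1 / (real k * L0))) (c * (1 / (real k * L0))) \<xi> \<zeta> x0 y0 u0)"
  by (rule assms(1)[unfolded comp_guarantee_def, rule_format, where \<mu> = \<mu> and Lyy = Lyy and
        \<Delta> = \<Delta> and D = D]) (use assms in auto)

lemma comp_converges:
  fixes L Cf Lxy \<iota> :: real
  assumes "0 < L" "0 \<le> Cf" "0 \<le> Lxy" "Cf \<le> \<iota>"
  shows "\<exists>c>0. \<exists>L0>0. \<exists>K4\<ge>0. \<exists>\<nu>\<ge>0.
    \<forall>(f :: nat \<Rightarrow> 'b \<Rightarrow> real) (r :: nat \<Rightarrow> 'a::euclidean_space \<Rightarrow> 'b::euclidean_space).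
      comp_guarantee L Cf Lxy \<iota> c L0 K4 \<nu> f r"
proof -
  define b where "b = 10 * (2 * L\<^sup>2 + 1) * (3 * L / 2 + (1 + 1 / (2 * L))) + 1"
  have "1 \<le> b" using assms by (simp add: b_def)
  \<comment> \<open>Here the decay rate is c / 2, so c is twice the required rate.\<close>
  define c where "c = 2 * (3 * L / 2 * (2 * L\<^sup>2 + 1) + (1 + 1 / (2 * L)) + b)"
  have "0 < c" using assms \<open>1 \<le> b\<close> by (simp add: c_def add_nonneg_pos add_pos_pos)
  define \<Lambda> where "\<Lambda> = L + Lxy * \<iota> + 2 * c * (L + 1)"
  have "0 < \<Lambda>" using assms \<open>0 < c\<close> by (simp add: \<Lambda>_def add_pos_nonneg)
  define K1 where "K1 = 2 * L\<^sup>2 + c + 3 * c * L"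
  have "0 \<le> K1" using assms \<open>0 < c\<close> by (simp add: K1_def)
  \<comment> \<open>The summand c gives \<open>H * c \<le> 1\<close>, which makes the contraction
    factors nonnegative and each update of u a convex combination.\<close>
  define L0 where "L0 = c + 32 * \<Lambda> + 2 * \<Lambda> * K1 + 192 * (L ^ 3 + Lxy * Cf) + b"
  have parts: "0 \<le> c" "0 \<le> 32 * \<Lambda>" "0 \<le> 2 * \<Lambda> * K1" "0 \<le> 192 * (L ^ 3 + Lxy * Cf)" "1 \<le> b"
    using assms \<open>0 < c\<close> \<open>0 < \<Lambda>\<close> \<open>1 \<le> b\<close> \<open>0 \<le> K1\<close> by auto
  have "0 < L0" unfolding L0_def using parts by linarith
  define H where "H = 1 / L0"
  have "0 < H" using \<open>0 < L0\<close> by (simp add: H_def)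
  have small: "u * H \<le> 1" if "u \<le> L0" for u using that \<open>0 < L0\<close> by (simp add: H_def)
  have "c * H \<le> 1" "32 * \<Lambda> * H \<le> 1" "2 * \<Lambda> * K1 * H \<le> 1" "192 * (L ^ 3 + Lxy * Cf) * H \<le> 1" "b * H \<le> 1"
    using parts by (auto intro!: small simp only: L0_def)
  then have small: "H * c \<le> 1" "32 * H * \<Lambda> \<le> 1" "2 * H * \<Lambda> * K1 \<le> 1"
      "192 * (L ^ 3 + Lxy * Cf) * H \<le> 1" "b * H \<le> 1"
    by (auto simp: mult_ac)
  define \<nu> where "\<nu> = 3 * (2 * L\<^sup>2 + 1)\<^sup>2 / b"
  have "0 \<le> \<nu>" using \<open>1 \<le> b\<close> by (simp add: \<nu>_def)
  have "0 \<le> \<iota>" using assms by simp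
  have "0 \<le> \<iota> + 2 * c" using \<open>0 \<le> \<iota>\<close> \<open>0 < c\<close> by simp
  show ?thesis
    unfolding comp_guarantee_def comp_reaches_def
  proof (rule exI[of _ c], rule conjI[OF \<open>0 < c\<close>], rule exI[of _ L0], rule conjI[OF \<open>0 < L0\<close>],
      rule exI[of _ "\<iota> + 2 * c"], rule conjI[OF \<open>0 \<le> \<iota> + 2 * c\<close>], rule exI[of _ \<nu>], rule conjI[OF \<open>0 \<le> \<nu>\<close>],
      intro allI impI, elim conjE)
    fix m n x0 y0 u0 \<Delta> D \<mu> Lyy \<alpha> C T k E \<epsilon> \<xi> \<zeta> I and f :: "nat \<Rightarrow> 'b \<Rightarrow> real" and r :: "nat \<Rightarrow> 'a \<Rightarrow> 'b"
    let ?\<eta> = "1 / (real k * L0)"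
    let ?w = "wior_comp f r I \<iota> ?\<eta> (c * ?\<eta>) (c * ?\<eta>) \<xi> \<zeta> x0 y0 u0"
    assume A1: "assm_A1_smooth L m (comp_outer f :: nat \<Rightarrow> 'a \<times> 'b \<Rightarrow> real)"
        "assm_A1_bounded Cf m (comp_outer f :: nat \<Rightarrow> 'a \<times> 'b \<Rightarrow> real)"
      and A2: "inner_A2 \<mu> L Lxy Lyy n (comp_inner r)"
      and \<Delta>: "\<forall>x. comp_obj m n f r x0 - comp_obj m n f r x \<le> \<Delta>"
      and D: "dist y0 (avg n r x0) \<le> D"
      and le: "0 < m" "0 < n" "\<alpha> \<le> 2" "0 < k" "E * k \<le> T" "0 < \<epsilon>"
      and \<delta>: "80 * ((\<iota> + 2 * c) * (real k powr (- \<alpha> / 2) * \<bar>C\<bar>))\<^sup>2 \<le> \<epsilon>\<^sup>2"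
      and E: "8 * L0 * (\<Delta> + \<nu> * (D + \<iota> / L)\<^sup>2) < real E * \<epsilon>\<^sup>2"
      and range: "\<forall>t<T. \<xi> t < m \<and> \<zeta> t < n"
      and A5: "inner_A5 \<alpha> C T m n (comp_outer f) (comp_inner r) \<xi> \<zeta> (\<lambda>t. (fst (?w t), fst (snd (?w t))))"
    interpret composition "avg m f" "grad (avg m f)" "avg n r" "avg n (\<lambda>j. jac (r j))" L Lxy Cf
      by (rule composition_avg[OF le(1,2) assms(1,2) A1 A2])
    note bd = composition_avg(2)[OF le(1,2) assms(1,2) A1 A2]
    have obj: "comp_obj m n f r = obj" by (rule ext) (simp add: comp_obj_def obj_def)
    define proj where "proj = (\<lambda>(x :: 'a, y :: 'b, u :: 'b). (x, y, closest_point (cball 0 \<iota>) u))"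
    have fst_proj: "fst (proj v) = fst v" for v by (simp add: proj_def split: prod.split)
    have cp: "norm (closest_point (cball 0 \<iota>) u) \<le> \<iota>" for u :: 'b
      using closest_point_in_set[of "cball 0 \<iota>" u] \<open>0 \<le> \<iota>\<close> by simp
    define V where "V z = obj (fst z) + \<nu> * (track z)\<^sup>2" for z
    have c\<eta>: "0 \<le> c * ?\<eta>" "c * ?\<eta> \<le> 1"
    proof -
      have "?\<eta> \<le> H" using le \<open>0 < L0\<close> by (simp add: H_def field_simps)
      then have "c * ?\<eta> \<le> c * H" using \<open>0 < c\<close> by (intro mult_left_mono) auto
      then show "c * ?\<eta> \<le> 1" using small(1) by (simp add: mult.commute)
    qed (use \<open>0 < c\<close> \<open>0 < L0\<close> in simp)
    \<comment> \<open>The potential is followed along the projected states, which obey the recursion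
      of \<open>comp_step\<close>. Projection leaves x and y alone, so the point found is an iterate
      of the algorithm, and the error bound along the run applies.\<close>
    have "\<exists>e<E. norm (hgrad (fst (proj (?w (e * k))))) \<le> \<epsilon>"
    proof (rule small_gradient_of_descent[where V = "\<lambda>e. V (proj (?w (e * k)))" and H = H and
          W = "\<Delta> + \<nu> * (D + \<iota> / L)\<^sup>2" and \<delta> = "(\<iota> + 2 * c) * (real k powr (- \<alpha> / 2) * \<bar>C\<bar>)"])
      fix e assume "e < E"
      then have "(e + 1) * k \<le> E * k" by (intro mult_right_mono) auto
      then have T: "e * k + k \<le> T" using le by simp
      obtain x y u where w: "?w (e * k) = (x, y, u)" by (cases "?w (e * k)")
      note windows = inner_A5_windows[OF le(1,2) A1(1) A2 A5 _ _ \<open>\<alpha> \<le> 2\<close> T]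
      have "V (proj (?w (e * k + k))) \<le> V (proj (?w (e * k + 0)))
          - H / 4 * (norm (hgrad (fst (proj (?w (e * k + 0))))))\<^sup>2
          + 10 * H * ((\<iota> + 2 * c) * (real k powr (- \<alpha> / 2) * \<bar>C\<bar>))\<^sup>2"
        unfolding V_def \<nu>_def
      proof (rule window_descent[where \<eta> = ?\<eta> and x = x and y = y and u = "closest_point (cball 0 \<iota>) u" and
            Rs = "\<lambda>j. r (\<zeta> (e * k + j))" and Js = "\<lambda>j. jac (r (\<zeta> (e * k + j)))" and Gs = "\<lambda>j. grad (f (\<xi> (e * k + j)))"])
        show "proj (?w (e * k + Suc j)) = proj (?w (e * k + j)) + ?\<eta> *\<^sub>R
            comp_step c (r (\<zeta> (e * k + j))) (jac (r (\<zeta> (e * k + j)))) (grad (f (\<xi> (e * k + j)))) (proj (?w (e * k + j)))"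
          if "j < k" for j
          unfolding add_Suc_right proj_def
        proof (rule wior_comp_projected[OF \<open>0 \<le> \<iota>\<close> c\<eta>, where T = T])
          show "norm (grad (f (\<xi> t)) y) \<le> \<iota>" if "t < T" for t y
            using bd[of "\<xi> t" y] range that \<open>Cf \<le> \<iota>\<close> by force
          show "r (\<zeta> t) differentiable (at x)" if "t < T" for t x
            using comp_inner_smooth_map(1)[OF A2] range that by blast
        qed (use T that in simp)
        show "smooth_map L Lxy (r (\<zeta> (e * k + j))) (jac (r (\<zeta> (e * k + j))))" if "j < k" for j
          using comp_inner_smooth_map(2)[OF A2] range T that by simp
        show "L-lipschitz_on UNIV (grad (f (\<xi> (e * k + j))))" if "j < k" for j
          using comp_outer_gradient(3)[OF A1(1)] range T that by simp
        show "norm ((\<Sum>j<l. jac (r (\<zeta> (e * k + j))) x) - real l *\<^sub>R avg n (\<lambda>j. jac (r j)) x)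
            \<le> real k * (real k powr (- \<alpha> / 2) * \<bar>C\<bar>)" if "l \<le> k" for l
          by (rule windows(1)) (use that range w in auto)
        show "norm ((\<Sum>j<l. r (\<zeta> (e * k + j)) x) - real l *\<^sub>R avg n r x)
            \<le> real k * (real k powr (- \<alpha> / 2) * \<bar>C\<bar>)" if "l \<le> k" for l
          by (rule windows(2)) (use that range w in auto)
        show "norm ((\<Sum>j<l. grad (f (\<xi> (e * k + j))) y) - real l *\<^sub>R grad (avg m f) y)
            \<le> real k * (real k powr (- \<alpha> / 2) * \<bar>C\<bar>)" if "l \<le> k" for l
          by (rule windows(3)) (use that range w in auto)
        show "H = real k * ?\<eta>" using le by (simp add: H_def)
        show "proj (?w (e * k + 0)) = (x, y, closest_point (cball 0 \<iota>) u)" 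
          by (simp only: add_0_right w proj_def prod.case)
        show "2 * H * \<Lambda> * (2 * L\<^sup>2 + c + 3 * c * L) \<le> 1" using small(3) by (simp add: K1_def)
        show "3 * L / 2 * (2 * L\<^sup>2 + 1) + (1 + 1 / (2 * L)) + b \<le> c / 2" by (simp add: c_def)
      qed (use \<open>0 < H\<close> \<open>0 < c\<close> \<open>0 < L0\<close> small b_def \<Lambda>_def cp in auto)
      then show "V (proj (?w (Suc e * k))) \<le> V (proj (?w (e * k)))
          - H / 4 * (norm (hgrad (fst (proj (?w (e * k))))))\<^sup>2
          + 10 * H * ((\<iota> + 2 * c) * (real k powr (- \<alpha> / 2) * \<bar>C\<bar>))\<^sup>2"
        by (simp add: add.commute)
    next
      have "obj (fst (proj (?w (E * k)))) \<le> V (proj (?w (E * k)))" using \<open>0 \<le> \<nu>\<close> by (simp add: V_def)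
      moreover have "track (proj (?w 0)) \<le> D + \<iota> / L"
      proof -
        have "norm (closest_point (cball 0 \<iota>) u0 - grad (avg m f) (avg n r x0)) \<le> 2 * \<iota>"
          using norm_triangle_ineq4[of "closest_point (cball 0 \<iota>) u0" "grad (avg m f) (avg n r x0)"]
            cp[of u0] bounded[of "avg n r x0"] \<open>Cf \<le> \<iota>\<close> by linarith
        then have "1 / (2 * L) * norm (closest_point (cball 0 \<iota>) u0 - grad (avg m f) (avg n r x0)) \<le> 1 / (2 * L) * (2 * \<iota>)"
          using \<open>0 < L\<close> by (intro mult_left_mono) auto
        then show ?thesis using D by (simp add: proj_def track_def dist_norm)
      qed
      then have "(track (proj (?w 0)))\<^sup>2 \<le> (D + \<iota> / L)\<^sup>2"
        using \<open>0 < L\<close> by (intro power_mono) (auto simp: track_def proj_def)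
      then have "V (proj (?w 0)) \<le> obj x0 + \<nu> * (D + \<iota> / L)\<^sup>2"
        using \<open>0 \<le> \<nu>\<close> by (simp add: V_def fst_proj mult_left_mono)
      ultimately show "V (proj (?w (0 * k))) - V (proj (?w (E * k))) \<le> \<Delta> + \<nu> * (D + \<iota> / L)\<^sup>2"
        using \<Delta>[rule_format, of "fst (proj (?w (E * k)))"] by (simp add: obj)
      show "8 * (\<Delta> + \<nu> * (D + \<iota> / L)\<^sup>2) < real E * H * \<epsilon>\<^sup>2" using E \<open>0 < L0\<close> by (simp add: H_def field_simps)
    qed (use \<open>0 < H\<close> le \<delta> in auto)
    then obtain e where "e < E" "norm (hgrad (fst (?w (e * k)))) \<le> \<epsilon>" by (auto simp: fst_proj)
    then show "\<exists>t\<le>E * k. stationary \<epsilon> (comp_obj m n f r) (fst (?w t))"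
      unfolding stationary_def obj using GDERIV_obj by (intro exI[of _ "e * k"]) auto
  qed
qed

section \<open>Sample complexity\<close>

lemma permutation_order_lt:
  assumes "permutation_order m s" "0 < m"
  shows "s t < m"
proof -
  have "s (t div m * m + t mod m) \<in> (\<lambda>i. s (t div m * m + i)) ` {..<m}" using \<open>0 < m\<close> by (intro imageI) simp
  also have "\<dots> = {..<m}" using assms(1) unfolding permutation_order_def by (blast dest: bij_betw_imp_surj_on)
  finally show ?thesis by simp
qed

text \<open>\<open>indep_vars\<close> includes measurability into \<open>count_space S\<close>,
  whose space is S, so membership holds at every outcome and not merely almost surely.\<close>

lemma independent_sampling_mem:
  assumes "independent_sampling M S s" "\<omega> \<in> space M"
  shows "s t \<omega> \<in> S"
proof -
  interpret prob_space M using assms(1) by (simp add: independent_sampling_def)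
  have "s t \<in> measurable M (count_space S)"
    using assms(1) by (auto simp: independent_sampling_def indep_vars_def)
  then show ?thesis using measurable_space[of "s t" M "count_space S" \<omega>] assms(2) by simp
qed

text \<open>k is about 9 K4 A Q / \<epsilon> raised to the power 2 / \<alpha>, which brings K4 times
  the window error below \<epsilon> / 9, and 81 is the first square above 80. E is about W divided
  by the square of \<epsilon>.\<close>

lemma sample_size:
  fixes \<alpha> A Q \<epsilon> W K4 :: real
  assumes "0 \<le> A" "0 \<le> K4" "0 \<le> W" "1 \<le> Q" "0 < \<epsilon>" "\<epsilon> \<le> 1" and \<alpha>: "\<alpha> = 1 \<or> \<alpha> = 2"
  obtains k E :: nat where "0 < k" "80 * (K4 * (real k powr (- \<alpha> / 2) * (Q * A)))\<^sup>2 \<le> \<epsilon>\<^sup>2"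
    "W < real E * \<epsilon>\<^sup>2"
    "real (E * k) \<le> (W + 2) * (81 * (K4 * A)\<^sup>2 + 9 * (K4 * A) + 2) * ((Q / \<epsilon>) powr (2 / \<alpha>) / \<epsilon>\<^sup>2)"
proof -
  define a where "a = 9 * (K4 * A)"
  have "0 \<le> a" using assms by (simp add: a_def)
  define x where "x = (a * (Q / \<epsilon>)) powr (2 / \<alpha>)"
  \<comment> \<open>The + 1 keeps k positive when A = 0; the one in E makes its inequality
    strict.\<close>
  define k where "k = nat \<lceil>x\<rceil> + 1"
  define E where "E = nat \<lceil>W / \<epsilon>\<^sup>2\<rceil> + 1"
  have "0 \<le> x" by (simp add: x_def)
  have "1 \<le> Q / \<epsilon>" using assms by (simp add: field_simps)
  have "x \<le> real k" by (simp add: k_def) linarith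
  have k2: "real k \<le> x + 2" using \<open>0 \<le> x\<close> by (simp add: k_def) linarith
  have E1: "W / \<epsilon>\<^sup>2 < real E" by (simp add: E_def) linarith
  have E2: "real E \<le> W / \<epsilon>\<^sup>2 + 2" using assms by (simp add: E_def) linarith
  have "\<alpha> > 0" using \<alpha> by auto
  have "a * (Q / \<epsilon>) = x powr (\<alpha> / 2)"
    using \<open>0 \<le> a\<close> assms \<open>\<alpha> > 0\<close> unfolding x_def powr_powr by simp
  also have "\<dots> \<le> real k powr (\<alpha> / 2)" using \<open>0 \<le> x\<close> \<open>x \<le> real k\<close> \<open>\<alpha> > 0\<close> by (intro powr_mono2) auto
  finally have "a * Q \<le> \<epsilon> * real k powr (\<alpha> / 2)" using assms by (simp add: field_simps)
  then have "9 * (K4 * (real k powr (- \<alpha> / 2) * (Q * A))) \<le> \<epsilon>"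
    by (simp add: a_def powr_minus_divide divide_simps k_def mult_ac)
  moreover have "0 \<le> K4 * (real k powr (- \<alpha> / 2) * (Q * A))" using assms by simp
  ultimately have "(9 * (K4 * (real k powr (- \<alpha> / 2) * (Q * A))))\<^sup>2 \<le> \<epsilon>\<^sup>2" by (intro power_mono) auto
  then have 81: "81 * (K4 * (real k powr (- \<alpha> / 2) * (Q * A)))\<^sup>2 \<le> \<epsilon>\<^sup>2" by (simp add: power_mult_distrib)
  have "80 * (K4 * (real k powr (- \<alpha> / 2) * (Q * A)))\<^sup>2 \<le> 81 * (K4 * (real k powr (- \<alpha> / 2) * (Q * A)))\<^sup>2"
    by (intro mult_right_mono) auto
  with 81 have 1: "80 * (K4 * (real k powr (- \<alpha> / 2) * (Q * A)))\<^sup>2 \<le> \<epsilon>\<^sup>2" by linarith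
  have 2: "W < real E * \<epsilon>\<^sup>2" using E1 assms by (simp add: field_simps)
  define B where "B = (Q / \<epsilon>) powr (2 / \<alpha>)"
  have "1 \<le> B" using \<open>1 \<le> Q / \<epsilon>\<close> \<open>\<alpha> > 0\<close> by (simp add: B_def ge_one_powr_ge_zero)
  have "x = a powr (2 / \<alpha>) * B"
    unfolding x_def B_def by (rule powr_mult)
  \<comment> \<open>\<open>a powr (2 / \<alpha>)\<close> is the square of a or a itself; their sum
    gives one constant for both sampling schemes.\<close>
  also have "\<dots> \<le> (a\<^sup>2 + a) * B"
    using \<alpha> \<open>0 \<le> a\<close> \<open>1 \<le> B\<close> by (intro mult_right_mono) (auto simp: powr_numeral)
  finally have "real k \<le> (a\<^sup>2 + a + 2) * B" using k2 \<open>1 \<le> B\<close> by (simp add: algebra_simps)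
  moreover have "real E \<le> (W + 2) / \<epsilon>\<^sup>2"
  proof -
    have "\<epsilon>\<^sup>2 \<le> 1" using assms by (simp add: power_le_one)
    then have "2 \<le> 2 / \<epsilon>\<^sup>2" using assms by (simp add: field_simps)
    then show ?thesis using E2 by (simp add: add_divide_distrib)
  qed
  ultimately have "real E * real k \<le> (W + 2) / \<epsilon>\<^sup>2 * ((a\<^sup>2 + a + 2) * B)"
    using assms by (intro mult_mono) auto
  then have 3: "real (E * k) \<le> (W + 2) * (81 * (K4 * A)\<^sup>2 + 9 * (K4 * A) + 2) * (B / \<epsilon>\<^sup>2)"
    by (simp add: a_def power_mult_distrib mult_ac)
  show ?thesis
    by (rule that[OF _ 1 2 3[unfolded B_def]]) (simp add: k_def)
qed

lemma sample_size_independent: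
  fixes A W K4 \<epsilon> :: real
  assumes "0 \<le> A" "0 \<le> K4" "0 \<le> W" "0 < \<epsilon>" "\<epsilon> \<le> 1"
  obtains k E :: nat where "0 < k" "80 * (K4 * (real k powr (- 1 / 2) * \<bar>A\<bar>))\<^sup>2 \<le> \<epsilon>\<^sup>2"
    "W < real E * \<epsilon>\<^sup>2"
    "soft_O_le ((W + 2) * (81 * (K4 * A)\<^sup>2 + 9 * (K4 * A) + 2)) 0 (1 / \<epsilon> ^ 4) (E * k)"
proof (rule sample_size[of A K4 W 1 \<epsilon> 1])
  fix k E :: nat
  assume *: "0 < k" "80 * (K4 * (real k powr (- 1 / 2) * (1 * A)))\<^sup>2 \<le> \<epsilon>\<^sup>2" "W < real E * \<epsilon>\<^sup>2"
    "real (E * k) \<le> (W + 2) * (81 * (K4 * A)\<^sup>2 + 9 * (K4 * A) + 2) * ((1 / \<epsilon>) powr (2 / 1) / \<epsilon>\<^sup>2)"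
  have eq: "(1 / \<epsilon>) powr (2 / 1) / \<epsilon>\<^sup>2 = 1 / \<epsilon> ^ 4"
    using assms by (simp add: powr_numeral power_divide power2_eq_square power4_eq_xxxx)
  show thesis
    using *(1-3) *(4)[unfolded eq] assms by (intro that) (simp_all add: soft_O_le_def)
qed (use assms in auto)

lemma sample_size_permutation:
  fixes A W K4 Q \<epsilon> :: real
  assumes "0 \<le> A" "0 \<le> K4" "0 \<le> W" "1 \<le> Q" "0 < \<epsilon>" "\<epsilon> \<le> 1"
  obtains k E :: nat where "0 < k" "80 * (K4 * (real k powr (- 2 / 2) * \<bar>Q * A\<bar>))\<^sup>2 \<le> \<epsilon>\<^sup>2"
    "W < real E * \<epsilon>\<^sup>2"
    "soft_O_le ((W + 2) * (81 * (K4 * A)\<^sup>2 + 9 * (K4 * A) + 2)) 0 (Q / \<epsilon> ^ 3) (E * k)"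
proof (rule sample_size[of A K4 W Q \<epsilon> 2])
  fix k E :: nat
  assume *: "0 < k" "80 * (K4 * (real k powr (- 2 / 2) * (Q * A)))\<^sup>2 \<le> \<epsilon>\<^sup>2" "W < real E * \<epsilon>\<^sup>2"
    "real (E * k) \<le> (W + 2) * (81 * (K4 * A)\<^sup>2 + 9 * (K4 * A) + 2) * ((Q / \<epsilon>) powr (2 / 2) / \<epsilon>\<^sup>2)"
  have "(Q / \<epsilon>) powr (2 / 2) / \<epsilon>\<^sup>2 = Q / \<epsilon> ^ 3"
    using assms by (simp add: power2_eq_square power3_eq_cube)
  moreover have "\<bar>Q * A\<bar> = Q * A" using assms by simp
  ultimately show thesis using * by (intro that) (auto simp: soft_O_le_def simp del: abs_mult)
qed (use assms in auto)

theorem corollaryB20: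
  fixes \<mu> L C\<^sub>f L\<^sub>x\<^sub>y L\<^sub>y\<^sub>y \<iota> :: real
  assumes "0 < \<mu>" "0 < L" "0 \<le> C\<^sub>f" "0 \<le> L\<^sub>x\<^sub>y" "0 \<le> L\<^sub>y\<^sub>y" "C\<^sub>f \<le> \<iota>"
  shows
    "(\<exists>c1>0. \<exists>c2>0. \<exists>L0>0. \<forall>A\<ge>0. \<forall>\<Delta> D. \<exists>K p.
        \<forall>m n (f :: nat \<Rightarrow> 'b \<Rightarrow> real) (r :: nat \<Rightarrow> 'a::euclidean_space \<Rightarrow> 'b::euclidean_space) x0 y0 u0 q \<epsilon>.
          0 < m \<and> 0 < n \<and> 0 \<le> q \<and> q \<le> 1 \<and> 0 < \<epsilon> \<and> \<epsilon> \<le> 1 \<and>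
          assm_A1_smooth L m (comp_outer f :: nat \<Rightarrow> 'a \<times> 'b \<Rightarrow> real) \<and>
          assm_A1_bounded C\<^sub>f m (comp_outer f :: nat \<Rightarrow> 'a \<times> 'b \<Rightarrow> real) \<and>
          inner_A2 \<mu> L L\<^sub>x\<^sub>y L\<^sub>y\<^sub>y n (comp_inner r) \<and>
          assm_A3 A m (comp_outer f :: nat \<Rightarrow> 'a \<times> 'b \<Rightarrow> real) \<and>
          inner_A4 A n (comp_inner r) \<and>
          (\<forall>x. comp_obj m n f r x0 - comp_obj m n f r x \<le> \<Delta>) \<and> dist y0 (avg n r x0) \<le> D
          \<longrightarrow>
          (\<exists>k \<eta> N. 0 < k \<and> 0 < \<eta> \<and> \<eta> \<le> 1 / (real k * L0) \<and> soft_O_le K p (1 / \<epsilon> ^ 4) N \<and>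
            (\<forall>E R. E * k = R * lcm m n \<and> N \<le> E * k \<longrightarrow>
              (\<forall>(M :: 'w measure) s. independent_sampling M ({..<m} \<times> {..<n}) s \<longrightarrow>
                (\<forall>\<omega>\<in>space M.
                  let \<xi> = (\<lambda>t. fst (s t \<omega>)); \<zeta> = (\<lambda>t. snd (s t \<omega>))
                  in comp_reaches 1 A (E * k) N \<epsilon> m n f r \<xi> \<zeta>
                      (wior_comp f r (lcm m n) \<iota> \<eta> (c1 * \<eta>) (c2 * \<eta>) \<xi> \<zeta> x0 y0 u0))))) \<and>
          (\<exists>k \<eta> N. 0 < k \<and> 0 < \<eta> \<and> \<eta> \<le> 1 / (real k * L0) \<and>
            soft_O_le K p (real (max m n) powr q / \<epsilon> ^ 3) N \<and>
            (\<forall>E R. E * k = R * lcm m n \<and> N \<le> E * k \<longrightarrow>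
              (\<forall>\<xi> \<zeta>. permutation_order m \<xi> \<and> permutation_order n \<zeta> \<longrightarrow>
                comp_reaches 2 (real (max m n) powr q * A) (E * k) N \<epsilon> m n f r \<xi> \<zeta>
                  (wior_comp f r (lcm m n) \<iota> \<eta> (c1 * \<eta>) (c2 * \<eta>) \<xi> \<zeta> x0 y0 u0)))))
     \<and>
     (\<exists>c1>0. \<exists>L0>0. \<forall>A\<ge>0. \<forall>\<Delta> D. \<exists>K p.
        \<forall>m (f :: nat \<Rightarrow> 'a \<times> 'b \<Rightarrow> real) x0 y0 q \<epsilon>.
          0 < m \<and> 0 \<le> q \<and> q \<le> 1 \<and> 0 < \<epsilon> \<and> \<epsilon> \<le> 1 \<and>
          assm_A1_smooth L m f \<and>
          assm_A2 \<mu> L L\<^sub>x\<^sub>y L\<^sub>y\<^sub>y m (neg_fam f) \<and>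
          assm_A3 A m f \<and>
          assm_A4 A m (neg_fam f) \<and>
          (\<forall>x. minimax_obj m f x0 - minimax_obj m f x \<le> \<Delta>) \<and>
          dist y0 (ARG_MAX (\<lambda>y. avg m f (x0, y)) y. True) \<le> D
          \<longrightarrow>
          (\<exists>k \<eta> N. 0 < k \<and> 0 < \<eta> \<and> \<eta> \<le> 1 / (real k * L0) \<and> soft_O_le K p (1 / \<epsilon> ^ 4) N \<and>
            (\<forall>E R. E * k = R * m \<and> N \<le> E * k \<longrightarrow>
              (\<forall>(M :: 'w measure) s. independent_sampling M {..<m} s \<longrightarrow>
                (\<forall>\<omega>\<in>space M.
                  let \<xi> = (\<lambda>t. s t \<omega>)
                  in minimax_reaches 1 A (E * k) N \<epsilon> m f \<xi> (wior_minimax f \<eta> (c1 * \<eta>) \<xi> x0 y0))))) \<and>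
          (\<exists>k \<eta> N. 0 < k \<and> 0 < \<eta> \<and> \<eta> \<le> 1 / (real k * L0) \<and>
            soft_O_le K p (real m powr q / \<epsilon> ^ 3) N \<and>
            (\<forall>E R. E * k = R * m \<and> N \<le> E * k \<longrightarrow>
              (\<forall>\<xi>. permutation_order m \<xi> \<longrightarrow>
                minimax_reaches 2 (real m powr q * A) (E * k) N \<epsilon> m f \<xi>
                  (wior_minimax f \<eta> (c1 * \<eta>) \<xi> x0 y0)))))"

proof (rule conjI, goal_cases)
  case 1
  from comp_converges[of L C\<^sub>f L\<^sub>x\<^sub>y \<iota>] assms
  obtain c L0 K4 \<nu> where pos: "0 < c" "0 < L0" "0 \<le> K4"
    and conv: "\<And>(f :: nat \<Rightarrow> 'b \<Rightarrow> real) (r :: nat \<Rightarrow> 'a \<Rightarrow> 'b). comp_guarantee L C\<^sub>f L\<^sub>x\<^sub>y \<iota> c L0 K4 \<nu> f r"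
    by blast
  \<comment> \<open>Both ratios \<open>c1\<close> and \<open>c2\<close> are the \<open>c\<close> of
    the guarantee.\<close>
  show ?case
  proof (rule exI[of _ c], rule conjI[OF pos(1)], rule exI[of _ c], rule conjI[OF pos(1)],
      rule exI[of _ L0], rule conjI[OF pos(2)], intro allI impI, goal_cases)
    case (1 A \<Delta> D)
    \<comment> \<open>K has to be named before the hypotheses that constrain \<Delta> and D; the
      maximum with 0 supplies the sign that \<open>sample_size\<close> asks for.\<close>
    define W where "W = max 0 (8 * L0 * (\<Delta> + \<nu> * (D + \<iota> / L)\<^sup>2))"
    have W: "0 \<le> W" "8 * L0 * (\<Delta> + \<nu> * (D + \<iota> / L)\<^sup>2) \<le> W" by (auto simp: W_def)
    show ?case
    proof (rule exI[of _ "(W + 2) * (81 * (K4 * A)\<^sup>2 + 9 * (K4 * A) + 2)"], rule exI[of _ 0],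
        intro allI impI, elim conjE, goal_cases)
      case (1 m n f r x0 y0 u0 q \<epsilon>)
      have Q: "1 \<le> real (max m n) powr q" using 1 by (intro ge_one_powr_ge_zero) auto
      \<comment> \<open>The premises common to both schemes are discharged here; those on k, E, the
        run length and the example order remain.\<close>
      note reach = comp_guaranteeD[OF conv \<open>0 < m\<close> \<open>0 < n\<close> \<open>assm_A1_smooth _ _ _\<close> \<open>assm_A1_bounded _ _ _\<close>
          \<open>inner_A2 _ _ _ _ _ _\<close> \<open>\<forall>x. _ \<le> \<Delta>\<close> \<open>dist _ _ \<le> D\<close> _ \<open>0 < \<epsilon>\<close> order.strict_trans1[OF W(2)]]
      show ?case
      proof (rule conjI, goal_cases)
        case 1
        obtain k E where k: "0 < k" "80 * (K4 * (real k powr (- 1 / 2) * \<bar>A\<bar>))\<^sup>2 \<le> \<epsilon>\<^sup>2" "W < real E * \<epsilon>\<^sup>2"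
          and N: "soft_O_le ((W + 2) * (81 * (K4 * A)\<^sup>2 + 9 * (K4 * A) + 2)) 0 (1 / \<epsilon> ^ 4) (E * k)"
          by (rule sample_size_independent[OF \<open>0 \<le> A\<close> pos(3) W(1) \<open>0 < \<epsilon>\<close> \<open>\<epsilon> \<le> 1\<close>])
        show ?case
        proof (rule exI[of _ k], rule exI[of _ "1 / (real k * L0)"], rule exI[of _ "E * k"],
            intro conjI allI impI ballI, goal_cases)
          \<comment> \<open>N is \<open>E * k\<close> for the E found above, while the run has
            length \<open>E' * k\<close>; \<open>E * k \<le> E' * k\<close> places the first E
            windows inside the run.\<close>
          case (5 E' R M s \<omega>)
          have "s t \<omega> \<in> {..<m} \<times> {..<n}" for t by (rule independent_sampling_mem[OF 5(2,3)])
          then have "fst (s t \<omega>) < m" "snd (s t \<omega>) < n" for t by (auto simp: mem_Times_iff)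
          moreover have "E * k \<le> E' * k" using 5(1) by blast
          ultimately show ?case unfolding Let_def by (intro reach[OF k(1,3,2)]) auto
        qed (use k pos N in auto)
      next
        case 2
        obtain k E where k: "0 < k" "80 * (K4 * (real k powr (- 2 / 2) * \<bar>real (max m n) powr q * A\<bar>))\<^sup>2 \<le> \<epsilon>\<^sup>2"
            "W < real E * \<epsilon>\<^sup>2"
          and N: "soft_O_le ((W + 2) * (81 * (K4 * A)\<^sup>2 + 9 * (K4 * A) + 2)) 0
            (real (max m n) powr q / \<epsilon> ^ 3) (E * k)"
          by (rule sample_size_permutation[OF \<open>0 \<le> A\<close> pos(3) W(1) Q \<open>0 < \<epsilon>\<close> \<open>\<epsilon> \<le> 1\<close>])
        show ?case
        proof (rule exI[of _ k], rule exI[of _ "1 / (real k * L0)"], rule exI[of _ "E * k"],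
            intro conjI allI impI, goal_cases)
          case (5 E' R \<xi> \<zeta>)
          then have "E * k \<le> E' * k" "\<And>t. \<xi> t < m" "\<And>t. \<zeta> t < n"
            using permutation_order_lt \<open>0 < m\<close> \<open>0 < n\<close> by blast+
          then show ?case by (intro reach[OF k(1,3,2)]) auto
        qed (use k pos N in auto)
      qed
    qed
  qed
next
  case 2
  from minimax_converges[of \<mu> L] assms
  obtain c L0 K4 \<nu> where pos: "0 < c" "0 < L0" "0 \<le> K4"
    and conv: "\<And>f :: nat \<Rightarrow> 'a \<times> 'b \<Rightarrow> real. minimax_guarantee \<mu> L c L0 K4 \<nu> f"
    by blast
  show ?case
  proof (rule exI[of _ c], rule conjI[OF pos(1)],
      rule exI[of _ L0], rule conjI[OF pos(2)], intro allI impI, goal_cases)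
    case (1 A \<Delta> D)
    \<comment> \<open>The initial tracking error is now the distance from y0 to the maximiser alone,
      so D stands by itself.\<close>
    define W where "W = max 0 (8 * L0 * (\<Delta> + \<nu> * D\<^sup>2))"
    have W: "0 \<le> W" "8 * L0 * (\<Delta> + \<nu> * D\<^sup>2) \<le> W" by (auto simp: W_def)
    show ?case
    proof (rule exI[of _ "(W + 2) * (81 * (K4 * A)\<^sup>2 + 9 * (K4 * A) + 2)"], rule exI[of _ 0],
        intro allI impI, elim conjE, goal_cases)
      case (1 m f x0 y0 q \<epsilon>)
      have Q: "1 \<le> real m powr q" using 1 by (intro ge_one_powr_ge_zero) auto
      note reach = minimax_guaranteeD[OF conv \<open>0 < m\<close> \<open>assm_A1_smooth _ _ _\<close> \<open>assm_A2 _ _ _ _ _ _\<close>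
          \<open>\<forall>x. _ \<le> \<Delta>\<close> \<open>dist _ _ \<le> D\<close> _ \<open>0 < \<epsilon>\<close> order.strict_trans1[OF W(2)]]
      show ?case
      proof (rule conjI, goal_cases)
        case 1
        obtain k E where k: "0 < k" "80 * (K4 * (real k powr (- 1 / 2) * \<bar>A\<bar>))\<^sup>2 \<le> \<epsilon>\<^sup>2" "W < real E * \<epsilon>\<^sup>2"
          and N: "soft_O_le ((W + 2) * (81 * (K4 * A)\<^sup>2 + 9 * (K4 * A) + 2)) 0 (1 / \<epsilon> ^ 4) (E * k)"
          by (rule sample_size_independent[OF \<open>0 \<le> A\<close> pos(3) W(1) \<open>0 < \<epsilon>\<close> \<open>\<epsilon> \<le> 1\<close>])
        show ?case
        proof (rule exI[of _ k], rule exI[of _ "1 / (real k * L0)"], rule exI[of _ "E * k"],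
            intro conjI allI impI ballI, goal_cases)
          case (5 E' R M s \<omega>)
          have "s t \<omega> \<in> {..<m}" for t by (rule independent_sampling_mem[OF 5(2,3)])
          moreover have "E * k \<le> E' * k" using 5(1) by blast
          ultimately show ?case unfolding Let_def by (intro reach[OF k(1,3,2)]) auto
        qed (use k pos N in auto)
      next
        case 2
        obtain k E where k: "0 < k" "80 * (K4 * (real k powr (- 2 / 2) * \<bar>real m powr q * A\<bar>))\<^sup>2 \<le> \<epsilon>\<^sup>2"
            "W < real E * \<epsilon>\<^sup>2"
          and N: "soft_O_le ((W + 2) * (81 * (K4 * A)\<^sup>2 + 9 * (K4 * A) + 2)) 0 (real m powr q / \<epsilon> ^ 3) (E * k)"
          by (rule sample_size_permutation[OF \<open>0 \<le> A\<close> pos(3) W(1) Q \<open>0 < \<epsilon>\<close> \<open>\<epsilon> \<le> 1\<close>])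
        show ?case
        proof (rule exI[of _ k], rule exI[of _ "1 / (real k * L0)"], rule exI[of _ "E * k"],
            intro conjI allI impI, goal_cases)
          case (5 E' R \<xi>)
          then have "E * k \<le> E' * k" "\<And>t. \<xi> t < m"
            using permutation_order_lt \<open>0 < m\<close> by blast+
          then show ?case by (intro reach[OF k(1,3,2)]) auto
        qed (use k pos N in auto)
      qed
    qed
  qed
qed

end
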